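(* Let $\mathcal{G}$ be an étale groupoid with compact Hausdorff unit space. The Hamana boundary $\partial_H\mathcal{G}$ and the Furstenberg boundary $\partial_F\mathcal{G}$ are isomorphic as $\mathcal{G}$-spaces.
   Context: Groupoids. $r,s$ denote range and source, $gh$ is defined iff $r(h)=s(g)$; $\mathcal{G}_x=s^{-1}(x)$. Étale means $r,s$ are local homeomorphisms ($\mathcal{G}$ need not be Hausdorff). $\Gamma(\mathcal{G})$ is the inverse semigroup of open bisections (open $\gamma\subseteq\mathcal{G}$ on which $s$ and $r$ are homeomorphisms onto their images), with setwise product and $\gamma^*=\gamma^{-1}$; $\operatorname{supp}\gamma=s(\gamma)$, $\operatorname{im}\gamma=r(\gamma)$, $\psi_\gamma=r|_\gamma\circ(s|_\gamma)^{-1}$. Furstenberg boundary. A compact $\mathcal{G}$-space is a compact Hausdorff space $Y$ with a continuous surjection $p:Y\to\mathcal{G}^{(0)}$ and a continuous (associative, unital) action $(g,y)\mapsto gy$ defined for $s(g)=p(y)$, with $p(gy)=r(g)$. If $\mu$ is a probability measure on $Y$ with $p_*\mu=\delta_x$ and $g\in\mathcal{G}_x$, then $g\mu$ is the push-forward of $\mu$ under $p^{-1}(x)\to p^{-1}(r(g))$, $y\mapsto gy$. $Y$ is identified with the Dirac measures in the space $\mathcal{P}(Y)$ of probability measures (weak* topology). $Y$ is irreducible if the only closed $\mathcal{G}$-invariant $Z\subseteq Y$ with $p(Z)=\mathcal{G}^{(0)}$ is $Y$. $Y$ is strongly proximal if for every family $(\mu_x)_{x\in\mathcal{G}^{(0)}}$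 in $\mathcal{P}(Y)$ with $p_*\mu_x=\delta_x$ one has $\mathcal{G}^{(0)}\subseteq p(Y\cap\overline{\{g\mu_x: x\in\mathcal{G}^{(0)},g\in\mathcal{G}_x\}})$. A $\mathcal{G}$-boundary is an irreducible strongly proximal compact $\mathcal{G}$-space. $\partial_F\mathcal{G}$ is the (unique up to isomorphism) $\mathcal{G}$-boundary that admits a $\mathcal{G}$-map (continuous equivariant map) onto every $\mathcal{G}$-boundary. $\mathcal{G}$-$C^*$-algebras. For a unital inclusion $C(\mathcal{G}^{(0)})\subseteq A$ and open $U\subseteq\mathcal{G}^{(0)}$ put $A_U=\overline{C_0(U)AC_0(U)}$. A unital $\mathcal{G}$-$C^*$-algebra is a unital $C^*$-algebra $A$ with an injective unital $*$-homomorphism $\iota:C(\mathcal{G}^{(0)})\to A$ and $*$-isomorphisms $\alpha_\gamma:A_{\operatorname{supp}\gamma}\to A_{\operatorname{im}\gamma}$, $\gamma\in\Gamma(\mathcal{G})$, such that $\alpha_\gamma(\iota(f))=\iota(f\circ\psi_{\gamma^*})$ for $f\in C_0(\operatorname{supp}\gamma)$ and $\alpha_{\gamma_1}\alpha_{\gamma_2}=\alpha_{\gamma_1\gamma_2}$ on $A_{\psi_{\gamma_2^*}(\operatorname{supp}\gamma_1\cap\operatorname{im}\gamma_2)}$. A $\mathcal{G}$-ucp map is a unital completely positive map compatible with the inclusions of $C(\mathcal{G}^{(0)})$ and intertwining the $\alpha_\gamma$'s; an embedding is a $\mathcal{G}$-ucp map that is a complete order embedding. Commutative unital $\mathcal{G}$-$C^*$-algebras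 $C(Y)$ correspond to compact $\mathcal{G}$-spaces $p:Y\to\mathcal{G}^{(0)}$ via $\iota(f)=f\circ p$ and $\alpha_\gamma(f)(y)=f(h^{-1}y)$ for $p(y)\in\operatorname{im}\gamma$, where $h\in\gamma$, $r(h)=p(y)$ (and $0$ otherwise). Hamana boundary. $C$ is injective (in the category of unital $\mathcal{G}$-$C^*$-algebras with $\mathcal{G}$-ucp maps) if every $\mathcal{G}$-ucp map $A\to C$ extends along every embedding $A\to B$ to a $\mathcal{G}$-ucp map $B\to C$. For an embedding $A\subseteq B$, $B$ is an essential extension of $A$ if every $\mathcal{G}$-ucp map on $B$ whose restriction to $A$ is an embedding is an embedding. An injective envelope of $A$ is an injective essential extension of $A$. $\partial_H\mathcal{G}$ is the spectrum of the injective envelope of $C(\mathcal{G}^{(0)})$ in this category, which exists, is commutative and is unique up to $*$-isomorphism. *)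

theory Defs
  imports "HOL-Probability.Probability" "HOL-Algebra.Ring"
begin

section \<open>Etale groupoids and open bisections\<close>

record 'g groupoid =
  gtop :: "'g topology"
  src :: "'g \<Rightarrow> 'g"
  rng :: "'g \<Rightarrow> 'g"
  gmul :: "'g \<Rightarrow> 'g \<Rightarrow> 'g"
  ginv :: "'g \<Rightarrow> 'g"

abbreviation arrows :: "'g groupoid \<Rightarrow> 'g set" where
  "arrows G \<equiv> topspace (gtop G)"

definition units :: "'g groupoid \<Rightarrow> 'g set" where
  "units G = src G ` arrows G"

definition unit_top :: "'g groupoid \<Rightarrow> 'g topology" where
  "unit_top G = subtopology (gtop G) (units G)"

definition composable :: "'g groupoid \<Rightarrow> ('g \<times> 'g) set" where
  "composable G = {(g, h). g \<in> arrows G \<and> h \<in> arrows G \<and> src G g = rng G h}"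

definition local_homeomorphism :: "'a topology \<Rightarrow> 'b topology \<Rightarrow> ('a \<Rightarrow> 'b) \<Rightarrow> bool" where
  "local_homeomorphism X Y f \<longleftrightarrow>
     continuous_map X Y f \<and>
     (\<forall>x\<in>topspace X. \<exists>U. openin X U \<and> x \<in> U \<and> openin Y (f ` U) \<and>
        homeomorphic_map (subtopology X U) (subtopology Y (f ` U)) f)"

text \<open>Units are identified with identity arrows. The arrow space need not be Hausdorff.\<close>

locale etale_groupoid =
  fixes G :: "'g groupoid"
  assumes src_closed: "g \<in> arrows G \<Longrightarrow> src G g \<in> arrows G"
    and rng_closed: "g \<in> arrows G \<Longrightarrow> rng G g \<in> arrows G"
    and src_src: "g \<in> arrows G \<Longrightarrow> src G (src G g) = src G g"
    and rng_src: "g \<in> arrows G \<Longrightarrow> rng G (src G g) = src G g"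
    and src_rng: "g \<in> arrows G \<Longrightarrow> src G (rng G g) = rng G g"
    and rng_rng: "g \<in> arrows G \<Longrightarrow> rng G (rng G g) = rng G g"
    and mul_closed: "(g, h) \<in> composable G \<Longrightarrow> gmul G g h \<in> arrows G"
    and src_mul: "(g, h) \<in> composable G \<Longrightarrow> src G (gmul G g h) = src G h"
    and rng_mul: "(g, h) \<in> composable G \<Longrightarrow> rng G (gmul G g h) = rng G g"
    and mul_assoc: "\<lbrakk>(g, h) \<in> composable G; (h, k) \<in> composable G\<rbrakk>
      \<Longrightarrow> gmul G (gmul G g h) k = gmul G g (gmul G h k)"
    and mul_src: "g \<in> arrows G \<Longrightarrow> gmul G g (src G g) = g"
    and rng_mul_unit: "g \<in> arrows G \<Longrightarrow> gmul G (rng G g) g = g"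
    and inv_closed: "g \<in> arrows G \<Longrightarrow> ginv G g \<in> arrows G"
    and src_inv: "g \<in> arrows G \<Longrightarrow> src G (ginv G g) = rng G g"
    and rng_inv: "g \<in> arrows G \<Longrightarrow> rng G (ginv G g) = src G g"
    and inv_mul: "g \<in> arrows G \<Longrightarrow> gmul G (ginv G g) g = src G g"
    and mul_inv: "g \<in> arrows G \<Longrightarrow> gmul G g (ginv G g) = rng G g"
    and continuous_mul:
      "continuous_map (subtopology (prod_topology (gtop G) (gtop G)) (composable G)) (gtop G)
         (\<lambda>(g, h). gmul G g h)"
    and continuous_inv: "continuous_map (gtop G) (gtop G) (ginv G)"
    and src_local_homeo: "local_homeomorphism (gtop G) (unit_top G) (src G)"
    and rng_local_homeo: "local_homeomorphism (gtop G) (unit_top G) (rng G)"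

definition open_bisections :: "'g groupoid \<Rightarrow> 'g set set" where
  "open_bisections G = {\<gamma>. openin (gtop G) \<gamma> \<and>
     homeomorphic_map (subtopology (gtop G) \<gamma>) (subtopology (gtop G) (src G ` \<gamma>)) (src G) \<and>
     homeomorphic_map (subtopology (gtop G) \<gamma>) (subtopology (gtop G) (rng G ` \<gamma>)) (rng G)}"

definition bis_mul :: "'g groupoid \<Rightarrow> 'g set \<Rightarrow> 'g set \<Rightarrow> 'g set" where
  "bis_mul G \<gamma> \<delta> = {gmul G g h | g h. g \<in> \<gamma> \<and> h \<in> \<delta> \<and> src G g = rng G h}"

definition bis_star :: "'g groupoid \<Rightarrow> 'g set \<Rightarrow> 'g set" where
  "bis_star G \<gamma> = ginv G ` \<gamma>"

abbreviation bis_supp :: "'g groupoid \<Rightarrow> 'g set \<Rightarrow> 'g set" where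
  "bis_supp G \<gamma> \<equiv> src G ` \<gamma>"

abbreviation bis_im :: "'g groupoid \<Rightarrow> 'g set \<Rightarrow> 'g set" where
  "bis_im G \<gamma> \<equiv> rng G ` \<gamma>"

definition bis_map :: "'g groupoid \<Rightarrow> 'g set \<Rightarrow> 'g \<Rightarrow> 'g" where
  "bis_map G \<gamma> x = rng G (the_inv_into \<gamma> (src G) x)"


section \<open>Compact G-spaces and boundaries\<close>

record ('g, 'y) gspace =
  sptop :: "'y topology"
  proj :: "'y \<Rightarrow> 'g"
  act :: "'g \<Rightarrow> 'y \<Rightarrow> 'y"

definition act_dom :: "'g groupoid \<Rightarrow> ('g, 'y) gspace \<Rightarrow> ('g \<times> 'y) set" where
  "act_dom G Y = {(g, y). g \<in> arrows G \<and> y \<in> topspace (sptop Y) \<and> src G g = proj Y y}"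

locale compact_gspace =
  fixes G :: "'g groupoid" and Y :: "('g, 'y) gspace"
  assumes compact: "compact_space (sptop Y)"
    and Hausdorff: "Hausdorff_space (sptop Y)"
    and continuous_proj: "continuous_map (sptop Y) (unit_top G) (proj Y)"
    and surj_proj: "proj Y ` topspace (sptop Y) = units G"
    and act_closed: "(g, y) \<in> act_dom G Y \<Longrightarrow> act Y g y \<in> topspace (sptop Y)"
    and proj_act: "(g, y) \<in> act_dom G Y \<Longrightarrow> proj Y (act Y g y) = rng G g"
    and act_unit: "y \<in> topspace (sptop Y) \<Longrightarrow> act Y (proj Y y) y = y"
    and act_mul: "\<lbrakk>(g, h) \<in> composable G; (h, y) \<in> act_dom G Y\<rbrakk>
      \<Longrightarrow> act Y (gmul G g h) y = act Y g (act Y h y)"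
    and continuous_act:
      "continuous_map (subtopology (prod_topology (gtop G) (sptop Y)) (act_dom G Y)) (sptop Y)
         (\<lambda>(g, y). act Y g y)"

definition gmap :: "'g groupoid \<Rightarrow> ('g, 'y) gspace \<Rightarrow> ('g, 'z) gspace \<Rightarrow> ('y \<Rightarrow> 'z) \<Rightarrow> bool" where
  "gmap G Y Z f \<longleftrightarrow>
     continuous_map (sptop Y) (sptop Z) f \<and>
     (\<forall>y\<in>topspace (sptop Y). proj Z (f y) = proj Y y) \<and>
     (\<forall>(g, y)\<in>act_dom G Y. f (act Y g y) = act Z g (f y))"

definition isomorphic_gspaces :: "'g groupoid \<Rightarrow> ('g, 'y) gspace \<Rightarrow> ('g, 'z) gspace \<Rightarrow> bool" where
  "isomorphic_gspaces G Y Z \<longleftrightarrow>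
     (\<exists>f. gmap G Y Z f \<and> homeomorphic_map (sptop Y) (sptop Z) f)"

text \<open>The unit space itself, on which an arrow \<open>g\<close> sends \<open>src G g\<close> to \<open>rng G g\<close>.\<close>

definition unit_gspace :: "'g groupoid \<Rightarrow> ('g, 'g) gspace" where
  "unit_gspace G = \<lparr>sptop = unit_top G, proj = (\<lambda>x. x), act = (\<lambda>g x. rng G g)\<rparr>"

definition borel_sigma :: "'y topology \<Rightarrow> 'y measure" where
  "borel_sigma Y = sigma (topspace Y) {U. openin Y U}"

definition continuous_functions :: "'y topology \<Rightarrow> ('y \<Rightarrow> complex) set" where
  "continuous_functions Y =
     {f. continuous_map Y euclidean f \<and> (\<forall>y. y \<notin> topspace Y \<longrightarrow> f y = 0)}"

text \<open>As usual for compact Hausdorff spaces that need not be metrizable, probability measures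
  are Radon, i.e. Borel and inner regular with respect to compact sets.\<close>

definition prob_measures :: "'y topology \<Rightarrow> 'y measure set" where
  "prob_measures Y = {\<mu>. prob_space \<mu> \<and> sets \<mu> = sets (borel_sigma Y) \<and>
     (\<forall>B\<in>sets \<mu>. \<forall>\<epsilon>>0. \<exists>K. compactin Y K \<and> K \<subseteq> B \<and> measure \<mu> B < measure \<mu> K + \<epsilon>)}"

definition weak_star_top :: "'y topology \<Rightarrow> 'y measure topology" where
  "weak_star_top Y = pullback_topology (prob_measures Y)
     (\<lambda>\<mu>. \<lambda>f\<in>continuous_functions Y. (\<integral>y. f y \<partial>\<mu>))
     (product_topology (\<lambda>_. euclidean :: complex topology) (continuous_functions Y))"

definition dirac :: "'y topology \<Rightarrow> 'y \<Rightarrow> 'y measure" where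
  "dirac Y y = return (borel_sigma Y) y"

definition gpush :: "'g groupoid \<Rightarrow> ('g, 'y) gspace \<Rightarrow> 'g \<Rightarrow> 'y measure \<Rightarrow> 'y measure" where
  "gpush G Y g \<mu> =
     distr (restrict_space \<mu> {y \<in> topspace (sptop Y). proj Y y = src G g})
       (borel_sigma (sptop Y)) (act Y g)"

definition fibre_family :: "'g groupoid \<Rightarrow> ('g, 'y) gspace \<Rightarrow> ('g \<Rightarrow> 'y measure) \<Rightarrow> bool" where
  "fibre_family G Y \<mu> \<longleftrightarrow>
     (\<forall>x\<in>units G. \<mu> x \<in> prob_measures (sptop Y) \<and>
        distr (\<mu> x) (borel_sigma (unit_top G)) (proj Y) = dirac (unit_top G) x)"

definition irreducible_gspace :: "'g groupoid \<Rightarrow> ('g, 'y) gspace \<Rightarrow> bool" where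
  "irreducible_gspace G Y \<longleftrightarrow>
     (\<forall>Z. closedin (sptop Y) Z \<longrightarrow>
          (\<forall>(g, y)\<in>act_dom G Y. y \<in> Z \<longrightarrow> act Y g y \<in> Z) \<longrightarrow>
          proj Y ` Z = units G \<longrightarrow> Z = topspace (sptop Y))"

definition strongly_proximal :: "'g groupoid \<Rightarrow> ('g, 'y) gspace \<Rightarrow> bool" where
  "strongly_proximal G Y \<longleftrightarrow>
     (\<forall>\<mu>. fibre_family G Y \<mu> \<longrightarrow>
        units G \<subseteq> proj Y ` {y \<in> topspace (sptop Y).
          dirac (sptop Y) y \<in> weak_star_top (sptop Y) closure_of
            {gpush G Y g (\<mu> x) | x g. x \<in> units G \<and> g \<in> arrows G \<and> src G g = x}})"

definition gboundary :: "'g groupoid \<Rightarrow> ('g, 'y) gspace \<Rightarrow> bool" where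
  "gboundary G Y \<longleftrightarrow>
     compact_gspace G Y \<and> irreducible_gspace G Y \<and> strongly_proximal G Y"

text \<open>
  HOL formulas cannot quantify over types, so the class of all objects of a category is represented
  by those whose points form a subset of a universe type, which is passed as an argument. A boundary
  is the closure of the orbits of any section of its projection (not necessarily continuous), hence
  it embeds into \<open>'g set set\<close>, and \<open>TYPE('g set set)\<close> contains all boundaries up to isomorphism.
\<close>

definition furstenberg_boundary :: "'u itself \<Rightarrow> 'g groupoid \<Rightarrow> ('g, 'y) gspace \<Rightarrow> bool" where
  "furstenberg_boundary U G Y \<longleftrightarrow>
     gboundary G Y \<and>
     (\<forall>Z :: ('g, 'u) gspace. gboundary G Z \<longrightarrow>
        (\<exists>f. gmap G Y Z f \<and> f ` topspace (sptop Y) = topspace (sptop Z)))"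


section \<open>Unital C*-algebras and completely positive maps\<close>

record 'a cstar = "'a ring" +
  scale :: "complex \<Rightarrow> 'a \<Rightarrow> 'a"
  adj :: "'a \<Rightarrow> 'a"
  nrm :: "'a \<Rightarrow> real"

text \<open>The value outside the carrier is chosen to satisfy the unrestricted axioms of
  \<open>Metric_space\<close> (nonnegativity and symmetry).\<close>

definition norm_dist :: "('a, 'm) cstar_scheme \<Rightarrow> 'a \<Rightarrow> 'a \<Rightarrow> real" where
  "norm_dist A x y =
     (if x \<in> carrier A \<and> y \<in> carrier A then nrm A (x \<ominus>\<^bsub>A\<^esub> y) else 0)"

definition norm_top :: "('a, 'm) cstar_scheme \<Rightarrow> 'a topology" where
  "norm_top A = Metric_space.mtopology (carrier A) (norm_dist A)"

text \<open>The zero algebra is allowed; it is the algebra of functions on the empty space.\<close>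

locale cstar_algebra = ring A for A :: "('a, 'm) cstar_scheme" (structure) +
  assumes scale_closed: "x \<in> carrier A \<Longrightarrow> scale A c x \<in> carrier A"
    and scale_add_right: "\<lbrakk>x \<in> carrier A; y \<in> carrier A\<rbrakk>
      \<Longrightarrow> scale A c (x \<oplus> y) = scale A c x \<oplus> scale A c y"
    and scale_add_left: "x \<in> carrier A \<Longrightarrow> scale A (c + d) x = scale A c x \<oplus> scale A d x"
    and scale_scale: "x \<in> carrier A \<Longrightarrow> scale A c (scale A d x) = scale A (c * d) x"
    and scale_one: "x \<in> carrier A \<Longrightarrow> scale A 1 x = x"
    and scale_mult_left: "\<lbrakk>x \<in> carrier A; y \<in> carrier A\<rbrakk>
      \<Longrightarrow> scale A c x \<otimes> y = scale A c (x \<otimes> y)"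
    and scale_mult_right: "\<lbrakk>x \<in> carrier A; y \<in> carrier A\<rbrakk>
      \<Longrightarrow> x \<otimes> scale A c y = scale A c (x \<otimes> y)"
    and adj_closed: "x \<in> carrier A \<Longrightarrow> adj A x \<in> carrier A"
    and adj_adj: "x \<in> carrier A \<Longrightarrow> adj A (adj A x) = x"
    and adj_add: "\<lbrakk>x \<in> carrier A; y \<in> carrier A\<rbrakk> \<Longrightarrow> adj A (x \<oplus> y) = adj A x \<oplus> adj A y"
    and adj_scale: "x \<in> carrier A \<Longrightarrow> adj A (scale A c x) = scale A (cnj c) (adj A x)"
    and adj_mult: "\<lbrakk>x \<in> carrier A; y \<in> carrier A\<rbrakk> \<Longrightarrow> adj A (x \<otimes> y) = adj A y \<otimes> adj A x"
    and nrm_nonneg: "x \<in> carrier A \<Longrightarrow> 0 \<le> nrm A x"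
    and nrm_eq_0: "x \<in> carrier A \<Longrightarrow> nrm A x = 0 \<longleftrightarrow> x = \<zero>"
    and nrm_add: "\<lbrakk>x \<in> carrier A; y \<in> carrier A\<rbrakk> \<Longrightarrow> nrm A (x \<oplus> y) \<le> nrm A x + nrm A y"
    and nrm_scale: "x \<in> carrier A \<Longrightarrow> nrm A (scale A c x) = cmod c * nrm A x"
    and nrm_mult: "\<lbrakk>x \<in> carrier A; y \<in> carrier A\<rbrakk> \<Longrightarrow> nrm A (x \<otimes> y) \<le> nrm A x * nrm A y"
    and nrm_adj_mult: "x \<in> carrier A \<Longrightarrow> nrm A (adj A x \<otimes> x) = (nrm A x)\<^sup>2"
    and complete: "Metric_space.mcomplete (carrier A) (norm_dist A)"

definition star_hom_on ::
  "'a set \<Rightarrow> ('a, 'm) cstar_scheme \<Rightarrow> ('b, 'n) cstar_scheme \<Rightarrow> ('a \<Rightarrow> 'b) \<Rightarrow> bool" where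
  "star_hom_on S A B \<phi> \<longleftrightarrow>
     (\<forall>x\<in>S. \<phi> x \<in> carrier B) \<and>
     (\<forall>x\<in>S. \<forall>y\<in>S. \<phi> (x \<oplus>\<^bsub>A\<^esub> y) = \<phi> x \<oplus>\<^bsub>B\<^esub> \<phi> y) \<and>
     (\<forall>x\<in>S. \<forall>y\<in>S. \<phi> (x \<otimes>\<^bsub>A\<^esub> y) = \<phi> x \<otimes>\<^bsub>B\<^esub> \<phi> y) \<and>
     (\<forall>c. \<forall>x\<in>S. \<phi> (scale A c x) = scale B c (\<phi> x)) \<and>
     (\<forall>x\<in>S. \<phi> (adj A x) = adj B (\<phi> x))"

definition mat_carrier :: "('a, 'm) cstar_scheme \<Rightarrow> nat \<Rightarrow> (nat \<Rightarrow> nat \<Rightarrow> 'a) \<Rightarrow> bool" where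
  "mat_carrier A n X \<longleftrightarrow> (\<forall>i<n. \<forall>j<n. X i j \<in> carrier A)"

text \<open>Positivity in the matrix algebra over \<open>A\<close>: the \<open>n\<times>n\<close> block of \<open>X\<close> is of the form
  \<open>Z\<^sup>* Z\<close>. Entries outside the block are irrelevant.\<close>

definition mat_positive :: "('a, 'm) cstar_scheme \<Rightarrow> nat \<Rightarrow> (nat \<Rightarrow> nat \<Rightarrow> 'a) \<Rightarrow> bool" where
  "mat_positive A n X \<longleftrightarrow>
     (\<exists>Z. mat_carrier A n Z \<and>
        (\<forall>i<n. \<forall>j<n. X i j = finsum A (\<lambda>k. adj A (Z k i) \<otimes>\<^bsub>A\<^esub> Z k j) {..<n}))"

definition ucp_map ::
  "('a, 'm) cstar_scheme \<Rightarrow> ('b, 'n) cstar_scheme \<Rightarrow> ('a \<Rightarrow> 'b) \<Rightarrow> bool" where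
  "ucp_map A B \<phi> \<longleftrightarrow>
     (\<forall>x\<in>carrier A. \<phi> x \<in> carrier B) \<and>
     (\<forall>x\<in>carrier A. \<forall>y\<in>carrier A. \<phi> (x \<oplus>\<^bsub>A\<^esub> y) = \<phi> x \<oplus>\<^bsub>B\<^esub> \<phi> y) \<and>
     (\<forall>c. \<forall>x\<in>carrier A. \<phi> (scale A c x) = scale B c (\<phi> x)) \<and>
     \<phi> \<one>\<^bsub>A\<^esub> = \<one>\<^bsub>B\<^esub> \<and>
     (\<forall>n X. mat_positive A n X \<longrightarrow> mat_positive B n (\<lambda>i j. \<phi> (X i j)))"

definition complete_order_embedding ::
  "('a, 'm) cstar_scheme \<Rightarrow> ('b, 'n) cstar_scheme \<Rightarrow> ('a \<Rightarrow> 'b) \<Rightarrow> bool" where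
  "complete_order_embedding A B \<phi> \<longleftrightarrow>
     ucp_map A B \<phi> \<and> inj_on \<phi> (carrier A) \<and>
     (\<forall>n X. mat_carrier A n X \<longrightarrow> mat_positive B n (\<lambda>i j. \<phi> (X i j)) \<longrightarrow> mat_positive A n X)"

text \<open>\<open>C(Y)\<close> with pointwise operations; functions vanish off \<open>topspace Y\<close>. The element \<open>0\<close> is
  inserted into the supremum only to make the norm well-defined for the empty space.\<close>

definition C_alg :: "'y topology \<Rightarrow> ('y \<Rightarrow> complex) cstar" where
  "C_alg Y =
    \<lparr>carrier = continuous_functions Y,
     mult = (\<lambda>f g y. f y * g y),
     one = (\<lambda>y. if y \<in> topspace Y then 1 else 0),
     zero = (\<lambda>y. 0),
     add = (\<lambda>f g y. f y + g y),
     scale = (\<lambda>c f y. c * f y),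
     adj = (\<lambda>f y. cnj (f y)),
     nrm = (\<lambda>f. Sup (insert 0 ((\<lambda>y. cmod (f y)) ` topspace Y)))\<rparr>"


section \<open>G-C*-algebras and injective envelopes\<close>

record ('g, 'a) gcstar = "'a cstar" +
  incl :: "('g \<Rightarrow> complex) \<Rightarrow> 'a"
  bact :: "'g set \<Rightarrow> 'a \<Rightarrow> 'a"

text \<open>Since the unit space is compact, \<open>C\<^sub>0(U)\<close> for open \<open>U\<close> is the ideal of continuous functions
  vanishing off \<open>U\<close>.\<close>

definition C0_fun :: "'g groupoid \<Rightarrow> 'g set \<Rightarrow> ('g \<Rightarrow> complex) set" where
  "C0_fun G U = {f \<in> continuous_functions (unit_top G). \<forall>x. x \<notin> U \<longrightarrow> f x = 0}"

definition corner :: "'g groupoid \<Rightarrow> ('g, 'a) gcstar \<Rightarrow> 'g set \<Rightarrow> 'a set" where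
  "corner G A U = norm_top A closure_of
     {incl A f \<otimes>\<^bsub>A\<^esub> a \<otimes>\<^bsub>A\<^esub> incl A h | f a h.
        f \<in> C0_fun G U \<and> a \<in> carrier A \<and> h \<in> C0_fun G U}"

locale gcstar_algebra = cstar_algebra A
  for G :: "'g groupoid" and A :: "('g, 'a) gcstar" (structure) +
  assumes incl_hom: "star_hom_on (continuous_functions (unit_top G)) (C_alg (unit_top G)) A (incl A)"
    and incl_one: "incl A \<one>\<^bsub>C_alg (unit_top G)\<^esub> = \<one>"
    and incl_inj: "inj_on (incl A) (continuous_functions (unit_top G))"
    and bact_bij: "\<gamma> \<in> open_bisections G
      \<Longrightarrow> bij_betw (bact A \<gamma>) (corner G A (bis_supp G \<gamma>)) (corner G A (bis_im G \<gamma>))"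
    and bact_hom: "\<gamma> \<in> open_bisections G
      \<Longrightarrow> star_hom_on (corner G A (bis_supp G \<gamma>)) A A (bact A \<gamma>)"
    and bact_incl: "\<lbrakk>\<gamma> \<in> open_bisections G; f \<in> C0_fun G (bis_supp G \<gamma>)\<rbrakk>
      \<Longrightarrow> bact A \<gamma> (incl A f) =
          incl A (\<lambda>x. if x \<in> bis_im G \<gamma> then f (bis_map G (bis_star G \<gamma>) x) else 0)"
    and bact_comp: "\<lbrakk>\<gamma> \<in> open_bisections G; \<delta> \<in> open_bisections G;
        a \<in> corner G A (bis_map G (bis_star G \<delta>) ` (bis_supp G \<gamma> \<inter> bis_im G \<delta>))\<rbrakk>
      \<Longrightarrow> bact A \<gamma> (bact A \<delta> a) = bact A (bis_mul G \<gamma> \<delta>) a"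

definition compatible ::
  "'g groupoid \<Rightarrow> ('g, 'a) gcstar \<Rightarrow> ('g, 'b) gcstar \<Rightarrow> ('a \<Rightarrow> 'b) \<Rightarrow> bool" where
  "compatible G A B \<phi> \<longleftrightarrow>
     (\<forall>f\<in>continuous_functions (unit_top G). \<phi> (incl A f) = incl B f) \<and>
     (\<forall>\<gamma>\<in>open_bisections G. \<forall>a\<in>corner G A (bis_supp G \<gamma>). \<phi> (bact A \<gamma> a) = bact B \<gamma> (\<phi> a))"

definition gucp_map ::
  "'g groupoid \<Rightarrow> ('g, 'a) gcstar \<Rightarrow> ('g, 'b) gcstar \<Rightarrow> ('a \<Rightarrow> 'b) \<Rightarrow> bool" where
  "gucp_map G A B \<phi> \<longleftrightarrow> ucp_map A B \<phi> \<and> compatible G A B \<phi>"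

definition gembedding ::
  "'g groupoid \<Rightarrow> ('g, 'a) gcstar \<Rightarrow> ('g, 'b) gcstar \<Rightarrow> ('a \<Rightarrow> 'b) \<Rightarrow> bool" where
  "gembedding G A B \<phi> \<longleftrightarrow> gucp_map G A B \<phi> \<and> complete_order_embedding A B \<phi>"

definition gcstar_iso ::
  "'g groupoid \<Rightarrow> ('g, 'a) gcstar \<Rightarrow> ('g, 'b) gcstar \<Rightarrow> ('a \<Rightarrow> 'b) \<Rightarrow> bool" where
  "gcstar_iso G A B \<phi> \<longleftrightarrow>
     star_hom_on (carrier A) A B \<phi> \<and> bij_betw \<phi> (carrier A) (carrier B) \<and> compatible G A B \<phi>"

text \<open>The test objects below range over the \<open>G\<close>-C*-algebras whose elements form a subset of the
  universe type (cf. the remark on boundaries above). The universe \<open>TYPE('g set set \<Rightarrow> complex)\<close>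
  contains, up to isomorphism, \<open>C(Y)\<close> for every boundary \<open>Y\<close>, and the injective algebra of bounded
  functions on the arrows.\<close>

definition ginjective :: "'u itself \<Rightarrow> 'g groupoid \<Rightarrow> ('g, 'c) gcstar \<Rightarrow> bool" where
  "ginjective U G C \<longleftrightarrow>
     gcstar_algebra G C \<and>
     (\<forall>(A :: ('g, 'u) gcstar) (B :: ('g, 'u) gcstar) j \<phi>.
        gcstar_algebra G A \<longrightarrow> gcstar_algebra G B \<longrightarrow> gembedding G A B j \<longrightarrow> gucp_map G A C \<phi> \<longrightarrow>
        (\<exists>\<psi>. gucp_map G B C \<psi> \<and> (\<forall>a\<in>carrier A. \<psi> (j a) = \<phi> a)))"

definition essential_extension ::
  "'u itself \<Rightarrow> 'g groupoid \<Rightarrow> ('g, 'a) gcstar \<Rightarrow> ('g, 'b) gcstar \<Rightarrow> ('a \<Rightarrow> 'b) \<Rightarrow> bool" where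
  "essential_extension U G A B j \<longleftrightarrow>
     gcstar_algebra G B \<and> gembedding G A B j \<and>
     (\<forall>(C :: ('g, 'u) gcstar) \<phi>.
        gcstar_algebra G C \<longrightarrow> gucp_map G B C \<phi> \<longrightarrow> gembedding G A C (\<phi> \<circ> j) \<longrightarrow>
        gembedding G B C \<phi>)"

definition injective_envelope ::
  "'u itself \<Rightarrow> 'g groupoid \<Rightarrow> ('g, 'a) gcstar \<Rightarrow> ('g, 'b) gcstar \<Rightarrow> bool" where
  "injective_envelope U G A B \<longleftrightarrow>
     ginjective U G B \<and> (\<exists>j. essential_extension U G A B j)"

text \<open>The \<open>G\<close>-C*-algebra \<open>C(Y)\<close> of a compact \<open>G\<close>-space: the bisection \<open>\<gamma>\<close> sends \<open>f\<close> to
  \<open>y \<mapsto> f(h\<inverse> y)\<close>, where \<open>h\<close> is the arrow of \<open>\<gamma>\<close> with range \<open>proj Y y\<close>.\<close>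

definition C_galg :: "'g groupoid \<Rightarrow> ('g, 'y) gspace \<Rightarrow> ('g, 'y \<Rightarrow> complex) gcstar" where
  "C_galg G Y = cstar.extend (C_alg (sptop Y)) (gcstar.fields
     (\<lambda>f y. if y \<in> topspace (sptop Y) then f (proj Y y) else 0)
     (\<lambda>\<gamma> f y. if y \<in> topspace (sptop Y) \<and> proj Y y \<in> bis_im G \<gamma>
        then f (act Y (ginv G (the_inv_into \<gamma> (rng G) (proj Y y))) y) else 0))"

text \<open>\<open>Y\<close> is the spectrum of \<open>A\<close>, as a \<open>G\<close>-space, if \<open>A\<close> is isomorphic to \<open>C(Y)\<close>; this forces \<open>A\<close>
  to be commutative.\<close>

definition is_spectrum :: "'g groupoid \<Rightarrow> ('g, 'a) gcstar \<Rightarrow> ('g, 'y) gspace \<Rightarrow> bool" where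
  "is_spectrum G A Y \<longleftrightarrow> compact_gspace G Y \<and> (\<exists>\<Phi>. gcstar_iso G A (C_galg G Y) \<Phi>)"

end

theory Submission
  imports Defs
begin

text \<open>
  Let \<open>H\<close> be the spectrum of the injective envelope and \<open>F\<close> the Furstenberg boundary.

  A family \<open>\<mu>\<close> of probability measures on the fibres of \<open>H\<close> defines an equivariant ucp map
  \<open>f \<mapsto> (g \<mapsto> \<integral> f d(g \<mu>))\<close> from \<open>C(H)\<close> to the bounded functions on the arrows. On \<open>C(G\<^sup>0)\<close> it is
  composition with the range map, so by essentiality it is an order embedding. Hence for every
  \<open>f \<ge> 0\<close> vanishing at \<open>y\<close> the integrals of \<open>f\<close> against the measures \<open>g \<mu>\<close> have infimum 0, that is,
  every Dirac measure of \<open>H\<close> is a limit of measures \<open>g \<mu>\<close>. This gives strong proximality and, with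
  Dirac measures for \<open>\<mu>\<close>, irreducibility of \<open>H\<close>, so \<open>F\<close> maps to \<open>H\<close> by universality.

  Conversely, an equivariant ucp map \<open>C(Z) \<rightarrow> C(Y)\<close> assigns to each point of \<open>Y\<close> a probability measure
  on \<open>Z\<close>, by Riesz representation. If \<open>Z\<close> is strongly proximal, the closed invariant set of points with
  a Dirac measure maps onto \<open>G\<^sup>0\<close>, and if \<open>Y\<close> is irreducible it is all of \<open>Y\<close>: the ucp map is dual
  to a map \<open>Y \<rightarrow> Z\<close>. Injectivity thus yields a map \<open>H \<rightarrow> F\<close>. Applied to the average of two
  pullbacks, the same fact shows that maps between boundaries are unique, so the two maps are mutually
  inverse.

  The norm of the given algebra is never compared with the sup norm of \<open>C(H)\<close>: membership in its
  corners follows from an exact (Cohen) factorisation in \<open>C(H)\<close>.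
\<close>

section \<open>Positive semidefinite matrices\<close>

text \<open>Positivity in \<open>mat_positive\<close> means being of the form Z* Z over the algebra.
  For algebras of functions this is turned into pointwise positive semidefiniteness, which requires
  square roots of matrix-valued functions inside the algebra; they come from a power series whose
  convergence is uniform. The measures of a fibre family are chosen independently for each unit, so
  their integrals need not vary continuously with the arrow. The target of the transform is
  therefore the algebra of all bounded functions on the arrows, acted on by left multiplication, and
  it is the one algebra against which essentiality is tested. Equivariance is given for open
  bisections acting on corners, whereas boundaries are about single arrows acting on fibres. Passing
  between the two rests on three facts: the measures involved live on one fibre, a function may be
  cut off near that fibre without changing its integral, and membership in a corner is a domination
  estimate that pullbacks and ucp maps preserve.\<close>

definition psd :: "nat \<Rightarrow> (nat \<Rightarrow> nat \<Rightarrow> complex) \<Rightarrow> bool" where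
  "psd n M \<longleftrightarrow> (\<forall>i<n. \<forall>j<n. M j i = cnj (M i j)) \<and>
     (\<forall>v. 0 \<le> Re (\<Sum>i<n. \<Sum>j<n. cnj (v i) * M i j * v j))"

lemma psd_cong:
  assumes "\<And>i j. i < n \<Longrightarrow> j < n \<Longrightarrow> M i j = N i j"
  shows "psd n M \<longleftrightarrow> psd n N"
proof -
  have "(\<Sum>i<n. \<Sum>j<n. cnj (v i) * M i j * v j) = (\<Sum>i<n. \<Sum>j<n. cnj (v i) * N i j * v j)" for v
    by (intro sum.cong refl) (simp add: assms)
  then show ?thesis
    unfolding psd_def by (simp add: assms)
qed

lemma psd_hermitian: "psd n M \<Longrightarrow> i < n \<Longrightarrow> j < n \<Longrightarrow> M j i = cnj (M i j)"
  unfolding psd_def by blast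

lemma psd_nonneg: "psd n M \<Longrightarrow> 0 \<le> Re (\<Sum>i<n. \<Sum>j<n. cnj (v i) * M i j * v j)"
  unfolding psd_def by blast

lemma psd_gram: "psd n (\<lambda>i j. \<Sum>k<m. cnj (Z k i) * Z k j)"
  unfolding psd_def
proof (intro conjI allI impI)
  fix v :: "nat \<Rightarrow> complex"
  have "(\<Sum>i<n. \<Sum>j<n. cnj (v i) * (\<Sum>k<m. cnj (Z k i) * Z k j) * v j) =
      (\<Sum>i<n. \<Sum>j<n. \<Sum>k<m. cnj (Z k i * v i) * (Z k j * v j))"
    by (simp add: sum_distrib_left sum_distrib_right ac_simps)
  also have "\<dots> = (\<Sum>i<n. \<Sum>k<m. \<Sum>j<n. cnj (Z k i * v i) * (Z k j * v j))"
    by (intro sum.cong refl sum.swap)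
  also have "\<dots> = (\<Sum>k<m. \<Sum>i<n. \<Sum>j<n. cnj (Z k i * v i) * (Z k j * v j))"
    by (rule sum.swap)
  also have "\<dots> = (\<Sum>k<m. cnj (\<Sum>i<n. Z k i * v i) * (\<Sum>j<n. Z k j * v j))"
    by (simp add: sum_product)
  also have "\<dots> = (\<Sum>k<m. of_real ((cmod (\<Sum>i<n. Z k i * v i))\<^sup>2))"
    by (intro sum.cong refl) (metis complex_norm_square mult.commute)
  also have "Re \<dots> = (\<Sum>k<m. (cmod (\<Sum>i<n. Z k i * v i))\<^sup>2)"
    by simp
  finally show "0 \<le> Re (\<Sum>i<n. \<Sum>j<n. cnj (v i) * (\<Sum>k<m. cnj (Z k i) * Z k j) * v j)"
    by (simp add: sum_nonneg)
qed (simp add: ac_simps)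

text \<open>If 0 \<le> S \<le> 1, testing the form Q of S on v - w with w = S v gives 2 |w|^2 \<le>
  Q v + Q w, and Q is at most the squared norm. No spectral decomposition enters.\<close>

lemma psd_contraction:
  assumes S: "psd n S" and S1: "psd n (\<lambda>i j. (if i = j then 1 else 0) - S i j)"
  shows "(\<Sum>i<n. (cmod (\<Sum>j<n. S i j * v j))\<^sup>2) \<le> (\<Sum>i<n. (cmod (v i))\<^sup>2)"
proof -
  define w where "w i = (\<Sum>j<n. S i j * v j)" for i
  define Q where "Q u = Re (\<Sum>i<n. \<Sum>j<n. cnj (u i) * S i j * u j)" for u
  have sq: "(\<Sum>i<n. (cmod (u i))\<^sup>2) = Re (\<Sum>i<n. cnj (u i) * u i)" for u
    by (simp add: cmod_power2 flip: power2_eq_square)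
  have Q_le: "Q u \<le> (\<Sum>i<n. (cmod (u i))\<^sup>2)" for u
  proof -
    have "(\<Sum>i<n. \<Sum>j<n. cnj (u i) * ((if i = j then 1 else 0) - S i j) * u j) =
        (\<Sum>i<n. \<Sum>j<n. (if i = j then cnj (u i) * u j else 0)) -
        (\<Sum>i<n. \<Sum>j<n. cnj (u i) * S i j * u j)"
      by (simp only: sum_subtractf[symmetric]) (intro sum.cong refl, auto simp: algebra_simps)
    also have "(\<Sum>i<n. \<Sum>j<n. (if i = j then cnj (u i) * u j else 0)) = (\<Sum>i<n. cnj (u i) * u i)"
      by (intro sum.cong refl) (simp add: sum.delta)
    finally have "(\<Sum>i<n. \<Sum>j<n. cnj (u i) * ((if i = j then 1 else 0) - S i j) * u j) =
        (\<Sum>i<n. cnj (u i) * u i) - (\<Sum>i<n. \<Sum>j<n. cnj (u i) * S i j * u j)" .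
    moreover have "0 \<le> Re (\<Sum>i<n. \<Sum>j<n. cnj (u i) * ((if i = j then 1 else 0) - S i j) * u j)"
      using S1 unfolding psd_def by blast
    ultimately show ?thesis
      unfolding Q_def sq by simp
  qed
  have cw: "cnj (w j) = (\<Sum>i<n. cnj (v i) * S i j)" if "j < n" for j
  proof -
    have "S j i = cnj (S i j)" if "i < n" for i
      using S that \<open>j < n\<close> unfolding psd_def by blast
    then show ?thesis
      unfolding w_def by (auto intro!: sum.cong simp: ac_simps)
  qed
  have "(\<Sum>i<n. \<Sum>j<n. cnj (v i - w i) * S i j * (v j - w j)) =
      (\<Sum>i<n. \<Sum>j<n. cnj (v i) * S i j * v j) - (\<Sum>i<n. \<Sum>j<n. cnj (v i) * S i j * w j)
      - (\<Sum>i<n. \<Sum>j<n. cnj (w i) * S i j * v j) + (\<Sum>i<n. \<Sum>j<n. cnj (w i) * S i j * w j)"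
    by (simp only: sum_subtractf[symmetric] sum.distrib[symmetric]) (intro sum.cong refl, simp add: algebra_simps)
  moreover have "(\<Sum>i<n. \<Sum>j<n. cnj (v i) * S i j * w j) = (\<Sum>j<n. cnj (w j) * w j)"
    by (subst sum.swap) (intro sum.cong refl, simp add: cw sum_distrib_right)
  moreover have "(\<Sum>i<n. \<Sum>j<n. cnj (w i) * S i j * v j) = (\<Sum>j<n. cnj (w j) * w j)"
    by (intro sum.cong refl) (simp only: mult.assoc sum_distrib_left[symmetric] w_def[symmetric])
  ultimately have "Q (\<lambda>i. v i - w i) = Q v - 2 * (\<Sum>i<n. (cmod (w i))\<^sup>2) + Q w"
    unfolding Q_def sq by simp
  moreover have "0 \<le> Q u" for u
    using S unfolding psd_def Q_def by blast
  ultimately have "(\<Sum>i<n. (cmod (w i))\<^sup>2) \<le> (\<Sum>i<n. (cmod (v i))\<^sup>2)"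
    using Q_le[of v] Q_le[of w] by (smt (verit))
  then show ?thesis unfolding w_def .
qed

text \<open>The coefficients of \<open>1 - sqrt (1 - x) = \<Sum>k. sqrt_coeff k * x ^ k\<close>.\<close>

function sqrt_coeff :: "nat \<Rightarrow> real" where
  "sqrt_coeff 0 = 0"
| "sqrt_coeff (Suc k) =
     (if k = 0 then 1 / 2 else (\<Sum>i\<in>{1..k}. sqrt_coeff i * sqrt_coeff (Suc k - i)) / 2)"
  by pat_completeness auto
termination by (relation "Wellfounded.measure id") auto

lemma sqrt_coeff_nonneg: "0 \<le> sqrt_coeff k"
proof (induction k rule: less_induct)
  case (less k)
  then show ?case
    by (cases k) (auto intro!: sum_nonneg divide_nonneg_nonneg mult_nonneg_nonneg)
qed

text \<open>These are the coefficients of c^2 = 2 c - x for c = 1 - sqrt (1 - x). The recursion of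
  \<open>sqrt_coeff\<close> solves this equation degree by degree; the case m = 1 is the term
  x.\<close>

lemma sqrt_coeff_conv:
  "(\<Sum>i\<le>m. sqrt_coeff i * sqrt_coeff (m - i)) = 2 * sqrt_coeff m - (if m = 1 then 1 else 0)"
proof (cases m)
  case (Suc k)
  show ?thesis
  proof (cases "k = 0")
    case False
    have "{..m} = insert 0 (insert (Suc k) {1..k})"
      using Suc by auto
    then show ?thesis
      using Suc False by simp
  qed (simp add: Suc)
qed simp

text \<open>By \<open>sqrt_coeff_conv\<close>, twice the partial sum up to N + 1 is 1 plus the
  products with i + j \<le> N + 1. An index N + 1 forces the other to be 0, where the coefficient
  vanishes, so these products are bounded by the square of the partial sum up to N.\<close>

lemma sqrt_coeff_sum_le_1: "(\<Sum>k\<le>N. sqrt_coeff k) \<le> 1"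
proof (induction N)
  case (Suc N)
  let ?s = "\<Sum>k\<le>N. sqrt_coeff k"
  have fin: "finite {(i, j). i + j \<le> Suc N}"
    by (rule finite_subset[of _ "{..Suc N} \<times> {..Suc N}"]) auto
  have z: "sqrt_coeff (fst p) * sqrt_coeff (snd p) = 0"
    if "fst p + snd p \<le> Suc N" "fst p \<le> N \<longrightarrow> \<not> snd p \<le> N" for p
  proof -
    have "fst p = 0 \<or> snd p = 0" using that by linarith
    then show ?thesis by auto
  qed
  have "2 * (\<Sum>k\<le>Suc N. sqrt_coeff k) =
      (\<Sum>m\<le>Suc N. (\<Sum>i\<le>m. sqrt_coeff i * sqrt_coeff (m - i)) + (if m = 1 then 1 else 0))"
    by (simp only: sqrt_coeff_conv) (simp add: sum_distrib_left)
  also have "\<dots> = (\<Sum>m\<le>Suc N. \<Sum>i\<le>m. sqrt_coeff i * sqrt_coeff (m - i)) + 1"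
    by (subst sum.distrib) (simp add: sum.delta)
  also have "(\<Sum>m\<le>Suc N. \<Sum>i\<le>m. sqrt_coeff i * sqrt_coeff (m - i)) =
      (\<Sum>(i, j)\<in>{(i, j). i + j \<le> Suc N}. sqrt_coeff i * sqrt_coeff j)"
    by (rule sum.triangle_reindex_eq[symmetric])
  also have "\<dots> = (\<Sum>(i, j)\<in>{(i, j). i + j \<le> Suc N} \<inter> {..N} \<times> {..N}. sqrt_coeff i * sqrt_coeff j)"
  proof (rule sum.mono_neutral_right[OF fin]; (intro ballI)?)
    fix p assume "p \<in> {(i, j). i + j \<le> Suc N} - {(i, j). i + j \<le> Suc N} \<inter> {..N} \<times> {..N}"
    then have "fst p + snd p \<le> Suc N" "fst p \<le> N \<longrightarrow> \<not> snd p \<le> N"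
      by (auto simp: mem_Times_iff case_prod_beta)
    then show "(case p of (a, b) \<Rightarrow> sqrt_coeff a * sqrt_coeff b) = 0"
      using z[of p] by (simp add: case_prod_beta)
  qed auto
  also have "\<dots> \<le> (\<Sum>(i, j)\<in>{..N} \<times> {..N}. sqrt_coeff i * sqrt_coeff j)"
    by (rule sum_mono2) (auto simp: sqrt_coeff_nonneg)
  also have "\<dots> = ?s * ?s"
    by (simp add: sum_product sum.cartesian_product)
  also have "\<dots> \<le> 1 * 1"
    by (intro mult_mono Suc.IH) (auto intro!: sum_nonneg sqrt_coeff_nonneg)
  finally show ?case by simp
qed simp

lemma summable_sqrt_coeff: "summable sqrt_coeff"
proof (rule summableI_nonneg_bounded[where x = 1])
  fix n
  have "(\<Sum>k<n. sqrt_coeff k) \<le> (\<Sum>k\<le>n. sqrt_coeff k)"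
    by (intro sum_mono2) (auto simp: sqrt_coeff_nonneg)
  then show "(\<Sum>k<n. sqrt_coeff k) \<le> 1"
    using sqrt_coeff_sum_le_1[of n] by simp
qed (rule sqrt_coeff_nonneg)

section \<open>Square roots of matrices between 0 and 1\<close>

primrec mpow :: "nat \<Rightarrow> (nat \<Rightarrow> nat \<Rightarrow> complex) \<Rightarrow> nat \<Rightarrow> nat \<Rightarrow> nat \<Rightarrow> complex" where
  "mpow n S 0 i j = (if i = j then 1 else 0)"
| "mpow n S (Suc a) i j = (\<Sum>k<n. S i k * mpow n S a k j)"

lemma mpow_add:
  "i < n \<Longrightarrow> (\<Sum>k<n. mpow n S a i k * mpow n S b k j) = mpow n S (a + b) i j"
proof (induction a arbitrary: i)
  case 0
  have "(\<Sum>k<n. mpow n S 0 i k * mpow n S b k j) = (\<Sum>k<n. if i = k then mpow n S b k j else 0)"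
    by (intro sum.cong) auto
  then show ?case using 0 by simp
next
  case (Suc a)
  have "(\<Sum>k<n. mpow n S (Suc a) i k * mpow n S b k j) =
      (\<Sum>k<n. \<Sum>l<n. S i l * (mpow n S a l k * mpow n S b k j))"
    by (simp add: sum_distrib_right mult.assoc)
  also have "\<dots> = (\<Sum>l<n. S i l * (\<Sum>k<n. mpow n S a l k * mpow n S b k j))"
    by (subst sum.swap) (simp add: sum_distrib_left)
  finally show ?case using Suc.IH by simp
qed

lemma mpow_one: "j < n \<Longrightarrow> mpow n S 1 i j = S i j"
proof -
  assume "j < n"
  have "mpow n S 1 i j = (\<Sum>k<n. if k = j then S i k else 0)"
    unfolding One_nat_def mpow.simps by (intro sum.cong) auto
  then show ?thesis using \<open>j < n\<close> by simp
qed

lemma mpow_hermitian: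
  assumes S: "\<And>i j. i < n \<Longrightarrow> j < n \<Longrightarrow> S j i = cnj (S i j)"
  shows "i < n \<Longrightarrow> j < n \<Longrightarrow> mpow n S a j i = cnj (mpow n S a i j)"
proof (induction a arbitrary: i j)
  case (Suc a)
  \<comment> \<open>Splitting off the last factor on one side and the first on the other matches the
    reversal of factors under the adjoint.\<close>
  have "mpow n S (Suc a) j i = (\<Sum>k<n. mpow n S a j k * mpow n S 1 k i)"
    using mpow_add[of j n S a 1 i] Suc.prems by simp
  also have "\<dots> = (\<Sum>k<n. cnj (S i k * mpow n S a k j))"
  proof (intro sum.cong refl)
    fix k assume "k \<in> {..<n}"
    then have k: "k < n" by simp
    have a: "mpow n S 1 k i = S k i"
      using Suc.prems(1) by (rule mpow_one)
    have b: "S k i = cnj (S i k)"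
      using Suc.prems(1) k by (rule S)
    have c: "mpow n S a j k = cnj (mpow n S a k j)"
      using k Suc.prems(2) by (rule Suc.IH)
    show "mpow n S a j k * mpow n S 1 k i = cnj (S i k * mpow n S a k j)"
      unfolding a b c complex_cnj_mult by (rule mult.commute)
  qed
  finally show ?case by simp
qed auto

text \<open>Column j of the a-th power is S applied a times to a unit vector, and S is a
  contraction.\<close>

lemma mpow_bound:
  assumes S: "psd n S" and S1: "psd n (\<lambda>i j. (if i = j then 1 else 0) - S i j)"
    and "i < n" "j < n"
  shows "cmod (mpow n S a i j) \<le> 1"
proof -
  have "(\<Sum>i<n. (cmod (mpow n S a i j))\<^sup>2) \<le> 1"
  proof (induction a)
    case 0
    have "(\<Sum>i<n. (cmod (mpow n S 0 i j))\<^sup>2) = (\<Sum>i<n. if i = j then 1 else 0)"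
      by (intro sum.cong) auto
    then show ?case by simp
  next
    case (Suc a)
    show ?case
      using psd_contraction[OF S S1, of "\<lambda>k. mpow n S a k j"] Suc by simp
  qed
  moreover have "(cmod (mpow n S a i j))\<^sup>2 \<le> (\<Sum>i<n. (cmod (mpow n S a i j))\<^sup>2)"
    using \<open>i < n\<close> by (intro member_le_sum) auto
  ultimately have "(cmod (mpow n S a i j))\<^sup>2 \<le> 1"
    by linarith
  then show ?thesis
    by (simp add: abs_square_le_1)
qed

text \<open>The series for the square root of 1 - S, not of S: the argument is the defect from the
  identity.\<close>

definition msqrt :: "nat \<Rightarrow> (nat \<Rightarrow> nat \<Rightarrow> complex) \<Rightarrow> nat \<Rightarrow> nat \<Rightarrow> complex" where
  "msqrt n S i j = (if i = j then 1 else 0) - (\<Sum>a. of_real (sqrt_coeff a) * mpow n S a i j)"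

context
  fixes n S
  assumes S: "psd n S" and S1: "psd n (\<lambda>i j. (if i = j then 1 else 0) - S i j)"
begin

lemma msqrt_norm_le:
  "i < n \<Longrightarrow> j < n \<Longrightarrow> norm (of_real (sqrt_coeff a) * mpow n S a i j) \<le> sqrt_coeff a"
  using mpow_bound[OF S S1, of i j a] sqrt_coeff_nonneg[of a]
  by (simp add: norm_mult mult_left_le)

lemma msqrt_summable:
  assumes "i < n" "j < n"
  shows "summable (\<lambda>a. norm (of_real (sqrt_coeff a) * mpow n S a i j))"
  using msqrt_norm_le[OF assms] by (intro summable_comparison_test'[OF summable_sqrt_coeff, of 0]) simp

text \<open>The error bound is a tail of \<open>sqrt_coeff\<close> and depends neither on S nor on
  the entry. For matrices depending on a point the convergence is therefore uniform in the point, as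
  \<open>root_in\<close> requires.\<close>

lemma msqrt_approx:
  assumes "i < n" "j < n"
  shows "cmod (msqrt n S i j -
      ((if i = j then 1 else 0) - (\<Sum>a<N. of_real (sqrt_coeff a) * mpow n S a i j)))
    \<le> suminf sqrt_coeff - (\<Sum>a<N. sqrt_coeff a)"
proof -
  let ?f = "\<lambda>a. of_real (sqrt_coeff a) * mpow n S a i j"
  have s: "summable ?f"
    using msqrt_summable[OF assms] by (rule summable_norm_cancel)
  have sN: "summable (\<lambda>a. norm (?f (a + N)))"
    by (rule summable_ignore_initial_segment[OF msqrt_summable[OF assms]])
  have "msqrt n S i j - ((if i = j then 1 else 0) - (\<Sum>a<N. ?f a)) = - (suminf ?f - (\<Sum>a<N. ?f a))"
    unfolding msqrt_def by simp
  also have "suminf ?f - (\<Sum>a<N. ?f a) = (\<Sum>a. ?f (a + N))"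
    using suminf_split_initial_segment[OF s, of N] by simp
  also have "cmod (- \<dots>) \<le> (\<Sum>a. norm (?f (a + N)))"
    using summable_norm[OF sN] by simp
  also have "\<dots> \<le> (\<Sum>a. sqrt_coeff (a + N))"
    by (intro suminf_le sN summable_ignore_initial_segment[OF summable_sqrt_coeff]
        msqrt_norm_le assms)
  also have "\<dots> = suminf sqrt_coeff - (\<Sum>a<N. sqrt_coeff a)"
    using suminf_split_initial_segment[OF summable_sqrt_coeff, of N] by simp
  finally show ?thesis .
qed

lemma msqrt_hermitian: "i < n \<Longrightarrow> j < n \<Longrightarrow> msqrt n S j i = cnj (msqrt n S i j)"
proof -
  assume ij: "i < n" "j < n"
  have h: "mpow n S a j i = cnj (mpow n S a i j)" for a
    using psd_hermitian[OF S] ij by (rule mpow_hermitian)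
  have "(\<lambda>a. of_real (sqrt_coeff a) * mpow n S a i j) sums
      (\<Sum>a. of_real (sqrt_coeff a) * mpow n S a i j)"
    using summable_norm_cancel[OF msqrt_summable[OF ij]] by (rule summable_sums)
  then have "(\<lambda>a. cnj (of_real (sqrt_coeff a) * mpow n S a i j)) sums
      cnj (\<Sum>a. of_real (sqrt_coeff a) * mpow n S a i j)"
    by (simp only: sums_cnj)
  then have "(\<Sum>a. of_real (sqrt_coeff a) * mpow n S a j i) =
      cnj (\<Sum>a. of_real (sqrt_coeff a) * mpow n S a i j)"
    by (simp add: sums_iff h)
  then show ?thesis unfolding msqrt_def by simp
qed

text \<open>With P = 1 - \<open>msqrt n S\<close>, the Cauchy product and
  \<open>sqrt_coeff_conv\<close> give P^2 = 2 P - S, hence (1 - P)^2 = 1 - S.\<close>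

lemma msqrt_square:
  assumes ij: "i < n" "j < n"
  shows "(\<Sum>k<n. msqrt n S i k * msqrt n S k j) = (if i = j then 1 else 0) - S i j"
proof -
  define P where "P i j = (\<Sum>a. of_real (sqrt_coeff a) * mpow n S a i j)" for i j
  have "(\<lambda>m. \<Sum>a\<le>m. (of_real (sqrt_coeff a) * mpow n S a i k) *
        (of_real (sqrt_coeff (m - a)) * mpow n S (m - a) k j)) sums (P i k * P k j)"
    if "k < n" for k
    unfolding P_def using ij that by (intro Cauchy_product_sums msqrt_summable)
  then have "(\<lambda>m. \<Sum>k<n. \<Sum>a\<le>m. (of_real (sqrt_coeff a) * mpow n S a i k) *
        (of_real (sqrt_coeff (m - a)) * mpow n S (m - a) k j)) sums (\<Sum>k<n. P i k * P k j)"
    by (intro sums_sum) auto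
  moreover have "(\<Sum>k<n. \<Sum>a\<le>m. (of_real (sqrt_coeff a) * mpow n S a i k) *
        (of_real (sqrt_coeff (m - a)) * mpow n S (m - a) k j)) =
      2 * (of_real (sqrt_coeff m) * mpow n S m i j) - (if m = 1 then S i j else 0)" for m
  proof -
    have "(\<Sum>k<n. \<Sum>a\<le>m. (of_real (sqrt_coeff a) * mpow n S a i k) *
        (of_real (sqrt_coeff (m - a)) * mpow n S (m - a) k j)) =
        (\<Sum>a\<le>m. of_real (sqrt_coeff a * sqrt_coeff (m - a)) *
          (\<Sum>k<n. mpow n S a i k * mpow n S (m - a) k j))"
      by (subst sum.swap) (simp add: sum_distrib_left ac_simps)
    also have "\<dots> = (\<Sum>a\<le>m. of_real (sqrt_coeff a * sqrt_coeff (m - a)) * mpow n S m i j)"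
      using ij by (intro sum.cong) (auto simp: mpow_add)
    also have "\<dots> = of_real (\<Sum>a\<le>m. sqrt_coeff a * sqrt_coeff (m - a)) * mpow n S m i j"
      by (simp add: sum_distrib_right)
    also have "\<dots> = 2 * (of_real (sqrt_coeff m) * mpow n S m i j) - (if m = 1 then mpow n S 1 i j else 0)"
      by (subst sqrt_coeff_conv) (auto simp: algebra_simps simp del: mpow.simps)
    also have "mpow n S 1 i j = S i j"
      using ij by (rule_tac mpow_one)
    finally show ?thesis .
  qed
  moreover have "(\<lambda>m. 2 * (of_real (sqrt_coeff m) * mpow n S m i j) - (if m = 1 then S i j else 0))
      sums (2 * P i j - S i j)"
    unfolding P_def
    by (intro sums_diff sums_mult summable_sums summable_norm_cancel[OF msqrt_summable[OF ij]])
      (rule sums_single)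
  ultimately have PP: "(\<Sum>k<n. P i k * P k j) = 2 * P i j - S i j"
    using sums_unique2 by fastforce
  have "(\<Sum>k<n. msqrt n S i k * msqrt n S k j) =
      (\<Sum>k<n. (if i = k then if k = j then 1 else 0 else 0)) - (\<Sum>k<n. if i = k then P k j else 0)
      - (\<Sum>k<n. if k = j then P i k else 0) + (\<Sum>k<n. P i k * P k j)"
    unfolding msqrt_def P_def[symmetric]
    by (simp only: sum_subtractf[symmetric] sum.distrib[symmetric])
      (intro sum.cong refl, auto simp: algebra_simps)
  then show ?thesis using PP ij by simp
qed

end

text \<open>The form of M is at most n B |v|^2, because |v i| |v j| is at most the mean of the two
  squares. The summand 1 in the denominator of c covers the case n B = 0.\<close>

lemma psd_scaled:
  assumes M: "psd n M" and B: "\<And>i j. i < n \<Longrightarrow> j < n \<Longrightarrow> cmod (M i j) \<le> B" "0 \<le> B"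
    and c: "c = 1 / (1 + real n * B)"
  shows "psd n (\<lambda>i j. of_real c * M i j)"
    and "psd n (\<lambda>i j. (if i = j then 1 else 0) - of_real c * M i j)"
proof -
  have c0: "0 < c" "c * (real n * B) \<le> 1"
    using B(2) unfolding c by (auto simp: field_simps add_pos_nonneg)
  have eq: "(\<Sum>i<n. \<Sum>j<n. cnj (v i) * (of_real c * M i j) * v j) =
      of_real c * (\<Sum>i<n. \<Sum>j<n. cnj (v i) * M i j * v j)" for v
    by (simp add: sum_distrib_left ac_simps)
  show "psd n (\<lambda>i j. of_real c * M i j)"
  proof -
    have "0 \<le> c * Re (\<Sum>i<n. \<Sum>j<n. cnj (v i) * M i j * v j)" for v
      using psd_nonneg[OF M, of v] c0(1) by simp
    moreover have "of_real c * M j i = cnj (of_real c * M i j)" if "i < n" "j < n" for i j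
      unfolding psd_hermitian[OF M that] by simp
    ultimately show ?thesis
      unfolding psd_def eq by auto
  qed
  have "0 \<le> Re (\<Sum>i<n. \<Sum>j<n. cnj (v i) * ((if i = j then 1 else 0) - of_real c * M i j) * v j)"
    (is "0 \<le> Re ?L") for v
  proof -
    let ?N = "\<Sum>i<n. (cmod (v i))\<^sup>2"
    have "?L = (\<Sum>i<n. \<Sum>j<n. (if i = j then cnj (v i) * v j else 0)) -
        (\<Sum>i<n. \<Sum>j<n. cnj (v i) * (of_real c * M i j) * v j)"
      by (simp only: sum_subtractf[symmetric]) (intro sum.cong refl, auto simp: algebra_simps)
    also have "(\<Sum>i<n. \<Sum>j<n. (if i = j then cnj (v i) * v j else 0)) = (\<Sum>i<n. cnj (v i) * v i)"
      by (intro sum.cong refl) (simp add: sum.delta)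
    also have "\<dots> = of_real ?N"
      unfolding of_real_sum by (intro sum.cong refl) (metis complex_norm_square mult.commute)
    finally have L: "Re ?L = ?N - c * Re (\<Sum>i<n. \<Sum>j<n. cnj (v i) * M i j * v j)"
      unfolding eq by simp
    have "Re (\<Sum>i<n. \<Sum>j<n. cnj (v i) * M i j * v j) \<le>
        (\<Sum>i<n. \<Sum>j<n. B * (((cmod (v i))\<^sup>2 + (cmod (v j))\<^sup>2) / 2))"
      unfolding Re_sum
    proof (intro sum_mono)
      fix i j assume "i \<in> {..<n}" "j \<in> {..<n}"
      then have "cmod (M i j) \<le> B" using B by auto
      have "Re (cnj (v i) * M i j * v j) \<le> cmod (M i j) * (cmod (v i) * cmod (v j))"
        using complex_Re_le_cmod[of "cnj (v i) * M i j * v j"] by (simp add: norm_mult ac_simps)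
      also have "\<dots> \<le> B * (((cmod (v i))\<^sup>2 + (cmod (v j))\<^sup>2) / 2)"
        using \<open>cmod (M i j) \<le> B\<close> B(2) sum_squares_bound[of "cmod (v i)" "cmod (v j)"]
        by (intro mult_mono) auto
      finally show "Re (cnj (v i) * M i j * v j) \<le> B * (((cmod (v i))\<^sup>2 + (cmod (v j))\<^sup>2) / 2)" .
    qed
    also have "\<dots> = real n * B * ?N"
    proof -
      have "(\<Sum>i<n. \<Sum>j<n. B * (((cmod (v i))\<^sup>2 + (cmod (v j))\<^sup>2) / 2)) =
          B * (((\<Sum>i<n. \<Sum>j<n. (cmod (v i))\<^sup>2) + (\<Sum>i<n. \<Sum>j<n. (cmod (v j))\<^sup>2)) / 2)"
        by (simp only: sum_distrib_left[symmetric] sum_divide_distrib[symmetric] sum.distrib)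
      then show ?thesis
        by (simp add: sum_distrib_left[symmetric])
    qed
    finally have "c * Re (\<Sum>i<n. \<Sum>j<n. cnj (v i) * M i j * v j) \<le> c * (real n * B * ?N)"
      using c0 by (intro mult_left_mono) auto
    also have "\<dots> = (c * (real n * B)) * ?N" by simp
    also have "\<dots> \<le> 1 * ?N"
      using c0 by (intro mult_right_mono) (auto intro: sum_nonneg)
    finally show ?thesis using L by simp
  qed
  moreover have "(if j = i then 1 else 0) - complex_of_real c * M j i =
      cnj ((if i = j then 1 else 0) - of_real c * M i j)" if "i < n" "j < n" for i j
    unfolding psd_hermitian[OF M that] by simp
  ultimately show "psd n (\<lambda>i j. (if i = j then 1 else 0) - of_real c * M i j)"
    unfolding psd_def by blast
qed


section \<open>Algebras of bounded functions\<close>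

text \<open>Common axioms of \<open>C(Y)\<close> and of the bounded functions on the arrows. Closure
  under uniform limits is the source of completeness, of square roots and of the quotients in the
  Cohen factorisation. Elements vanish off T, so that they are determined by their values on
  T.\<close>

locale fun_alg =
  fixes T :: "'y set" and V :: "('y \<Rightarrow> complex) set"
  assumes vanish: "f \<in> V \<Longrightarrow> y \<notin> T \<Longrightarrow> f y = 0"
    and bounded_on: "f \<in> V \<Longrightarrow> \<exists>B. \<forall>y\<in>T. cmod (f y) \<le> B"
    and one_in: "(\<lambda>y. if y \<in> T then 1 else 0) \<in> V"
    and add_in: "f \<in> V \<Longrightarrow> g \<in> V \<Longrightarrow> (\<lambda>y. f y + g y) \<in> V"
    and mult_in: "f \<in> V \<Longrightarrow> g \<in> V \<Longrightarrow> (\<lambda>y. f y * g y) \<in> V"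
    and scale_in: "f \<in> V \<Longrightarrow> (\<lambda>y. c * f y) \<in> V"
    and cnj_in: "f \<in> V \<Longrightarrow> (\<lambda>y. cnj (f y)) \<in> V"
    and uniform_limit_in:
      "\<lbrakk>\<And>y. y \<notin> T \<Longrightarrow> f y = 0; \<And>e. e > 0 \<Longrightarrow> \<exists>g\<in>V. \<forall>y\<in>T. cmod (f y - g y) \<le> e\<rbrakk> \<Longrightarrow> f \<in> V"
begin

lemma zero_in: "(\<lambda>y. 0) \<in> V"
  using scale_in[OF one_in, of 0] by simp

lemma uminus_in: "f \<in> V \<Longrightarrow> (\<lambda>y. - f y) \<in> V"
  using scale_in[of f "-1"] by simp

lemma diff_in: "f \<in> V \<Longrightarrow> g \<in> V \<Longrightarrow> (\<lambda>y. f y - g y) \<in> V"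
  using add_in[OF _ uminus_in, of f g] by simp

lemma sum_in: "(\<And>i. i \<in> I \<Longrightarrow> F i \<in> V) \<Longrightarrow> (\<lambda>y. \<Sum>i\<in>I. F i y) \<in> V"
  by (induction I rule: infinite_finite_induct) (auto simp: zero_in intro: add_in)

lemma bound_ex:
  assumes "f \<in> V"
  obtains B where "0 < B" "\<And>y. cmod (f y) \<le> B"
proof -
  obtain B where B: "\<forall>y\<in>T. cmod (f y) \<le> B" using bounded_on[OF assms] by blast
  have "cmod (f y) \<le> max B 1" for y
  proof (cases "y \<in> T")
    case True
    then have "cmod (f y) \<le> B" using B by blast
    then show ?thesis by linarith
  next
    case False
    then show ?thesis by (simp add: vanish[OF assms False])
  qed
  then show ?thesis by (intro that[of "max B 1"]) auto
qed

text \<open>After scaling, the values of M lie between 0 and 1. The partial sums of the root series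
  are then polynomials in the entries, and they converge uniformly by
  \<open>msqrt_approx\<close>.\<close>

lemma root_in:
  assumes M: "\<And>i j. i < n \<Longrightarrow> j < n \<Longrightarrow> M i j \<in> V" and pos: "\<And>t. t \<in> T \<Longrightarrow> psd n (\<lambda>i j. M i j t)"
  obtains Z where "\<And>i j. i < n \<Longrightarrow> j < n \<Longrightarrow> Z i j \<in> V"
    and "\<And>i j t. i < n \<Longrightarrow> j < n \<Longrightarrow> M i j t = (\<Sum>k<n. cnj (Z k i t) * Z k j t)"
proof -
  have "\<exists>b. i < n \<longrightarrow> j < n \<longrightarrow> 0 < b \<and> (\<forall>t. cmod (M i j t) \<le> b)" for i j
    using bound_ex[OF M, of i j] by blast
  then obtain b where b: "\<And>i j. i < n \<Longrightarrow> j < n \<Longrightarrow> 0 < b i j \<and> (\<forall>t. cmod (M i j t) \<le> b i j)"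
    by metis
  define B where "B = (\<Sum>i<n. \<Sum>j<n. b i j)"
  have B: "cmod (M i j t) \<le> B" if "i < n" "j < n" for i j t
  proof -
    have "cmod (M i j t) \<le> b i j" using b that by blast
    also have "\<dots> \<le> (\<Sum>j<n. b i j)"
      using b that by (intro member_le_sum) (auto intro: less_imp_le)
    also have "\<dots> \<le> B"
      unfolding B_def using b that
      by (intro member_le_sum[of i "{..<n}" "\<lambda>i. \<Sum>j<n. b i j"]) (auto intro!: sum_nonneg intro: less_imp_le)
    finally show ?thesis .
  qed
  have B0: "0 \<le> B"
    unfolding B_def using b by (intro sum_nonneg) (auto intro: less_imp_le)
  define c where "c = 1 / (1 + real n * B)"
  have c0: "0 < c" using B0 by (simp add: c_def add_pos_nonneg)
  \<comment> \<open>\<open>msqrt\<close> gives the root of 1 minus its argument, so the root of c M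
    is taken at 1 - c M.\<close>
  define S where "S t i j = (if i = j then 1 else 0) - complex_of_real c * M i j t" for t i j
  have S: "psd n (S t)" and S1: "psd n (\<lambda>i j. (if i = j then 1 else 0) - S t i j)" if "t \<in> T" for t
    using psd_scaled[OF pos[OF that] B B0 c_def] by (simp_all add: S_def[abs_def])
  define P where "P a i j t = (if t \<in> T then mpow n (S t) a i j else 0)" for a i j t
  have S_in: "(\<lambda>t. if t \<in> T then S t i j else 0) \<in> V" if "i < n" "j < n" for i j
  proof -
    have "(\<lambda>t. if t \<in> T then S t i j else 0) =
        (\<lambda>t. (if i = j then 1 else 0) * (if t \<in> T then 1 else 0) - of_real c * M i j t)"
      by (rule ext) (auto simp: S_def vanish[OF M[OF that]])
    then show ?thesis
      by (simp only:) (intro diff_in scale_in one_in M that)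
  qed
  have P_in: "P a i j \<in> V" if "i < n" "j < n" for a i j
    using that
  proof (induction a arbitrary: i)
    case 0
    have "P 0 i j = (\<lambda>t. (if i = j then 1 else 0) * (if t \<in> T then 1 else 0))"
      by (rule ext) (simp add: P_def)
    then show ?case by (simp only:) (intro scale_in one_in)
  next
    case (Suc a)
    have "P (Suc a) i j = (\<lambda>t. \<Sum>k<n. (if t \<in> T then S t i k else 0) * P a k j t)"
      by (rule ext) (simp add: P_def)
    then show ?case
      using Suc by (simp only:) (intro sum_in mult_in S_in, auto)
  qed
  define R where "R i j t = (if t \<in> T then msqrt n (S t) i j else 0)" for i j t
  have R_in: "R i j \<in> V" if ij: "i < n" "j < n" for i j
  proof (rule uniform_limit_in)
    fix e :: real assume "e > 0"
    have "(\<lambda>N. \<Sum>a<N. sqrt_coeff a) \<longlonglongrightarrow> suminf sqrt_coeff"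
      by (rule summable_LIMSEQ[OF summable_sqrt_coeff])
    then obtain N where "dist (\<Sum>a<N. sqrt_coeff a) (suminf sqrt_coeff) < e"
      using \<open>e > 0\<close> unfolding lim_sequentially by blast
    then have N: "suminf sqrt_coeff - (\<Sum>a<N. sqrt_coeff a) \<le> e"
      by (simp add: dist_real_def)
    let ?g = "\<lambda>t. (if i = j then 1 else 0) * (if t \<in> T then 1 else 0) -
      (\<Sum>a<N. of_real (sqrt_coeff a) * P a i j t)"
    have "?g \<in> V"
      by (intro diff_in scale_in one_in sum_in P_in ij)
    moreover have "cmod (R i j t - ?g t) \<le> e" if "t \<in> T" for t
      using msqrt_approx[OF S[OF that] S1[OF that] ij, of N] N that
      by (simp add: R_def P_def)
    ultimately show "\<exists>g\<in>V. \<forall>t\<in>T. cmod (R i j t - g t) \<le> e"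
      by (intro bexI[of _ ?g] ballI)
  qed (simp add: R_def)
  \<comment> \<open>The factor undoes the scaling in Z* Z. The root is hermitian, so Z* Z is its
    square up to this factor.\<close>
  define Z where "Z i j t = complex_of_real (1 / sqrt c) * R i j t" for i j t
  show thesis
  proof (rule that[of Z])
    show "Z i j \<in> V" if "i < n" "j < n" for i j
      unfolding Z_def[abs_def] by (intro scale_in R_in that)
    show "M i j t = (\<Sum>k<n. cnj (Z k i t) * Z k j t)" if ij: "i < n" "j < n" for i j t
    proof (cases "t \<in> T")
      case True
      have "cnj (Z k i t) * Z k j t = of_real (1 / c) * (msqrt n (S t) i k * msqrt n (S t) k j)"
        if "k < n" for k
      proof -
        have "complex_of_real (sqrt c) * complex_of_real (sqrt c) = of_real c"
          using c0 by (simp flip: of_real_mult)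
        then show ?thesis
          using True msqrt_hermitian[OF S[OF True] S1[OF True] that ij(1)]
          by (simp add: Z_def R_def)
      qed
      then have "(\<Sum>k<n. cnj (Z k i t) * Z k j t) =
          of_real (1 / c) * (\<Sum>k<n. msqrt n (S t) i k * msqrt n (S t) k j)"
        by (simp add: sum_distrib_left)
      also have "\<dots> = of_real (1 / c) * (of_real c * M i j t)"
        by (subst msqrt_square[OF S[OF True] S1[OF True] ij]) (simp add: S_def)
      also have "\<dots> = M i j t" using c0 by simp
      finally show ?thesis by simp
    next
      case False
      then show ?thesis using vanish[OF M[OF ij] False] by (simp add: Z_def R_def)
    qed
  qed
qed

end

section \<open>Algebras of functions as C*-algebras\<close>

definition galg :: "'g groupoid \<Rightarrow> ('g, 'y) gspace \<Rightarrow> ('y \<Rightarrow> complex) set \<Rightarrow> ('g, 'y \<Rightarrow> complex) gcstar"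
  where "galg G Y V = (C_galg G Y)\<lparr>carrier := V\<rparr>"

text \<open>Replacing only the carrier of \<open>C_galg\<close> lets the same proofs cover
  \<open>C(Y)\<close> and algebras of discontinuous functions.\<close>

lemma C_galg_eq_galg: "C_galg G Y = galg G Y (continuous_functions (sptop Y))"
  by (simp add: galg_def C_galg_def C_alg_def cstar.defs gcstar.defs)

lemma galg_simps [simp]:
  "carrier (galg G Y V) = V"
  "mult (galg G Y V) f g = (\<lambda>y. f y * g y)"
  "one (galg G Y V) = (\<lambda>y. if y \<in> topspace (sptop Y) then 1 else 0)"
  "zero (galg G Y V) = (\<lambda>y. 0)"
  "add (galg G Y V) f g = (\<lambda>y. f y + g y)"
  "scale (galg G Y V) c f = (\<lambda>y. c * f y)"
  "adj (galg G Y V) f = (\<lambda>y. cnj (f y))"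
  "incl (galg G Y V) k = (\<lambda>y. if y \<in> topspace (sptop Y) then k (proj Y y) else 0)"
  "bact (galg G Y V) \<gamma> f = (\<lambda>y. if y \<in> topspace (sptop Y) \<and> proj Y y \<in> bis_im G \<gamma>
        then f (act Y (ginv G (the_inv_into \<gamma> (rng G) (proj Y y))) y) else 0)"
  by (simp_all add: galg_def C_galg_def C_alg_def cstar.defs gcstar.defs)

lemma nrm_galg: "nrm (galg G Y V) f = Sup (insert 0 ((\<lambda>y. cmod (f y)) ` topspace (sptop Y)))"
  by (simp add: galg_def C_galg_def C_alg_def cstar.defs gcstar.defs)

text \<open>The part of the axioms of \<open>cstar_algebra\<close> that makes \<open>norm_dist\<close> a metric; it is needed before
  completeness can be proved.\<close>

locale normed_ring = ring A for A :: "('a, 'm) cstar_scheme" (structure) +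
  assumes nscale_closed: "x \<in> carrier A \<Longrightarrow> scale A c x \<in> carrier A"
    and nscale_add: "x \<in> carrier A \<Longrightarrow> scale A (c + d) x = scale A c x \<oplus> scale A d x"
    and nscale_one: "x \<in> carrier A \<Longrightarrow> scale A 1 x = x"
    and nnrm_nonneg: "x \<in> carrier A \<Longrightarrow> 0 \<le> nrm A x"
    and nnrm_eq_0: "x \<in> carrier A \<Longrightarrow> nrm A x = 0 \<longleftrightarrow> x = \<zero>"
    and nnrm_add: "\<lbrakk>x \<in> carrier A; y \<in> carrier A\<rbrakk> \<Longrightarrow> nrm A (x \<oplus> y) \<le> nrm A x + nrm A y"
    and nnrm_scale: "x \<in> carrier A \<Longrightarrow> nrm A (scale A c x) = cmod c * nrm A x"
begin

lemma a_inv_scale: "x \<in> carrier A \<Longrightarrow> \<ominus> x = scale A (-1) x"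
proof -
  assume x: "x \<in> carrier A"
  have "scale A 0 x \<oplus> scale A 0 x = scale A 0 x"
    using nscale_add[OF x, of 0 0] by simp
  then have "scale A 0 x = \<zero>"
    using x by (metis nscale_closed add.r_cancel_one')
  then have "scale A (-1) x \<oplus> x = \<zero>"
    using nscale_add[OF x, of "-1" 1] nscale_one[OF x] by simp
  then show ?thesis
    using x by (intro minus_equality nscale_closed)
qed

lemma nrm_a_inv: "x \<in> carrier A \<Longrightarrow> nrm A (\<ominus> x) = nrm A x"
  by (simp add: a_inv_scale nnrm_scale)

lemma Metric_space_norm_dist: "Metric_space (carrier A) (norm_dist A)"
proof
  fix x y
  show "0 \<le> norm_dist A x y"
    by (auto simp: norm_dist_def intro: nnrm_nonneg)
  show "norm_dist A x y = norm_dist A y x"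
  proof (cases "x \<in> carrier A \<and> y \<in> carrier A")
    case True
    then have "\<ominus> (x \<ominus> y) = y \<ominus> x"
      by (simp add: minus_eq minus_add a_comm)
    then show ?thesis
      using True nrm_a_inv[of "x \<ominus> y"] by (simp add: norm_dist_def)
  qed (auto simp: norm_dist_def)
next
  fix x y assume xy: "x \<in> carrier A" "y \<in> carrier A"
  then have "x \<ominus> y = \<zero> \<longleftrightarrow> x = y"
    by (metis minus_eq r_neg add.inv_closed minus_equality minus_minus)
  then show "norm_dist A x y = 0 \<longleftrightarrow> x = y"
    using xy by (simp add: norm_dist_def nnrm_eq_0)
  fix z assume z: "z \<in> carrier A"
  have "x \<ominus> z = (x \<ominus> y) \<oplus> (y \<ominus> z)"
    using xy z by (simp add: minus_eq a_assoc) (simp add: r_neg1 l_neg flip: a_assoc)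
  then show "norm_dist A x z \<le> norm_dist A x y + norm_dist A y z"
    using xy z by (simp add: norm_dist_def nnrm_add)
qed

lemma topspace_norm_top: "topspace (norm_top A) = carrier A"
  unfolding norm_top_def by (rule Metric_space.topspace_mtopology[OF Metric_space_norm_dist])

end

sublocale cstar_algebra \<subseteq> normed_ring A
  by unfold_locales (auto intro: scale_closed scale_add_left scale_one nrm_nonneg nrm_add
      simp: nrm_scale nrm_eq_0)

locale fun_galg = fun_alg "topspace (sptop Y)" V
  for G :: "'g groupoid" and Y :: "('g, 'y) gspace" and V
begin

abbreviation "A \<equiv> galg G Y V"
abbreviation "T \<equiv> topspace (sptop Y)"

lemma nrm_le_iff: "0 \<le> B \<Longrightarrow> f \<in> V \<Longrightarrow> nrm A f \<le> B \<longleftrightarrow> (\<forall>t. cmod (f t) \<le> B)"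
proof -
  assume "0 \<le> B" and f: "f \<in> V"
  obtain C where "\<And>y. cmod (f y) \<le> C" "0 < C" using bound_ex[OF f] by blast
  then have "bdd_above (insert 0 ((\<lambda>y. cmod (f y)) ` T))"
    by (intro bdd_aboveI[of _ C]) auto
  then have "nrm A f \<le> B \<longleftrightarrow> (\<forall>t\<in>T. cmod (f t) \<le> B)"
    using \<open>0 \<le> B\<close> unfolding nrm_galg by (subst cSup_le_iff) auto
  also have "\<dots> \<longleftrightarrow> (\<forall>t. cmod (f t) \<le> B)"
    using vanish[OF f] \<open>0 \<le> B\<close> by (metis norm_zero)
  finally show ?thesis .
qed

lemma nrm_ge_0: "f \<in> V \<Longrightarrow> 0 \<le> nrm A f"
proof -
  assume f: "f \<in> V"
  obtain C where "\<And>y. cmod (f y) \<le> C" "0 < C" using bound_ex[OF f] by blast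
  then have "bdd_above (insert 0 ((\<lambda>y. cmod (f y)) ` T))"
    by (intro bdd_aboveI[of _ C]) auto
  then show ?thesis
    unfolding nrm_galg by (intro cSup_upper) auto
qed

lemma le_nrm: "f \<in> V \<Longrightarrow> cmod (f t) \<le> nrm A f"
  using nrm_le_iff[OF nrm_ge_0[of f], of f] by simp

lemma ring_galg: "ring A"
proof (rule ringI)
  show "abelian_group A"
  proof (rule abelian_groupI)
    fix f assume "f \<in> carrier A"
    then show "\<exists>g\<in>carrier A. g \<oplus>\<^bsub>A\<^esub> f = \<zero>\<^bsub>A\<^esub>"
      by (intro bexI[of _ "\<lambda>y. - f y"]) (auto intro: uminus_in)
  qed (auto intro: add_in zero_in simp: ac_simps)
  show "monoid A"
  proof (rule monoidI)
    fix f assume "f \<in> carrier A"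
    then have "f y = 0" if "y \<notin> T" for y using vanish that by simp
    then show "\<one>\<^bsub>A\<^esub> \<otimes>\<^bsub>A\<^esub> f = f" "f \<otimes>\<^bsub>A\<^esub> \<one>\<^bsub>A\<^esub> = f"
      by (auto simp: fun_eq_iff)
  qed (auto intro: mult_in one_in simp: ac_simps)
qed (auto simp: algebra_simps)

lemma nrm_eqI:
  assumes "f \<in> V" "0 \<le> B" "\<And>C. 0 \<le> C \<Longrightarrow> (\<forall>t. cmod (f t) \<le> C) \<longleftrightarrow> B \<le> C"
  shows "nrm A f = B"
proof (rule antisym)
  show "nrm A f \<le> B"
    using nrm_le_iff[OF assms(2,1)] assms(3)[OF assms(2)] by simp
  show "B \<le> nrm A f"
    using le_nrm[OF assms(1)] assms(3)[OF nrm_ge_0[OF assms(1)]] by simp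
qed

lemma normed_ring_galg: "normed_ring A"
proof (intro normed_ring.intro normed_ring_axioms.intro ring_galg)
  fix f assume f: "f \<in> carrier A"
  then have f': "f \<in> V" by simp
  show "scale A c f \<in> carrier A" for c
    using f by (simp add: scale_in)
  show "scale A 1 f = f"
    by simp
  show "0 \<le> nrm A f"
    using nrm_ge_0[OF f'] .
  show "nrm A f = 0 \<longleftrightarrow> f = \<zero>\<^bsub>A\<^esub>"
  proof
    assume "nrm A f = 0"
    then show "f = \<zero>\<^bsub>A\<^esub>" using le_nrm[OF f'] by (auto)
  next
    assume "f = \<zero>\<^bsub>A\<^esub>"
    then have "nrm A f \<le> 0" using nrm_le_iff[of 0 f] f' by simp
    then show "nrm A f = 0" using nrm_ge_0[OF f'] by linarith
  qed
  show "nrm A (scale A c f) = cmod c * nrm A f" for c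
  proof (rule nrm_eqI)
    show "scale A c f \<in> V" using f by (simp add: scale_in)
    show "0 \<le> cmod c * nrm A f" using nrm_ge_0[OF f'] by simp
    fix C :: real assume "0 \<le> C"
    show "(\<forall>t. cmod (scale A c f t) \<le> C) \<longleftrightarrow> cmod c * nrm A f \<le> C"
    proof (cases "c = 0")
      case False
      then have "(\<forall>t. cmod (scale A c f t) \<le> C) \<longleftrightarrow> (\<forall>t. cmod (f t) \<le> C / cmod c)"
        by (simp add: norm_mult field_simps)
      also have "\<dots> \<longleftrightarrow> nrm A f \<le> C / cmod c"
        using nrm_le_iff[OF _ f', of "C / cmod c"] \<open>0 \<le> C\<close> by simp
      finally show ?thesis using False by (simp add: field_simps)
    qed (use \<open>0 \<le> C\<close> in simp)
  qed
  fix g assume g: "g \<in> carrier A"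
  then have g': "g \<in> V" by simp
  show "nrm A (f \<oplus>\<^bsub>A\<^esub> g) \<le> nrm A f + nrm A g"
  proof (subst nrm_le_iff)
    show "0 \<le> nrm A f + nrm A g" using nrm_ge_0[OF f'] nrm_ge_0[OF g'] by linarith
    show "f \<oplus>\<^bsub>A\<^esub> g \<in> V" using f g by (simp add: add_in)
    show "\<forall>t. cmod ((f \<oplus>\<^bsub>A\<^esub> g) t) \<le> nrm A f + nrm A g"
      using le_nrm[OF f'] le_nrm[OF g'] by (auto intro: norm_triangle_mono)
  qed
qed (auto simp: algebra_simps)

sublocale normed_ring A by (rule normed_ring_galg)

lemma minus_galg: "f \<in> V \<Longrightarrow> g \<in> V \<Longrightarrow> f \<ominus>\<^bsub>A\<^esub> g = (\<lambda>y. f y - g y)"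
  by (simp add: minus_eq a_inv_scale)

lemma norm_dist_le_iff:
  "f \<in> V \<Longrightarrow> g \<in> V \<Longrightarrow> 0 \<le> B \<Longrightarrow> norm_dist A f g \<le> B \<longleftrightarrow> (\<forall>t. cmod (f t - g t) \<le> B)"
  using nrm_le_iff[OF _ diff_in, of B f g] by (simp add: norm_dist_def minus_galg)

sublocale M: Metric_space V "norm_dist A"
  using Metric_space_norm_dist by simp

text \<open>The pointwise limit of a Cauchy sequence is uniform, and V is closed under uniform
  limits.\<close>

lemma mcomplete_galg: "M.mcomplete"
  unfolding M.mcomplete_def
proof (intro allI impI)
  fix \<sigma> assume "M.MCauchy \<sigma>"
  then have \<sigma>: "\<And>n. \<sigma> n \<in> V" and C: "\<And>e. e > 0 \<Longrightarrow> \<exists>N. \<forall>n n'. N \<le> n \<longrightarrow> N \<le> n' \<longrightarrow> norm_dist A (\<sigma> n) (\<sigma> n') < e"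
    unfolding M.MCauchy_def by auto
  have C': "\<exists>N. \<forall>n\<ge>N. \<forall>m\<ge>N. \<forall>t. cmod (\<sigma> n t - \<sigma> m t) \<le> e" if "e > 0" for e
    using C[OF that] norm_dist_le_iff[OF \<sigma> \<sigma>, of e] that by (meson less_imp_le)
  have "Cauchy (\<lambda>n. \<sigma> n t)" for t
  proof (rule CauchyI)
    fix e :: real assume "0 < e"
    then obtain N where "\<forall>n\<ge>N. \<forall>m\<ge>N. \<forall>t. cmod (\<sigma> n t - \<sigma> m t) \<le> e / 2"
      using C'[of "e / 2"] by auto
    then have "cmod (\<sigma> m t - \<sigma> n t) < e" if "m \<ge> N" "n \<ge> N" for m n
      using that \<open>0 < e\<close> by (smt (verit) field_sum_of_halves)
    then show "\<exists>M. \<forall>m\<ge>M. \<forall>n\<ge>M. cmod (\<sigma> m t - \<sigma> n t) < e" by blast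
  qed
  then have conv: "convergent (\<lambda>n. \<sigma> n t)" for t
    by (simp add: Cauchy_convergent)
  define l where "l t = lim (\<lambda>n. \<sigma> n t)" for t
  have l: "(\<lambda>n. \<sigma> n t) \<longlonglongrightarrow> l t" for t
    using conv[of t] unfolding l_def by (simp add: convergent_LIMSEQ_iff)
  have unif: "\<exists>N. \<forall>n\<ge>N. \<forall>t. cmod (\<sigma> n t - l t) \<le> e" if e: "e > 0" for e
  proof -
    obtain N where N: "\<forall>n\<ge>N. \<forall>m\<ge>N. \<forall>t. cmod (\<sigma> n t - \<sigma> m t) \<le> e"
      using C'[OF e] by blast
    have "cmod (\<sigma> n t - l t) \<le> e" if "n \<ge> N" for n t
    proof (rule LIMSEQ_le_const2)
      show "(\<lambda>m. cmod (\<sigma> n t - \<sigma> m t)) \<longlonglongrightarrow> cmod (\<sigma> n t - l t)"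
        by (intro tendsto_intros l)
      show "\<exists>N. \<forall>m\<ge>N. cmod (\<sigma> n t - \<sigma> m t) \<le> e"
        using N that by blast
    qed
    then show ?thesis by blast
  qed
  have "l \<in> V"
  proof (rule uniform_limit_in)
    show "l y = 0" if "y \<notin> T" for y
      using l[of y] vanish[OF \<sigma> that] by (simp add: LIMSEQ_const_iff)
    fix e :: real assume "e > 0"
    then obtain N where "\<forall>n\<ge>N. \<forall>t. cmod (\<sigma> n t - l t) \<le> e" using unif by blast
    then show "\<exists>g\<in>V. \<forall>y\<in>T. cmod (l y - g y) \<le> e"
      using \<sigma>[of N] by (metis norm_minus_commute order_refl)
  qed
  have "limitin M.mtopology \<sigma> l sequentially"
    unfolding M.limit_metric_sequentially
  proof (intro conjI allI impI \<open>l \<in> V\<close>)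
    fix e :: real assume "e > 0"
    then obtain N where "\<forall>n\<ge>N. \<forall>t. cmod (\<sigma> n t - l t) \<le> e / 2" using unif[of "e / 2"] by auto
    then have "norm_dist A (\<sigma> n) l \<le> e / 2" if "n \<ge> N" for n
      using norm_dist_le_iff[OF \<sigma> \<open>l \<in> V\<close>, of "e / 2" n] \<open>e > 0\<close> that by simp
    then show "\<exists>N. \<forall>n\<ge>N. \<sigma> n \<in> V \<and> norm_dist A (\<sigma> n) l < e"
      using \<sigma> \<open>e > 0\<close> by (intro exI[of _ N]) fastforce
  qed
  then show "\<exists>l. limitin M.mtopology \<sigma> l sequentially" by blast
qed

lemma cstar_algebra_galg: "cstar_algebra A"
proof (intro cstar_algebra.intro cstar_algebra_axioms.intro ring_galg)
  fix f assume f: "f \<in> carrier A"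
  then have f': "f \<in> V" by simp
  show "nrm A (adj A f \<otimes>\<^bsub>A\<^esub> f) = (nrm A f)\<^sup>2"
  proof (rule nrm_eqI)
    show "adj A f \<otimes>\<^bsub>A\<^esub> f \<in> V" using f by (simp add: mult_in cnj_in)
    fix C :: real assume C: "0 \<le> C"
    have "(\<forall>t. cmod ((adj A f \<otimes>\<^bsub>A\<^esub> f) t) \<le> C) \<longleftrightarrow> (\<forall>t. cmod (f t) \<le> sqrt C)"
      using C by (simp add: norm_mult real_le_rsqrt real_sqrt_le_iff flip: power2_eq_square)
        (metis real_le_rsqrt real_sqrt_le_iff real_sqrt_abs abs_norm_cancel)
    also have "\<dots> \<longleftrightarrow> nrm A f \<le> sqrt C"
      using C by (simp add: nrm_le_iff[OF _ f'])
    also have "\<dots> \<longleftrightarrow> (nrm A f)\<^sup>2 \<le> C"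
      using C nrm_ge_0[OF f'] by (metis real_le_rsqrt real_sqrt_le_iff real_sqrt_abs abs_of_nonneg)
    finally show "(\<forall>t. cmod ((adj A f \<otimes>\<^bsub>A\<^esub> f) t) \<le> C) \<longleftrightarrow> (nrm A f)\<^sup>2 \<le> C" .
  qed simp
  fix g assume g: "g \<in> carrier A"
  then have g': "g \<in> V" by simp
  show "nrm A (f \<otimes>\<^bsub>A\<^esub> g) \<le> nrm A f * nrm A g"
  proof (subst nrm_le_iff)
    show "0 \<le> nrm A f * nrm A g" using nrm_ge_0[OF f'] nrm_ge_0[OF g'] by simp
    show "f \<otimes>\<^bsub>A\<^esub> g \<in> V" using f g by (simp add: mult_in)
    show "\<forall>t. cmod ((f \<otimes>\<^bsub>A\<^esub> g) t) \<le> nrm A f * nrm A g"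
      using le_nrm[OF f'] le_nrm[OF g'] nrm_ge_0[OF f']
      by (auto simp: norm_mult intro: mult_mono)
  qed
next
  show "Metric_space.mcomplete (carrier A) (norm_dist A)"
    using mcomplete_galg by simp
qed (use normed_ring_galg[THEN normed_ring.axioms(2)] in
    \<open>auto simp: normed_ring_axioms_def scale_in cnj_in algebra_simps\<close>)

lemma finsum_galg:
  fixes n :: nat
  assumes "\<And>k. k < n \<Longrightarrow> F k \<in> V"
  shows "finsum A F {..<n} = (\<lambda>y. \<Sum>k<n. F k y)"
  using assms
proof (induction n)
  case (Suc n)
  have "{..<Suc n} = insert n {..<n}" by auto
  then have "finsum A F {..<Suc n} = F n \<oplus>\<^bsub>A\<^esub> finsum A F {..<n}"
    using Suc.prems by (simp only:) (subst finsum_insert, auto)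
  then show ?case using Suc by (simp add: add.commute)
qed (simp add: finsum_empty)

text \<open>One direction is a Gram matrix at each point; the other needs a root with entries in V,
  which is \<open>root_in\<close>. Complete positivity between function algebras can then be checked
  pointwise.\<close>

lemma mat_positive_galg:
  "mat_positive A n M \<longleftrightarrow> (\<forall>i<n. \<forall>j<n. M i j \<in> V) \<and> (\<forall>t\<in>T. psd n (\<lambda>i j. M i j t))"
proof
  assume "mat_positive A n M"
  then obtain Z where Z: "\<forall>i<n. \<forall>j<n. Z i j \<in> V"
    and M: "\<forall>i<n. \<forall>j<n. M i j = finsum A (\<lambda>k. adj A (Z k i) \<otimes>\<^bsub>A\<^esub> Z k j) {..<n}"
    unfolding mat_positive_def mat_carrier_def by auto
  have *: "M i j = (\<lambda>y. \<Sum>k<n. cnj (Z k i y) * Z k j y)" if "i < n" "j < n" for i j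
  proof -
    have "(\<lambda>y. cnj (Z k i y) * Z k j y) \<in> V" if "k < n" for k
      using Z that \<open>i < n\<close> \<open>j < n\<close> by (intro mult_in cnj_in) auto
    then show ?thesis
      using M that by (simp add: finsum_galg)
  qed
  have "M i j \<in> V" if "i < n" "j < n" for i j
    unfolding *[OF that] using Z that by (intro sum_in mult_in cnj_in) auto
  moreover have "psd n (\<lambda>i j. M i j t)" for t
  proof -
    have "psd n (\<lambda>i j. M i j t) \<longleftrightarrow> psd n (\<lambda>i j. \<Sum>k<n. cnj (Z k i t) * Z k j t)"
      by (rule psd_cong) (simp add: *)
    then show ?thesis using psd_gram[where n = n and m = n and Z = "\<lambda>k i. Z k i t"] by blast
  qed
  ultimately show "(\<forall>i<n. \<forall>j<n. M i j \<in> V) \<and> (\<forall>t\<in>T. psd n (\<lambda>i j. M i j t))" by blast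
next
  assume a: "(\<forall>i<n. \<forall>j<n. M i j \<in> V) \<and> (\<forall>t\<in>T. psd n (\<lambda>i j. M i j t))"
  obtain Z where Z: "\<And>i j. i < n \<Longrightarrow> j < n \<Longrightarrow> Z i j \<in> V"
    and M: "\<And>i j t. i < n \<Longrightarrow> j < n \<Longrightarrow> M i j t = (\<Sum>k<n. cnj (Z k i t) * Z k j t)"
    by (rule root_in[where n = n and M = M]) (use a in blast)+
  have "M i j = finsum A (\<lambda>k. adj A (Z k i) \<otimes>\<^bsub>A\<^esub> Z k j) {..<n}" if "i < n" "j < n" for i j
  proof -
    have "(\<lambda>y. cnj (Z k i y) * Z k j y) \<in> V" if "k < n" for k
      using that \<open>i < n\<close> \<open>j < n\<close> by (intro mult_in cnj_in Z)
    then show ?thesis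
      using M that by (simp add: finsum_galg fun_eq_iff)
  qed
  then show "mat_positive A n M"
    unfolding mat_positive_def mat_carrier_def using Z by (intro exI[of _ Z]) auto
qed

end


section \<open>Bisections of groupoids with compact unit space\<close>

lemma continuous_map_compose_continuous_on:
  assumes "continuous_map X euclidean f" "continuous_on UNIV g"
  shows "continuous_map X euclidean (\<lambda>x. g (f x))"
  using continuous_map_compose[OF assms(1), of euclidean g] assms(2) by (simp add: o_def)

lemma continuous_map_epsI:
  fixes f :: "'a \<Rightarrow> 'b::metric_space"
  assumes "\<And>x e. x \<in> topspace X \<Longrightarrow> e > 0 \<Longrightarrow> \<exists>U. openin X U \<and> x \<in> U \<and> (\<forall>y\<in>U. dist (f y) (f x) < e)"
  shows "continuous_map X euclidean f"
  unfolding continuous_map_def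
proof (intro conjI allI impI)
  fix W :: "'b set" assume "openin euclidean W"
  then have W: "open W" by simp
  show "openin X {x \<in> topspace X. f x \<in> W}"
  proof (subst openin_subopen, intro ballI)
    fix x assume x: "x \<in> {x \<in> topspace X. f x \<in> W}"
    then obtain e where "e > 0" and e: "\<forall>z. dist z (f x) < e \<longrightarrow> z \<in> W"
      using W unfolding open_dist by blast
    then obtain U where U: "openin X U" "x \<in> U" "\<forall>y\<in>U. dist (f y) (f x) < e"
      using assms[of x e] x by blast
    moreover have "U \<subseteq> {x \<in> topspace X. f x \<in> W}"
      using U e openin_subset by fastforce
    ultimately show "\<exists>T. openin X T \<and> x \<in> T \<and> T \<subseteq> {x \<in> topspace X. f x \<in> W}" by blast
  qed
qed simp

lemma continuous_map_epsD:
  fixes f :: "'a \<Rightarrow> 'b::metric_space"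
  assumes "continuous_map X euclidean f" "x \<in> topspace X" "e > 0"
  obtains U where "openin X U" "x \<in> U" "\<And>y. y \<in> U \<Longrightarrow> dist (f y) (f x) < e"
proof -
  have "openin euclidean (ball (f x) e)" by simp
  from openin_continuous_map_preimage[OF assms(1) this] show thesis
    using assms(2,3) by (intro that[of "{y \<in> topspace X. f y \<in> ball (f x) e}"]) (auto simp: dist_commute)
qed

text \<open>Translates by a bisection are defined over its image and set to 0 elsewhere. As U need
  not be closed, continuity at the remaining points is an estimate.\<close>

lemma continuous_map_extend_by_zero:
  fixes f :: "'a \<Rightarrow> 'b::real_normed_vector"
  assumes U: "openin X U" and f: "continuous_map (subtopology X U) euclidean f"
    and small: "\<And>x e. x \<in> topspace X \<Longrightarrow> x \<notin> U \<Longrightarrow> e > 0 \<Longrightarrow>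
      \<exists>W. openin X W \<and> x \<in> W \<and> (\<forall>y\<in>W \<inter> U. norm (f y) < e)"
  shows "continuous_map X euclidean (\<lambda>x. if x \<in> U then f x else 0)"
proof (rule continuous_map_epsI)
  fix x and e :: real assume x: "x \<in> topspace X" and e: "e > 0"
  show "\<exists>W. openin X W \<and> x \<in> W \<and>
      (\<forall>y\<in>W. dist (if y \<in> U then f y else 0) (if x \<in> U then f x else 0) < e)"
  proof (cases "x \<in> U")
    case True
    then obtain W where "openin (subtopology X U) W" "x \<in> W" "\<And>y. y \<in> W \<Longrightarrow> dist (f y) (f x) < e"
      using continuous_map_epsD[OF f _ e, of x] x by auto
    then show ?thesis
      using True U by (intro exI[of _ W]) (auto simp: openin_open_subtopology)
  next
    case False
    then obtain W where "openin X W" "x \<in> W" "\<forall>y\<in>W \<inter> U. norm (f y) < e"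
      using small[OF x False e] by blast
    then show ?thesis
      using False e by (intro exI[of _ W]) auto
  qed
qed

lemma continuous_functions_of_real:
  "continuous_map X euclideanreal v \<Longrightarrow>
    (\<lambda>x. if x \<in> topspace X then complex_of_real (v x) else 0) \<in> continuous_functions X"
proof -
  assume "continuous_map X euclideanreal v"
  then have "continuous_map X euclidean (\<lambda>x. complex_of_real (v x))"
    by (rule continuous_map_compose_continuous_on) (intro continuous_intros)
  then show ?thesis
    unfolding continuous_functions_def by (auto elim: continuous_map_eq)
qed

lemma fun_alg_continuous_functions:
  assumes "compact_space Y"
  shows "fun_alg (topspace Y) (continuous_functions Y)"
proof
  fix f y assume "f \<in> continuous_functions Y" "y \<notin> topspace Y"
  then show "f y = 0" by (simp add: continuous_functions_def)
next
  fix f assume "f \<in> continuous_functions Y"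
  then have "compactin euclidean (f ` topspace Y)"
    using assms by (intro image_compactin) (auto simp: continuous_functions_def compact_space_def)
  then have "bounded (f ` topspace Y)"
    by (simp add: compact_imp_bounded)
  then show "\<exists>B. \<forall>y\<in>topspace Y. cmod (f y) \<le> B"
    by (auto simp: bounded_iff)
next
  show "(\<lambda>y. if y \<in> topspace Y then 1 else 0) \<in> continuous_functions Y"
    using continuous_functions_of_real[of Y "\<lambda>_. 1"] unfolding of_real_1 by simp
next
  fix f g c assume f: "f \<in> continuous_functions Y"
  then have fc: "continuous_map Y euclidean f" by (simp add: continuous_functions_def)
  show "(\<lambda>y. c * f y) \<in> continuous_functions Y"
    using f continuous_map_compose_continuous_on[OF fc, of "\<lambda>z. c * z"]
    by (auto simp: continuous_functions_def intro!: continuous_intros)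
  show "(\<lambda>y. cnj (f y)) \<in> continuous_functions Y"
    using f continuous_map_compose_continuous_on[OF fc, of cnj]
    by (auto simp: continuous_functions_def intro!: continuous_intros)
  assume g: "g \<in> continuous_functions Y"
  then have gc: "continuous_map Y euclidean g" by (simp add: continuous_functions_def)
  show "(\<lambda>y. f y + g y) \<in> continuous_functions Y"
    using f g by (auto simp: continuous_functions_def intro!: continuous_intros)
  have "continuous_map Y euclidean (\<lambda>y. f y * g y)"
    using fc gc by (simp add: continuous_map_atin tendsto_mult)
  then show "(\<lambda>y. f y * g y) \<in> continuous_functions Y"
    using f by (auto simp: continuous_functions_def)
next
  fix f :: "'a \<Rightarrow> complex"
  assume zero: "\<And>y. y \<notin> topspace Y \<Longrightarrow> f y = 0"
    and lim: "\<And>e. e > 0 \<Longrightarrow> \<exists>g\<in>continuous_functions Y. \<forall>y\<in>topspace Y. cmod (f y - g y) \<le> e"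
  have "continuous_map Y euclidean f"
  proof (rule continuous_map_epsI)
    fix x and e :: real assume x: "x \<in> topspace Y" and e: "e > 0"
    obtain g where g: "g \<in> continuous_functions Y" "\<forall>y\<in>topspace Y. cmod (f y - g y) \<le> e / 4"
      using lim[of "e / 4"] e by auto
    obtain U where U: "openin Y U" "x \<in> U" "\<And>y. y \<in> U \<Longrightarrow> dist (g y) (g x) < e / 4"
      using continuous_map_epsD[of Y g x "e / 4"] g x e by (auto simp: continuous_functions_def)
    have "dist (f y) (f x) < e" if "y \<in> U" for y
    proof -
      have "y \<in> topspace Y" using that U openin_subset by blast
      then have "dist (f y) (g y) \<le> e / 4" "dist (f x) (g x) \<le> e / 4"
        using g x by (auto simp: dist_norm)
      moreover have "dist (f y) (f x) \<le> dist (f y) (g y) + dist (g y) (g x) + dist (f x) (g x)"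
        using dist_triangle[of "f y" "f x" "g y"] dist_triangle[of "g y" "f x" "g x"]
        by (simp add: dist_commute)
      ultimately show ?thesis using U(3)[OF that] e by linarith
    qed
    then show "\<exists>U. openin Y U \<and> x \<in> U \<and> (\<forall>y\<in>U. dist (f y) (f x) < e)"
      using U by blast
  qed
  then show "f \<in> continuous_functions Y"
    using zero by (simp add: continuous_functions_def)
qed

lemma local_homeomorphism_open_map:
  assumes "local_homeomorphism X Y f"
  shows "open_map X Y f"
  unfolding open_map_def
proof (intro allI impI)
  fix W assume W: "openin X W"
  show "openin Y (f ` W)"
  proof (subst openin_subopen, intro ballI)
    fix y assume "y \<in> f ` W"
    then obtain x where x: "x \<in> W" "y = f x" by blast
    then have "x \<in> topspace X" using W openin_subset by blast
    then obtain U where U: "openin X U" "x \<in> U" "openin Y (f ` U)"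
      "homeomorphic_map (subtopology X U) (subtopology Y (f ` U)) f"
      using assms unfolding local_homeomorphism_def by blast
    have "openin (subtopology X U) (U \<inter> W)"
      using U W by (auto simp: openin_open_subtopology)
    then have "openin (subtopology Y (f ` U)) (f ` (U \<inter> W))"
      using homeomorphic_imp_open_map[OF U(4)] unfolding open_map_def by blast
    then have "openin Y (f ` (U \<inter> W))"
      using U(3) by (simp add: openin_open_subtopology)
    then show "\<exists>T. openin Y T \<and> y \<in> T \<and> T \<subseteq> f ` W"
      using x U(2) by (intro exI[of _ "f ` (U \<inter> W)"]) auto
  qed
qed

lemma homeomorphic_map_restrict:
  assumes h: "homeomorphic_map (subtopology X U) (subtopology Y (f ` U)) f"
    and W: "W \<subseteq> U" "U \<subseteq> topspace X" and Y: "f ` U \<subseteq> topspace Y"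
  shows "homeomorphic_map (subtopology X W) (subtopology Y (f ` W)) f"
proof -
  have "homeomorphic_map (subtopology (subtopology X U) W) (subtopology (subtopology Y (f ` U)) (f ` W)) f"
    by (rule homeomorphic_map_subtopologies[OF h]) (use W Y in auto)
  moreover have "U \<inter> W = W" "f ` U \<inter> f ` W = f ` W" using W by auto
  ultimately show ?thesis by (simp add: subtopology_subtopology)
qed

section \<open>Groupoid identities, open bisections and their action on the units\<close>

locale compact_groupoid = etale_groupoid G for G :: "'g groupoid" +
  assumes compact_units: "compact_space (unit_top G)"
    and Hausdorff_units: "Hausdorff_space (unit_top G)"
begin

lemma units_subset: "units G \<subseteq> arrows G"
  unfolding units_def using src_closed by blast

lemma topspace_unit_top [simp]: "topspace (unit_top G) = units G"
  unfolding unit_top_def using units_subset by auto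

lemma src_units: "g \<in> arrows G \<Longrightarrow> src G g \<in> units G"
  unfolding units_def by blast

lemma rng_units: "g \<in> arrows G \<Longrightarrow> rng G g \<in> units G"
  using src_units[OF rng_closed, of g] src_rng[of g] by simp

lemma rng_unit: "x \<in> units G \<Longrightarrow> rng G x = x"
  unfolding units_def using rng_src by auto

lemma inv_inv: "g \<in> arrows G \<Longrightarrow> ginv G (ginv G g) = g"
proof -
  assume g: "g \<in> arrows G"
  note i = inv_closed[OF g] inv_closed[OF inv_closed[OF g]]
  have c: "(ginv G (ginv G g), ginv G g) \<in> composable G" "(ginv G g, g) \<in> composable G"
    using g i by (auto simp: composable_def src_inv rng_inv)
  have "ginv G (ginv G g) = gmul G (ginv G (ginv G g)) (gmul G (ginv G g) g)"
    using g i by (metis inv_mul mul_src src_inv rng_inv)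
  also have "\<dots> = gmul G (gmul G (ginv G (ginv G g)) (ginv G g)) g"
    using mul_assoc[OF c] by simp
  also have "\<dots> = g"
    using g i by (simp add: inv_mul src_inv rng_mul_unit)
  finally show ?thesis .
qed

lemma inv_gmul:
  assumes "(g, h) \<in> composable G"
  shows "ginv G (gmul G g h) = gmul G (ginv G h) (ginv G g)"
proof -
  have g: "g \<in> arrows G" and h: "h \<in> arrows G" and gh: "src G g = rng G h"
    using assms by (auto simp: composable_def)
  let ?k = "gmul G g h"
  let ?l = "gmul G (ginv G h) (ginv G g)"
  have c1: "(ginv G h, ginv G g) \<in> composable G"
    using g h gh by (auto simp: composable_def src_inv rng_inv inv_closed)
  have k: "?k \<in> arrows G" "src G ?k = src G h" "rng G ?k = rng G g"
    using assms mul_closed src_mul rng_mul by auto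
  have l: "?l \<in> arrows G" "src G ?l = rng G g" "rng G ?l = src G h"
    using c1 mul_closed src_mul rng_mul g h by (auto simp: src_inv rng_inv)
  have "gmul G ?l ?k = gmul G (ginv G h) (gmul G (ginv G g) ?k)"
    using c1 k g by (intro mul_assoc) (auto simp: composable_def src_inv inv_closed)
  also have "gmul G (ginv G g) ?k = gmul G (gmul G (ginv G g) g) h"
    using assms g by (intro mul_assoc[symmetric]) (auto simp: composable_def src_inv inv_closed)
  also have "\<dots> = h"
    using g h gh by (simp add: inv_mul rng_mul_unit)
  finally have lk: "gmul G ?l ?k = src G h"
    using h by (simp add: inv_mul)
  have "ginv G ?k = gmul G (gmul G ?l ?k) (ginv G ?k)"
    using k lk rng_mul_unit[OF inv_closed[OF k(1)]] by (simp add: rng_inv)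
  also have "\<dots> = gmul G ?l (gmul G ?k (ginv G ?k))"
    using k l by (intro mul_assoc) (auto simp: composable_def rng_inv inv_closed)
  also have "\<dots> = ?l"
    using k l mul_src[OF l(1)] by (simp add: mul_inv)
  finally show ?thesis .
qed

lemma open_map_src: "open_map (gtop G) (unit_top G) (src G)"
  using src_local_homeo by (rule local_homeomorphism_open_map)

lemma open_map_rng: "open_map (gtop G) (unit_top G) (rng G)"
  using rng_local_homeo by (rule local_homeomorphism_open_map)

lemma subtopology_unit_top: "S \<subseteq> units G \<Longrightarrow> subtopology (unit_top G) S = subtopology (gtop G) S"
  unfolding unit_top_def by (simp add: subtopology_subtopology Int_absorb1)

lemma bisection_open: "\<gamma> \<in> open_bisections G \<Longrightarrow> openin (gtop G) \<gamma>"
  unfolding open_bisections_def by blast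

lemma bisection_arrows: "\<gamma> \<in> open_bisections G \<Longrightarrow> h \<in> \<gamma> \<Longrightarrow> h \<in> arrows G"
  using bisection_open openin_subset by blast

lemma bisection_im_open: "\<gamma> \<in> open_bisections G \<Longrightarrow> openin (unit_top G) (rng G ` \<gamma>)"
  using bisection_open open_map_rng unfolding open_map_def by blast

lemma bisection_supp_open: "\<gamma> \<in> open_bisections G \<Longrightarrow> openin (unit_top G) (src G ` \<gamma>)"
  using bisection_open open_map_src unfolding open_map_def by blast

lemma bisection_rng_homeo:
  assumes "\<gamma> \<in> open_bisections G"
  shows "homeomorphic_map (subtopology (gtop G) \<gamma>) (subtopology (unit_top G) (rng G ` \<gamma>)) (rng G)"
  using assms subtopology_unit_top[of "rng G ` \<gamma>"] openin_subset[OF bisection_im_open[OF assms]]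
  unfolding open_bisections_def by simp

lemma bisection_src_homeo:
  assumes "\<gamma> \<in> open_bisections G"
  shows "homeomorphic_map (subtopology (gtop G) \<gamma>) (subtopology (unit_top G) (src G ` \<gamma>)) (src G)"
  using assms subtopology_unit_top[of "src G ` \<gamma>"] openin_subset[OF bisection_supp_open[OF assms]]
  unfolding open_bisections_def by simp

lemma bisection_inj_rng: "\<gamma> \<in> open_bisections G \<Longrightarrow> inj_on (rng G) \<gamma>"
  using bisection_rng_homeo[of \<gamma>] openin_subset[OF bisection_open, of \<gamma>]
  by (simp add: homeomorphic_eq_everything_map Int_absorb1)

lemma bisection_inj_src: "\<gamma> \<in> open_bisections G \<Longrightarrow> inj_on (src G) \<gamma>"
  using bisection_src_homeo[of \<gamma>] openin_subset[OF bisection_open, of \<gamma>]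
  by (simp add: homeomorphic_eq_everything_map Int_absorb1)

lemma continuous_the_inv_into:
  assumes h: "homeomorphic_map (subtopology X U) (subtopology Y (f ` U)) f" and "U \<subseteq> topspace X"
    and "f ` U \<subseteq> topspace Y"
  shows "continuous_map (subtopology Y (f ` U)) (subtopology X U) (the_inv_into U f)"
proof -
  obtain g where g: "homeomorphic_maps (subtopology X U) (subtopology Y (f ` U)) f g"
    using h homeomorphic_map_maps by blast
  have "inj_on f U"
    using h assms(2) by (simp add: homeomorphic_eq_everything_map Int_absorb1)
  then have "g y = the_inv_into U f y" if "y \<in> f ` U" for y
    using g that assms(2) by (auto simp: homeomorphic_maps_def the_inv_into_f_f)
  then show ?thesis
    using g assms(3) unfolding homeomorphic_maps_def by (auto elim!: continuous_map_eq)
qed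

lemma continuous_inv_rng:
  assumes "\<gamma> \<in> open_bisections G"
  shows "continuous_map (subtopology (unit_top G) (rng G ` \<gamma>)) (gtop G) (the_inv_into \<gamma> (rng G))"
  using continuous_the_inv_into[OF bisection_rng_homeo[OF assms]] openin_subset[OF bisection_open[OF assms]]
    openin_subset[OF bisection_im_open[OF assms]] by (auto intro: continuous_map_into_fulltopology)

lemma continuous_inv_src:
  assumes "\<gamma> \<in> open_bisections G"
  shows "continuous_map (subtopology (unit_top G) (src G ` \<gamma>)) (gtop G) (the_inv_into \<gamma> (src G))"
  using continuous_the_inv_into[OF bisection_src_homeo[OF assms]] openin_subset[OF bisection_open[OF assms]]
    openin_subset[OF bisection_supp_open[OF assms]] by (auto intro: continuous_map_into_fulltopology)

lemma continuous_src: "continuous_map (gtop G) (unit_top G) (src G)"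
  using src_local_homeo by (simp add: local_homeomorphism_def)

lemma continuous_rng: "continuous_map (gtop G) (unit_top G) (rng G)"
  using rng_local_homeo by (simp add: local_homeomorphism_def)

lemma bisection_ex:
  assumes "g \<in> arrows G"
  obtains \<gamma> where "\<gamma> \<in> open_bisections G" "g \<in> \<gamma>"
proof -
  obtain U where U: "openin (gtop G) U" "g \<in> U" "openin (unit_top G) (src G ` U)"
    "homeomorphic_map (subtopology (gtop G) U) (subtopology (unit_top G) (src G ` U)) (src G)"
    using src_local_homeo assms unfolding local_homeomorphism_def by blast
  obtain W where W: "openin (gtop G) W" "g \<in> W" "openin (unit_top G) (rng G ` W)"
    "homeomorphic_map (subtopology (gtop G) W) (subtopology (unit_top G) (rng G ` W)) (rng G)"
    using rng_local_homeo assms unfolding local_homeomorphism_def by blast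
  have s: "homeomorphic_map (subtopology (gtop G) (U \<inter> W)) (subtopology (unit_top G) (src G ` (U \<inter> W))) (src G)"
    using openin_subset[OF U(1)] openin_subset[OF U(3)] by (intro homeomorphic_map_restrict[OF U(4)]) auto
  have r: "homeomorphic_map (subtopology (gtop G) (U \<inter> W)) (subtopology (unit_top G) (rng G ` (U \<inter> W))) (rng G)"
    using openin_subset[OF W(1)] openin_subset[OF W(3)] by (intro homeomorphic_map_restrict[OF W(4)]) auto
  have "src G ` (U \<inter> W) \<subseteq> units G" "rng G ` (U \<inter> W) \<subseteq> units G"
    using openin_subset[OF U(3)] openin_subset[OF W(3)] by auto
  then have "U \<inter> W \<in> open_bisections G"
    using s r U(1) W(1) unfolding open_bisections_def by (simp add: subtopology_unit_top openin_Int)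
  then show thesis using that U(2) W(2) by blast
qed

lemma ginv_image_open: "openin (gtop G) U \<Longrightarrow> openin (gtop G) (ginv G ` U)"
proof -
  assume U: "openin (gtop G) U"
  have "ginv G ` U = {g \<in> arrows G. ginv G g \<in> U}"
    using openin_subset[OF U] inv_inv inv_closed by (force simp: image_iff)
  then show ?thesis
    using openin_continuous_map_preimage[OF continuous_inv U] by simp
qed

lemma src_star: "\<gamma> \<subseteq> arrows G \<Longrightarrow> src G ` bis_star G \<gamma> = rng G ` \<gamma>"
  unfolding bis_star_def image_image by (intro image_cong refl src_inv) auto

lemma rng_star: "\<gamma> \<subseteq> arrows G \<Longrightarrow> rng G ` bis_star G \<gamma> = src G ` \<gamma>"
  unfolding bis_star_def image_image by (intro image_cong refl rng_inv) auto

lemma bisection_star: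
  assumes g: "\<gamma> \<in> open_bisections G"
  shows "bis_star G \<gamma> \<in> open_bisections G"
proof -
  let ?s = "bis_star G \<gamma>"
  have sub: "\<gamma> \<subseteq> arrows G" using bisection_arrows[OF g] by blast
  have ssub: "?s \<subseteq> arrows G" unfolding bis_star_def using sub inv_closed by blast
  have inv: "homeomorphic_map (subtopology (gtop G) ?s) (subtopology (gtop G) \<gamma>) (ginv G)"
    unfolding homeomorphic_map_maps
  proof (intro exI)
    show "homeomorphic_maps (subtopology (gtop G) ?s) (subtopology (gtop G) \<gamma>) (ginv G) (ginv G)"
      unfolding homeomorphic_maps_def using sub ssub inv_inv
      by (auto simp: continuous_map_in_subtopology bis_star_def
          intro: continuous_map_from_subtopology[OF continuous_inv])
  qed
  have eq: "homeomorphic_map (subtopology (gtop G) ?s) (subtopology (gtop G) (f ` \<gamma>)) f'"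
    if "homeomorphic_map (subtopology (gtop G) \<gamma>) (subtopology (gtop G) (f ` \<gamma>)) f"
      "\<And>g. g \<in> \<gamma> \<Longrightarrow> f' (ginv G g) = f g" for f f'
  proof (rule homeomorphic_map_eq)
    show "homeomorphic_map (subtopology (gtop G) ?s) (subtopology (gtop G) (f ` \<gamma>)) (f \<circ> ginv G)"
      using inv that(1) by (rule homeomorphic_map_compose)
    show "(f \<circ> ginv G) x = f' x" if "x \<in> topspace (subtopology (gtop G) ?s)" for x
      using that \<open>\<And>g. g \<in> \<gamma> \<Longrightarrow> f' (ginv G g) = f g\<close> sub inv_inv
      by (auto simp: bis_star_def)
  qed
  have "homeomorphic_map (subtopology (gtop G) ?s) (subtopology (gtop G) (rng G ` \<gamma>)) (src G)"
    using g src_inv sub by (intro eq) (auto simp: open_bisections_def)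
  moreover have "homeomorphic_map (subtopology (gtop G) ?s) (subtopology (gtop G) (src G ` \<gamma>)) (rng G)"
    using g rng_inv sub by (intro eq) (auto simp: open_bisections_def)
  moreover have "openin (gtop G) ?s"
    unfolding bis_star_def using bisection_open[OF g] by (rule ginv_image_open)
  ultimately show ?thesis
    unfolding open_bisections_def by (simp add: src_star[OF sub] rng_star[OF sub])
qed

definition arr :: "'g set \<Rightarrow> 'g \<Rightarrow> 'g" where
  "arr \<gamma> x = the_inv_into \<gamma> (rng G) x"

lemma arr_rng: "\<gamma> \<in> open_bisections G \<Longrightarrow> h \<in> \<gamma> \<Longrightarrow> arr \<gamma> (rng G h) = h"
  unfolding arr_def by (rule the_inv_into_f_f[OF bisection_inj_rng])

lemma bis_map_star:
  assumes "\<gamma> \<in> open_bisections G" "h \<in> \<gamma>"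
  shows "bis_map G (bis_star G \<gamma>) (rng G h) = src G h"
proof -
  have h: "h \<in> arrows G" using assms by (rule bisection_arrows)
  have "the_inv_into (bis_star G \<gamma>) (src G) (src G (ginv G h)) = ginv G h"
    using assms by (intro the_inv_into_f_f[OF bisection_inj_src[OF bisection_star]]) (auto simp: bis_star_def)
  then show ?thesis
    unfolding bis_map_def using h by (simp add: src_inv rng_inv)
qed

text \<open>The translate of k by the bisection, extended by 0. It will dominate the translates of
  functions that k dominates.\<close>

definition unit_bact :: "'g set \<Rightarrow> ('g \<Rightarrow> complex) \<Rightarrow> 'g \<Rightarrow> complex" where
  "unit_bact \<gamma> k x = (if x \<in> rng G ` \<gamma> then k (src G (arr \<gamma> x)) else 0)"

lemma unit_bact_rng: "\<gamma> \<in> open_bisections G \<Longrightarrow> h \<in> \<gamma> \<Longrightarrow> unit_bact \<gamma> k (rng G h) = k (src G h)"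
  unfolding unit_bact_def by (auto simp: arr_rng)

sublocale X: fun_alg "units G" "continuous_functions (unit_top G)"
  using fun_alg_continuous_functions[OF compact_units] by simp

lemma C0_continuous: "k \<in> C0_fun G U \<Longrightarrow> k \<in> continuous_functions (unit_top G)"
  unfolding C0_fun_def by blast

lemma C0_continuous_map: "k \<in> C0_fun G U \<Longrightarrow> continuous_map (unit_top G) euclidean k"
  unfolding C0_fun_def continuous_functions_def by blast

text \<open>The issue is continuity off the image of \<gamma>. The set where |k| \<ge> e is compact
  inside the support, so its image under the bisection is compact, hence closed in the Hausdorff
  unit space, and the translate is below e off that closed set.\<close>

lemma unit_bact_C0:
  assumes g: "\<gamma> \<in> open_bisections G" and k: "k \<in> C0_fun G (src G ` \<gamma>)"
  shows "unit_bact \<gamma> k \<in> C0_fun G (rng G ` \<gamma>)"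
proof -
  let ?X = "unit_top G"
  have kc: "continuous_map ?X euclidean k" using k by (rule C0_continuous_map)
  have cont: "continuous_map (subtopology ?X (rng G ` \<gamma>)) euclidean (\<lambda>x. k (src G (arr \<gamma> x)))"
    using continuous_map_compose[OF continuous_map_compose[OF continuous_inv_rng[OF g] continuous_src] kc]
    by (simp add: o_def arr_def)
  have "continuous_map ?X euclidean (\<lambda>x. if x \<in> rng G ` \<gamma> then k (src G (arr \<gamma> x)) else 0)"
  proof (rule continuous_map_extend_by_zero[OF bisection_im_open[OF g] cont])
    fix x and e :: real assume x: "x \<in> topspace ?X" "x \<notin> rng G ` \<gamma>" and e: "e > 0"
    define C where "C = {x \<in> units G. e \<le> cmod (k x)}"
    have "closedin ?X C"
    proof -
      have "closedin euclidean {z::complex. e \<le> cmod z}"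
        by (simp add: closed_Collect_le continuous_on_norm)
      from closedin_continuous_map_preimage[OF kc this] show ?thesis by (simp add: C_def)
    qed
    then have "compactin ?X C" using compact_units by (rule closedin_compact_space[rotated])
    moreover have Cs: "C \<subseteq> src G ` \<gamma>"
      using k e unfolding C_def C0_fun_def by force
    ultimately have "compactin (subtopology ?X (src G ` \<gamma>)) C" by (simp add: compactin_subtopology)
    then have "compactin ?X (rng G ` the_inv_into \<gamma> (src G) ` C)"
      using image_compactin[OF _ continuous_map_compose[OF continuous_inv_src[OF g] continuous_rng]]
      by (simp add: image_comp)
    then have D: "closedin ?X (rng G ` the_inv_into \<gamma> (src G) ` C)" (is "closedin _ ?D")
      using Hausdorff_units compactin_imp_closedin by blast
    have "?D \<subseteq> rng G ` \<gamma>"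
      using Cs bisection_inj_src[OF g] by (auto simp: the_inv_into_f_f)
    then have "x \<in> units G - ?D" using x by auto
    moreover have "cmod (k (src G (arr \<gamma> y))) < e" if y: "y \<in> (units G - ?D) \<inter> rng G ` \<gamma>" for y
    proof (rule ccontr)
      obtain h where h: "h \<in> \<gamma>" "y = rng G h" using y by blast
      assume "\<not> cmod (k (src G (arr \<gamma> y))) < e"
      then have "src G h \<in> C"
        using h arr_rng[OF g] src_units[OF bisection_arrows[OF g h(1)]] by (simp add: C_def)
      then have "y \<in> ?D"
        using h the_inv_into_f_f[OF bisection_inj_src[OF g] h(1)] by force
      then show False using y by blast
    qed
    ultimately show "\<exists>W. openin ?X W \<and> x \<in> W \<and> (\<forall>y\<in>W \<inter> rng G ` \<gamma>. cmod (k (src G (arr \<gamma> y))) < e)"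
      using D by (intro exI[of _ "units G - ?D"]) (auto simp: closedin_def)
  qed
  moreover have "rng G ` \<gamma> \<subseteq> units G" using openin_subset[OF bisection_im_open[OF g]] by simp
  ultimately show ?thesis
    unfolding C0_fun_def continuous_functions_def unit_bact_def[abs_def] by auto
qed

lemma Urysohn_C0:
  assumes U: "openin (unit_top G) U" and C: "closedin (unit_top G) C" "C \<subseteq> U"
  obtains v where "continuous_map (unit_top G) euclideanreal v" "\<And>x. 0 \<le> v x" "\<And>x. v x \<le> 1"
    "\<And>x. x \<in> C \<Longrightarrow> v x = 1" "\<And>x. x \<notin> U \<Longrightarrow> v x = 0"
    "(\<lambda>x. complex_of_real (v x)) \<in> C0_fun G U"
proof -
  have n: "normal_space (unit_top G)"
    using compact_units Hausdorff_units by (rule compact_Hausdorff_or_regular_imp_normal_space[OF _ disjI1])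
  have d: "closedin (unit_top G) (units G - U)" "disjnt (units G - U) C"
    using U C(2) by (auto simp: disjnt_def openin_closedin_eq)
  obtain f where f: "continuous_map (unit_top G) (top_of_set {0..1::real}) f"
    "f ` (units G - U) \<subseteq> {0}" "f ` C \<subseteq> {1}"
    using Urysohn_lemma[OF n d(1) C(1) d(2), of 0 1] by auto
  define v where "v x = (if x \<in> units G then f x else 0)" for x
  have v: "continuous_map (unit_top G) euclideanreal v"
    using continuous_map_into_fulltopology[OF f(1)] by (rule continuous_map_eq) (simp add: v_def)
  have r: "f x \<in> {0..1}" if "x \<in> units G" for x
    using continuous_map_image_subset_topspace[OF f(1)] that by auto
  have Cu: "C \<subseteq> units G" using closedin_subset[OF C(1)] by simp
  have z: "v x = 0" if "x \<notin> U" for x using that f(2) by (auto simp: v_def)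
  have "(\<lambda>x. if x \<in> topspace (unit_top G) then complex_of_real (v x) else 0) \<in> continuous_functions (unit_top G)"
    using v by (rule continuous_functions_of_real)
  also have "(\<lambda>x. if x \<in> topspace (unit_top G) then complex_of_real (v x) else 0) = (\<lambda>x. complex_of_real (v x))"
    by (auto simp: v_def)
  finally have "(\<lambda>x. complex_of_real (v x)) \<in> C0_fun G U"
    using z by (simp add: C0_fun_def)
  moreover have "0 \<le> v x" "v x \<le> 1" for x using r[of x] by (auto simp: v_def)
  moreover have "v x = 1" if "x \<in> C" for x using that f(3) Cu by (auto simp: v_def)
  ultimately show thesis
    using that[of v] v z by blast
qed

end


section \<open>Function algebras on G-spaces\<close>

text \<open>A description of \<open>corner\<close> by estimates, see \<open>corner_eq\<close>.
  Unlike a closure of products it passes directly through translates, pullbacks and ucp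
  maps.\<close>

definition dominated :: "'g groupoid \<Rightarrow> ('g, 'y) gspace \<Rightarrow> 'g set \<Rightarrow> ('y \<Rightarrow> complex) \<Rightarrow> bool" where
  "dominated G Y U f \<longleftrightarrow> (\<forall>e>0. \<exists>k\<in>C0_fun G U. \<forall>t\<in>topspace (sptop Y).
     cmod (f t) \<le> e + cmod (k (proj Y t)))"

text \<open>The action is asked to be algebraic, and V to be stable under inclusion of the units and
  under translation. This covers continuous functions on compact spaces as well as bounded functions
  on the arrows.\<close>

locale gset = compact_groupoid G + fun_galg G Y V
  for G :: "'g groupoid" and Y :: "('g, 'y) gspace" and V +
  assumes proj_surj: "proj Y ` topspace (sptop Y) = units G"
    and actn_closed: "(g, y) \<in> act_dom G Y \<Longrightarrow> act Y g y \<in> topspace (sptop Y)"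
    and proj_actn: "(g, y) \<in> act_dom G Y \<Longrightarrow> proj Y (act Y g y) = rng G g"
    and actn_unit: "y \<in> topspace (sptop Y) \<Longrightarrow> act Y (proj Y y) y = y"
    and actn_mul: "\<lbrakk>(g, h) \<in> composable G; (h, y) \<in> act_dom G Y\<rbrakk>
      \<Longrightarrow> act Y (gmul G g h) y = act Y g (act Y h y)"
    and incl_in: "k \<in> continuous_functions (unit_top G) \<Longrightarrow>
      (\<lambda>y. if y \<in> topspace (sptop Y) then k (proj Y y) else 0) \<in> V"
    and bact_in: "\<lbrakk>\<gamma> \<in> open_bisections G; f \<in> V; dominated G Y (src G ` \<gamma>) f\<rbrakk> \<Longrightarrow>
      bact (galg G Y V) \<gamma> f \<in> V"
begin

lemma proj_units: "t \<in> T \<Longrightarrow> proj Y t \<in> units G"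
  using proj_surj by blast

lemma act_inv:
  assumes "t \<in> T" "h \<in> arrows G" "proj Y t = rng G h"
  shows "(ginv G h, t) \<in> act_dom G Y" "act Y (ginv G h) t \<in> T" "proj Y (act Y (ginv G h) t) = src G h"
    "act Y h (act Y (ginv G h) t) = t"
proof -
  show d: "(ginv G h, t) \<in> act_dom G Y"
    using assms by (simp add: act_dom_def inv_closed src_inv)
  show "act Y (ginv G h) t \<in> T" "proj Y (act Y (ginv G h) t) = src G h"
    using actn_closed[OF d] proj_actn[OF d] assms by (simp_all add: rng_inv)
  have "(h, ginv G h) \<in> composable G"
    using assms by (simp add: composable_def inv_closed rng_inv)
  from actn_mul[OF this d] show "act Y h (act Y (ginv G h) t) = t"
    using assms actn_unit[of t] by (simp add: mul_inv)
qed

lemma bact_at: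
  "\<lbrakk>\<gamma> \<in> open_bisections G; h \<in> \<gamma>; t \<in> T; proj Y t = rng G h\<rbrakk> \<Longrightarrow> bact A \<gamma> f t = f (act Y (ginv G h) t)"
  by (auto simp flip: arr_def simp: arr_rng)

text \<open>The translate of a dominating function on the units dominates the translate, fibre by
  fibre.\<close>

lemma dominated_bact:
  assumes g: "\<gamma> \<in> open_bisections G" and f: "dominated G Y (src G ` \<gamma>) f"
  shows "dominated G Y (rng G ` \<gamma>) (bact A \<gamma> f)"
  unfolding dominated_def
proof (intro allI impI)
  fix e :: real assume "e > 0"
  then obtain k where k: "k \<in> C0_fun G (src G ` \<gamma>)" "\<forall>t\<in>T. cmod (f t) \<le> e + cmod (k (proj Y t))"
    using f unfolding dominated_def by blast
  have "cmod (bact A \<gamma> f t) \<le> e + cmod (unit_bact \<gamma> k (proj Y t))" if t: "t \<in> T" for t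
  proof (cases "proj Y t \<in> rng G ` \<gamma>")
    case True
    then obtain h where h: "h \<in> \<gamma>" "proj Y t = rng G h" by blast
    note a = act_inv[OF t bisection_arrows[OF g h(1)] h(2)]
    have "bact A \<gamma> f t = f (act Y (ginv G h) t)"
      using bact_at[OF g h(1) t h(2)] .
    then show ?thesis
      using bspec[OF k(2) a(2)] a(3) unit_bact_rng[OF g h(1), of k] h(2) by simp
  next
    case False
    then show ?thesis using \<open>e > 0\<close> by simp
  qed
  then show "\<exists>k\<in>C0_fun G (rng G ` \<gamma>). \<forall>t\<in>T. cmod (bact A \<gamma> f t) \<le> e + cmod (k (proj Y t))"
    using unit_bact_C0[OF g k(1)] by blast
qed

text \<open>Cohen factorisation: with \<open>u = \<Sum>n. 2\<^sup>-\<^sup>n min 1 (8\<^sup>n \<bar>k n\<bar>)\<close>, where \<open>k n\<close> dominates \<open>f\<close> up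
  to \<open>8\<^sup>-\<^sup>n\<close>, the function \<open>f\<close> is bounded by a multiple of \<open>u\<^sup>3\<close>, so \<open>f / u\<^sup>2\<close> is a uniform limit of
  the functions \<open>f / (max u d)\<^sup>2\<close>.\<close>

lemma dominated_factor:
  assumes f: "f \<in> V" and dom: "dominated G Y U f"
  obtains u b where "u \<in> C0_fun G U" "b \<in> V" "f = (\<lambda>t. incl A u t * b t * incl A u t)"
proof -
  have "\<exists>k. k \<in> C0_fun G U \<and> (\<forall>t\<in>T. cmod (f t) \<le> (1/8)^n + cmod (k (proj Y t)))" for n :: nat
  proof -
    have "(0::real) < (1/8)^n" by simp
    then show ?thesis using dom unfolding dominated_def by blast
  qed
  then obtain k where k: "\<And>n. k n \<in> C0_fun G U"
    and dk: "\<And>n t. t \<in> T \<Longrightarrow> cmod (f t) \<le> (1/8)^n + cmod (k n (proj Y t))"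
    by metis
  define a where "a n x = (1/2)^n * min 1 (cmod (k n x) * 8^n)" for n x
  have a: "0 \<le> a n x" "a n x \<le> (1/2)^n" for n x
    by (auto simp: a_def mult_left_le)
  have sm: "summable (\<lambda>n. (1/2::real)^n)" by (rule summable_geometric) simp
  have sa: "summable (\<lambda>n. a n x)" for x
    using a by (intro summable_comparison_test'[OF sm, of 0]) simp
  define ur where "ur x = (\<Sum>n. a n x)" for x
  have a_le_ur: "a n x \<le> ur x" for n x
    using sum_le_suminf[OF sa, of "{n}" x] a by (simp add: ur_def)
  have ur0: "0 \<le> ur x" for x
    using a_le_ur[of 0 x] a(1)[of 0 x] by linarith
  have ur_off: "ur x = 0" if "x \<notin> U \<or> x \<notin> units G" for x
  proof -
    have "k n x = 0" for n
      using that k[of n] X.vanish[of "k n" x] by (auto simp: C0_fun_def)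
    then show ?thesis by (simp add: ur_def a_def)
  qed
  have k_cont: "continuous_map (unit_top G) euclideanreal (\<lambda>x. cmod (k n x))" for n
    using C0_continuous_map[OF k] by (rule continuous_map_norm)
  have u_in: "(\<lambda>x. complex_of_real (ur x)) \<in> continuous_functions (unit_top G)"
  proof (rule X.uniform_limit_in)
    show "complex_of_real (ur x) = 0" if "x \<notin> units G" for x
      using ur_off that by simp
    fix e :: real assume "e > 0"
    then obtain N where N: "(1/2::real)^N < e / 2"
      using real_arch_pow_inv[of "e / 2" "1/2"] by auto
    have "continuous_map (unit_top G) euclideanreal (\<lambda>x. \<Sum>n<N. a n x)"
      unfolding a_def by (intro continuous_intros k_cont) (auto intro!: k_cont continuous_intros)
    then have "(\<lambda>x. if x \<in> topspace (unit_top G) then complex_of_real (\<Sum>n<N. a n x) else 0)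
        \<in> continuous_functions (unit_top G)"
      by (rule continuous_functions_of_real)
    moreover have "cmod (complex_of_real (ur x) - complex_of_real (\<Sum>n<N. a n x)) \<le> e" for x
    proof -
      have s2: "summable (\<lambda>n. (1/2::real)^(n + N))" "summable (\<lambda>n. a (n + N) x)"
        by (rule summable_ignore_initial_segment[OF sm], rule summable_ignore_initial_segment[OF sa])
      have "ur x - (\<Sum>n<N. a n x) = (\<Sum>n. a (n + N) x)"
        unfolding ur_def using suminf_minus_initial_segment[OF sa] by simp
      moreover have "0 \<le> (\<Sum>n. a (n + N) x)"
        using s2(2) a by (intro suminf_nonneg)
      moreover have "(\<Sum>n. a (n + N) x) \<le> (\<Sum>n. (1/2::real)^(n + N))"
        using s2 a by (intro suminf_le)
      moreover have "(\<Sum>n. (1/2::real)^(n + N)) = 2 * (1/2)^N"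
        using suminf_mult2[OF sm, of "(1/2)^N"] suminf_geometric[of "1/2::real"]
        by (simp add: power_add)
      ultimately have "\<bar>ur x - (\<Sum>n<N. a n x)\<bar> \<le> e" using N by linarith
      then show ?thesis by (metis norm_of_real of_real_diff)
    qed
    ultimately show "\<exists>g\<in>continuous_functions (unit_top G). \<forall>x\<in>units G. cmod (complex_of_real (ur x) - g x) \<le> e"
      by (intro bexI[rotated]) auto
  qed
  then have uC0: "(\<lambda>x. complex_of_real (ur x)) \<in> C0_fun G U"
    using ur_off by (simp add: C0_fun_def)
  \<comment> \<open>If \<open>ur\<close> is below 2^-n, the minimum in \<open>a n\<close> is not 1,
    which forces |k n| below 8^-n.\<close>
  have small: "cmod (f t) \<le> 2 * (1/8)^n" if "t \<in> T" "ur (proj Y t) < (1/2)^n" for t n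
  proof -
    have "a n (proj Y t) < (1/2)^n" using a_le_ur[of n "proj Y t"] that by linarith
    then have "cmod (k n (proj Y t)) * 8^n < 1" by (auto simp: a_def)
    then have "cmod (k n (proj Y t)) < (1/8)^n" by (simp add: power_one_over field_simps)
    then show ?thesis using dk[OF that(1), of n] by linarith
  qed
  obtain B where B: "0 < B" "\<And>t. cmod (f t) \<le> B" using bound_ex[OF f] by blast
  \<comment> \<open>16 arises from 2 * 8^-l = 16 * (2^-(l + 1))^3, where the factor 2 is that of
    \<open>small\<close>. B takes care of the points where \<open>ur\<close> is at least 1.\<close>
  define K where "K = 16 + B"
  have K: "0 < K" using B by (simp add: K_def)
  have bnd: "cmod (f t) \<le> K * ur (proj Y t) ^ 3" if t: "t \<in> T" for t
  proof -
    let ?u = "ur (proj Y t)"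
    consider "?u = 0" | "1 \<le> ?u" | "0 < ?u" "?u < 1" using ur0[of "proj Y t"] by linarith
    then show ?thesis
    proof cases
      case 1
      have "cmod (f t) \<le> e" if e: "e > 0" for e
      proof -
        obtain n where "(1/8::real)^n < e / 2" using real_arch_pow_inv[of "e / 2" "1/8"] e by auto
        then show ?thesis using small[OF t, of n] 1 by simp
      qed
      then have "cmod (f t) \<le> 0" by (meson dense_ge)
      then show ?thesis using 1 by simp
    next
      case 2
      then have "1 \<le> ?u ^ 3" by (rule one_le_power)
      then have "K * 1 \<le> K * ?u ^ 3" using K by (intro mult_left_mono) auto
      then show ?thesis using B(2)[of t] by (simp add: K_def)
    next
      case 3
      \<comment> \<open>The dyadic level of the weight: 2^-m \<le> \<open>?u\<close> < 2^-(m -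
        1).\<close>
      define m where "m = (LEAST m. (1/2::real)^m \<le> ?u)"
      have "\<exists>m. (1/2::real)^m \<le> ?u" using real_arch_pow_inv[of ?u "1/2"] 3 by (auto intro: less_imp_le)
      then have m: "(1/2)^m \<le> ?u" unfolding m_def by (rule LeastI_ex)
      then have "m \<noteq> 0" using 3 by (cases m) auto
      then obtain l where l: "m = Suc l" by (cases m) auto
      then have "\<not> (1/2)^l \<le> ?u" using not_less_Least[of l "\<lambda>m. (1/2::real)^m \<le> ?u"] by (simp add: m_def)
      then have "cmod (f t) \<le> 2 * (1/8)^l" using small[OF t, of l] by simp
      also have "\<dots> = 16 * ((1/2)^m) ^ 3"
      proof -
        have "((1/2::real)^l) ^ 3 = ((1/2) ^ 3) ^ l" by (simp only: power_mult[symmetric] mult.commute)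
        then show ?thesis by (simp add: l power3_eq_cube)
      qed
      also have "\<dots> \<le> 16 * ?u ^ 3" using m by (intro mult_left_mono power_mono) auto
      also have "\<dots> \<le> K * ?u ^ 3" using B ur0[of "proj Y t"] by (intro mult_right_mono) (auto simp: K_def)
      finally show ?thesis .
    qed
  qed
  define b where "b t = (if ur (proj Y t) = 0 then 0 else f t / complex_of_real (ur (proj Y t)) ^ 2)" for t
  have "b \<in> V"
  proof (rule uniform_limit_in)
    show "b t = 0" if "t \<notin> T" for t using vanish[OF f that] by (simp add: b_def)
    fix e :: real assume e: "e > 0"
    \<comment> \<open>Where \<open>ur\<close> is below d, both b and its approximation are at most K
      d in modulus, so they differ by at most 2 K d = e; elsewhere they agree.\<close>
    define d where "d = e / (2 * K)"
    have d: "0 < d" "2 * (K * d) = e" using e K by (auto simp: d_def)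
    define w where "w x = 1 / (max (ur x) d)^2" for x
    have "continuous_map (unit_top G) euclideanreal (\<lambda>x. Re (complex_of_real (ur x)))"
      using u_in by (intro continuous_map_compose_continuous_on[of _ _ Re])
        (auto simp: continuous_functions_def intro!: continuous_intros)
    then have "continuous_map (unit_top G) euclideanreal w"
      unfolding w_def[abs_def] power2_eq_square using d
      by (intro continuous_map_real_divide continuous_map_real_mult continuous_map_real_max)
        (auto intro!: continuous_intros simp: max_def)
    then have "(\<lambda>x. if x \<in> topspace (unit_top G) then complex_of_real (w x) else 0) \<in> continuous_functions (unit_top G)"
      by (rule continuous_functions_of_real)
    from mult_in[OF f incl_in[OF this]]
    have g: "(\<lambda>t. f t * (if t \<in> T then if proj Y t \<in> units G then complex_of_real (w (proj Y t)) else 0 else 0)) \<in> V"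
      (is "?g \<in> V") unfolding topspace_unit_top .
    have "cmod (b t - ?g t) \<le> e" if t: "t \<in> T" for t
    proof -
      let ?u = "ur (proj Y t)"
      have gt: "?g t = f t * complex_of_real (w (proj Y t))" using t proj_units by simp
      show ?thesis
      proof (cases "d \<le> ?u")
        case True
        then show ?thesis using d e unfolding gt by (simp add: b_def w_def max_def)
      next
        case False
        have "cmod (b t) \<le> K * ?u"
        proof (cases "?u = 0")
          case nz: False
          then have "cmod (b t) = cmod (f t) / ?u ^ 2" by (simp add: b_def norm_divide norm_power)
          also have "\<dots> \<le> K * ?u ^ 3 / ?u ^ 2" using bnd[OF t] by (intro divide_right_mono) auto
          also have "\<dots> = K * ?u" using nz by (simp add: power3_eq_cube power2_eq_square)
          finally show ?thesis .
        qed (simp add: b_def)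
        also have "\<dots> \<le> K * d" using K False by (intro mult_left_mono) auto
        finally have 1: "cmod (b t) \<le> K * d" .
        have "cmod (?g t) = cmod (f t) / d ^ 2"
          using False d unfolding gt by (simp add: w_def max_def norm_mult norm_divide norm_power)
        also have "\<dots> \<le> K * ?u ^ 3 / d ^ 2" using bnd[OF t] by (intro divide_right_mono) auto
        also have "\<dots> \<le> K * d ^ 3 / d ^ 2"
          using False K ur0[of "proj Y t"] by (intro divide_right_mono mult_left_mono power_mono) auto
        also have "\<dots> = K * d" using d by (simp add: power3_eq_cube power2_eq_square)
        finally have "cmod (?g t) \<le> K * d" .
        then show ?thesis using 1 d(2) norm_triangle_ineq4[of "b t" "?g t"] by linarith
      qed
    qed
    then show "\<exists>g\<in>V. \<forall>t\<in>T. cmod (b t - g t) \<le> e" by (intro bexI[OF _ g] ballI)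
  qed
  moreover have "f t = incl A (\<lambda>x. complex_of_real (ur x)) t * b t * incl A (\<lambda>x. complex_of_real (ur x)) t" for t
  proof (cases "t \<in> T")
    case True
    show ?thesis
    proof (cases "ur (proj Y t) = 0")
      case z: True
      then have "cmod (f t) \<le> 0" using bnd[OF True] by simp
      then show ?thesis using z by simp
    next
      case False
      then show ?thesis using True by (simp add: b_def power2_eq_square)
    qed
  next
    case False
    then show ?thesis using vanish[OF f] by simp
  qed
  ultimately show thesis using that[OF uC0] by blast
qed

lemma incl_in': "k \<in> continuous_functions (unit_top G) \<Longrightarrow> incl A k \<in> V"
  using incl_in by simp

text \<open>A product of \<open>incl A k\<close>, a and \<open>incl A h\<close> is bounded by a
  multiple of |k|, and this survives a limit up to e. Conversely \<open>dominated_factor\<close>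
  exhibits f itself as such a product, so the products already form a closed set.\<close>

lemma corner_eq: "corner G A U = {f \<in> V. dominated G Y U f}"
proof (intro equalityI subsetI)
  let ?S = "{incl A f \<otimes>\<^bsub>A\<^esub> a \<otimes>\<^bsub>A\<^esub> incl A h | f a h. f \<in> C0_fun G U \<and> a \<in> carrier A \<and> h \<in> C0_fun G U}"
  have ctop: "norm_top A = M.mtopology" by (simp add: norm_top_def)
  have S_V: "?S \<subseteq> V"
    using incl_in' C0_continuous by (auto simp del: galg_simps(8) intro!: mult_in)
  fix f
  {
    assume "f \<in> corner G A U"
    then have fc: "f \<in> {x \<in> V. \<forall>r>0. \<exists>y\<in>?S. y \<in> M.mball x r}"
      unfolding corner_def ctop M.metric_closure_of .
    then have f: "f \<in> V" by blast
    have near: "\<exists>s\<in>?S. norm_dist A f s < e" if "e > 0" for e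
    proof -
      have "\<exists>s\<in>?S. s \<in> M.mball f e" using fc that by blast
      then show ?thesis unfolding M.in_mball by blast
    qed
    have "dominated G Y U f"
      unfolding dominated_def
    proof (intro allI impI)
      fix e :: real assume e: "e > 0"
      then obtain s where s: "s \<in> ?S" "norm_dist A f s < e" using near by blast
      then obtain k a h where kah: "k \<in> C0_fun G U" "a \<in> V" "h \<in> C0_fun G U"
        "s = incl A k \<otimes>\<^bsub>A\<^esub> a \<otimes>\<^bsub>A\<^esub> incl A h" by auto
      obtain B where B: "0 < B" "\<And>t. cmod (a t) \<le> B" using bound_ex[OF kah(2)] by blast
      obtain C where C: "0 < C" "\<And>t. cmod (h t) \<le> C" using X.bound_ex[OF C0_continuous[OF kah(3)]] by blast
      have fs: "cmod (f t - s t) \<le> e" for t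
        using norm_dist_le_iff[OF f _ less_imp_le[OF e]] s S_V by (meson less_imp_le subsetD)
      have "cmod (f t) \<le> e + cmod (of_real (B * C) * k (proj Y t))" if t: "t \<in> T" for t
      proof -
        have "cmod (s t) = cmod (k (proj Y t)) * (cmod (a t) * cmod (h (proj Y t)))"
          using t kah(4) by (simp add: norm_mult)
        also have "\<dots> \<le> cmod (k (proj Y t)) * (B * C)"
          using B C by (intro mult_left_mono mult_mono) (auto intro: less_imp_le)
        also have "\<dots> = cmod (of_real (B * C) * k (proj Y t))"
          using B C by (simp add: norm_mult)
        finally show ?thesis using fs[of t] norm_triangle_ineq2[of "f t" "s t"] by linarith
      qed
      moreover have "(\<lambda>x. of_real (B * C) * k x) \<in> C0_fun G U"
        using kah(1) X.scale_in[of k "of_real (B * C)"] by (simp add: C0_fun_def)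
      ultimately show "\<exists>k\<in>C0_fun G U. \<forall>t\<in>T. cmod (f t) \<le> e + cmod (k (proj Y t))"
        by (intro bexI[of _ "\<lambda>x. of_real (B * C) * k x"]) auto
    qed
    then show "f \<in> {f \<in> V. dominated G Y U f}" using f by simp
  }
  assume "f \<in> {f \<in> V. dominated G Y U f}"
  then obtain u b where "u \<in> C0_fun G U" "b \<in> V" "f = (\<lambda>t. incl A u t * b t * incl A u t)"
    using dominated_factor by blast
  then have "f \<in> ?S" by auto
  then show "f \<in> corner G A U"
    unfolding corner_def ctop using closure_of_subset[of ?S M.mtopology] S_V by auto
qed

lemma bact_star:
  assumes g: "\<gamma> \<in> open_bisections G" and f: "f \<in> V" "dominated G Y (src G ` \<gamma>) f"
  shows "bact A (bis_star G \<gamma>) (bact A \<gamma> f) = f"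
proof
  fix t
  have sub: "\<gamma> \<subseteq> arrows G" using bisection_arrows[OF g] by blast
  \<comment> \<open>By the factorisation f vanishes on the fibres outside the support, where the
    round trip gives 0.\<close>
  have f_off: "f t = 0" if "t \<in> T" "proj Y t \<notin> src G ` \<gamma>"
  proof -
    obtain u b where u: "u \<in> C0_fun G (src G ` \<gamma>)" "f = (\<lambda>t. incl A u t * b t * incl A u t)"
      using dominated_factor[OF f] by blast
    then have "u (proj Y t) = 0" using that by (simp add: C0_fun_def)
    then show ?thesis using u(2) by simp
  qed
  show "bact A (bis_star G \<gamma>) (bact A \<gamma> f) t = f t"
  proof (cases "t \<in> T \<and> proj Y t \<in> src G ` \<gamma>")
    case True
    then obtain h where h: "h \<in> \<gamma>" "proj Y t = src G h" by blast
    then have ha: "h \<in> arrows G" using sub by blast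
    have s: "ginv G h \<in> bis_star G \<gamma>" "proj Y t = rng G (ginv G h)"
      using h ha by (auto simp: bis_star_def rng_inv)
    let ?t = "act Y (ginv G (ginv G h)) t"
    note a = act_inv[OF conjunct1[OF True] inv_closed[OF ha] s(2)]
    have "bact A (bis_star G \<gamma>) (bact A \<gamma> f) t = bact A \<gamma> f ?t"
      using True by (intro bact_at[OF bisection_star[OF g] s(1) _ s(2)]) simp
    also have "\<dots> = f (act Y (ginv G h) ?t)"
      using a ha by (intro bact_at[OF g h(1)]) (auto simp: src_inv)
    also have "act Y (ginv G h) ?t = t" using a by simp
    finally show ?thesis .
  next
    case False
    then have "t \<notin> T \<or> proj Y t \<notin> rng G ` bis_star G \<gamma>"
      by (simp add: rng_star[OF sub])
    then have "bact A (bis_star G \<gamma>) (bact A \<gamma> f) t = 0" by auto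
    moreover have "f t = 0" using False f_off vanish[OF f(1), of t] by blast
    ultimately show ?thesis by simp
  qed
qed

lemma bact_corner:
  assumes g: "\<gamma> \<in> open_bisections G" and f: "f \<in> corner G A (src G ` \<gamma>)"
  shows "bact A \<gamma> f \<in> corner G A (rng G ` \<gamma>)"
  using f bact_in[OF g] dominated_bact[OF g] unfolding corner_eq by blast

lemma gcstar_algebra_galg: "gcstar_algebra G A"
proof (intro gcstar_algebra.intro gcstar_algebra_axioms.intro cstar_algebra_galg)
  show "star_hom_on (continuous_functions (unit_top G)) (C_alg (unit_top G)) A (incl A)"
    unfolding star_hom_on_def by (auto simp: C_alg_def incl_in)
  show "incl A \<one>\<^bsub>C_alg (unit_top G)\<^esub> = \<one>\<^bsub>A\<^esub>"
    using proj_units by (auto simp: C_alg_def)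
  show "inj_on (incl A) (continuous_functions (unit_top G))"
  proof (rule inj_onI, rule ext)
    fix k l x assume kl: "k \<in> continuous_functions (unit_top G)" "l \<in> continuous_functions (unit_top G)"
      and eq: "incl A k = incl A l"
    show "k x = l x"
    proof (cases "x \<in> units G")
      case True
      then have "x \<in> proj Y ` T" unfolding proj_surj .
      then obtain t where "t \<in> T" "proj Y t = x" by blast
      then show ?thesis using fun_cong[OF eq, of t] by simp
    next
      case False
      then show ?thesis using kl X.vanish[of k x] X.vanish[of l x] by simp
    qed
  qed
next
  fix \<gamma> assume g: "\<gamma> \<in> open_bisections G"
  have sub: "\<gamma> \<subseteq> arrows G" using bisection_arrows[OF g] by blast
  have sub': "bis_star G \<gamma> \<subseteq> arrows G" using bisection_arrows[OF bisection_star[OF g]] by blast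
  have ss: "bis_star G (bis_star G \<gamma>) = \<gamma>"
    using sub inv_inv unfolding bis_star_def by (force simp: image_iff)
  show "bij_betw (bact A \<gamma>) (corner G A (src G ` \<gamma>)) (corner G A (rng G ` \<gamma>))"
  proof (rule bij_betw_byWitness[where f' = "bact A (bis_star G \<gamma>)"])
    show "\<forall>a\<in>corner G A (src G ` \<gamma>). bact A (bis_star G \<gamma>) (bact A \<gamma> a) = a"
      using bact_star[OF g] unfolding corner_eq by blast
    show "\<forall>a\<in>corner G A (rng G ` \<gamma>). bact A \<gamma> (bact A (bis_star G \<gamma>) a) = a"
      using bact_star[OF bisection_star[OF g]] unfolding corner_eq src_star[OF sub] ss by blast
    show "bact A \<gamma> ` corner G A (src G ` \<gamma>) \<subseteq> corner G A (rng G ` \<gamma>)"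
      using bact_corner[OF g] by blast
    show "bact A (bis_star G \<gamma>) ` corner G A (rng G ` \<gamma>) \<subseteq> corner G A (src G ` \<gamma>)"
      using bact_corner[OF bisection_star[OF g]] unfolding src_star[OF sub] rng_star[OF sub] by blast
  qed
  show "star_hom_on (corner G A (src G ` \<gamma>)) A A (bact A \<gamma>)"
    unfolding star_hom_on_def
  proof (intro conjI ballI allI)
    fix f assume "f \<in> corner G A (src G ` \<gamma>)"
    then show "bact A \<gamma> f \<in> carrier A"
      using bact_corner[OF g] corner_eq by auto
  qed (auto simp: fun_eq_iff)
  fix f assume f: "f \<in> C0_fun G (src G ` \<gamma>)"
  show "bact A \<gamma> (incl A f) = incl A (\<lambda>x. if x \<in> rng G ` \<gamma> then f (bis_map G (bis_star G \<gamma>) x) else 0)"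
  proof
    fix t
    show "bact A \<gamma> (incl A f) t = incl A (\<lambda>x. if x \<in> rng G ` \<gamma> then f (bis_map G (bis_star G \<gamma>) x) else 0) t"
    proof (cases "t \<in> T \<and> proj Y t \<in> rng G ` \<gamma>")
      case True
      then obtain h where h: "h \<in> \<gamma>" "proj Y t = rng G h" by blast
      note a = act_inv[OF conjunct1[OF True] bisection_arrows[OF g h(1)] h(2)]
      have "bact A \<gamma> (incl A f) t = incl A f (act Y (ginv G h) t)"
        using True by (intro bact_at[OF g h(1) _ h(2)]) simp
      then show ?thesis
        using True a bis_map_star[OF g h(1)] h(2) by (simp add: image_iff)
    next
      case False
      then show ?thesis by auto
    qed
  qed
next
  \<comment> \<open>Compatibility with products: both sides evaluate f at the point obtained from t
    by the inverse of h k, where h k is the arrow of the product whose range is the projection of t.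
    Both are 0 if there is no such arrow.\<close>
  fix \<gamma> \<delta> f
  assume g: "\<gamma> \<in> open_bisections G" and d: "\<delta> \<in> open_bisections G"
  show "bact A \<gamma> (bact A \<delta> f) = bact A (bis_mul G \<gamma> \<delta>) f"
  proof
    fix t
    have prod_arr: "the_inv_into (bis_mul G \<gamma> \<delta>) (rng G) (rng G h) = gmul G h k"
      if hk: "h \<in> \<gamma>" "k \<in> \<delta>" "src G h = rng G k" for h k
    proof -
      have comp: "(h, k) \<in> composable G" if "h \<in> \<gamma>" "k \<in> \<delta>" "src G h = rng G k" for h k
        using that bisection_arrows g d by (auto simp: composable_def)
      have "inj_on (rng G) (bis_mul G \<gamma> \<delta>)"
      proof (rule inj_onI)
        fix p q assume "p \<in> bis_mul G \<gamma> \<delta>" "q \<in> bis_mul G \<gamma> \<delta>" and eq: "rng G p = rng G q"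
        then obtain h k h' k' where
          p: "p = gmul G h k" "h \<in> \<gamma>" "k \<in> \<delta>" "src G h = rng G k" and
          q: "q = gmul G h' k'" "h' \<in> \<gamma>" "k' \<in> \<delta>" "src G h' = rng G k'"
          unfolding bis_mul_def by blast
        have "rng G h = rng G h'"
          using eq p q rng_mul[OF comp, of h k] rng_mul[OF comp, of h' k'] by simp
        then have "h = h'" using bisection_inj_rng[OF g] p q by (auto dest: inj_onD)
        moreover from this have "k = k'" using bisection_inj_rng[OF d] p q by (auto dest: inj_onD)
        ultimately show "p = q" using p q by simp
      qed
      then show ?thesis
        using hk rng_mul[OF comp[OF hk]] the_inv_into_f_f[of "rng G" "bis_mul G \<gamma> \<delta>" "gmul G h k"]
        unfolding bis_mul_def by auto
    qed
    show "bact A \<gamma> (bact A \<delta> f) t = bact A (bis_mul G \<gamma> \<delta>) f t"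
    proof (cases "t \<in> T \<and> proj Y t \<in> rng G ` \<gamma>")
      case True
      then obtain h where h: "h \<in> \<gamma>" "proj Y t = rng G h" by blast
      have ha: "h \<in> arrows G" using bisection_arrows[OF g h(1)] .
      let ?t = "act Y (ginv G h) t"
      note a = act_inv[OF conjunct1[OF True] ha h(2)]
      have 1: "bact A \<gamma> (bact A \<delta> f) t = bact A \<delta> f ?t"
        using True by (intro bact_at[OF g h(1) _ h(2)]) simp
      show ?thesis
      proof (cases "src G h \<in> rng G ` \<delta>")
        case True2: True
        then obtain k where k: "k \<in> \<delta>" "src G h = rng G k" by blast
        have ka: "k \<in> arrows G" using bisection_arrows[OF d k(1)] .
        have hk: "(h, k) \<in> composable G" using ha ka k(2) by (simp add: composable_def)
        have "gmul G h k \<in> bis_mul G \<gamma> \<delta>" using h k unfolding bis_mul_def by blast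
        then have im: "proj Y t \<in> rng G ` bis_mul G \<gamma> \<delta>"
          using rng_mul[OF hk] h(2) by (metis image_eqI)
        have "bact A \<delta> f ?t = f (act Y (ginv G k) ?t)"
          using a k by (intro bact_at[OF d k(1)]) auto
        also have "act Y (ginv G k) ?t = act Y (gmul G (ginv G k) (ginv G h)) t"
          using ha ka k(2) a by (intro actn_mul[symmetric]) (auto simp: composable_def inv_closed src_inv rng_inv)
        also have "gmul G (ginv G k) (ginv G h) = ginv G (gmul G h k)"
          using inv_gmul[OF hk] by simp
        finally show ?thesis
          using 1 True im prod_arr[OF h(1) k] h(2) by (simp del: galg_simps(9)) simp
      next
        case False
        have "proj Y t \<notin> rng G ` bis_mul G \<gamma> \<delta>"
        proof
          assume "proj Y t \<in> rng G ` bis_mul G \<gamma> \<delta>"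
          then obtain h' k' where q: "h' \<in> \<gamma>" "k' \<in> \<delta>" "src G h' = rng G k'" "proj Y t = rng G (gmul G h' k')"
            unfolding bis_mul_def by blast
          then have "(h', k') \<in> composable G" using bisection_arrows g d by (auto simp: composable_def)
          then have "rng G h' = rng G h" using q h rng_mul by simp
          then have "h' = h" using inj_onD[OF bisection_inj_rng[OF g], of h' h] q(1) h(1) by blast
          then show False using q False by auto
        qed
        then show ?thesis using 1 a False by simp
      qed
    next
      case False
      have "proj Y t \<in> rng G ` \<gamma>" if "proj Y t \<in> rng G ` bis_mul G \<gamma> \<delta>"
      proof -
        from that obtain h' k' where q: "h' \<in> \<gamma>" "k' \<in> \<delta>" "src G h' = rng G k'" "proj Y t = rng G (gmul G h' k')"
          unfolding bis_mul_def by blast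
        then have "(h', k') \<in> composable G" using bisection_arrows g d by (auto simp: composable_def)
        then show ?thesis using q rng_mul by auto
      qed
      then show ?thesis using False by auto
    qed
  qed
qed

end

section \<open>Continuous functions on a compact G-space\<close>

locale compact_galg = compact_groupoid G + compact_gspace G Y
  for G :: "'g groupoid" and Y :: "('g, 'y) gspace"
begin

lemma continuous_bisection_act:
  assumes g: "\<gamma> \<in> open_bisections G"
  defines "U \<equiv> {t \<in> topspace (sptop Y). proj Y t \<in> rng G ` \<gamma>}"
  shows "continuous_map (subtopology (sptop Y) U) (sptop Y) (\<lambda>t. act Y (ginv G (arr \<gamma> (proj Y t))) t)"
proof -
  have p: "continuous_map (subtopology (sptop Y) U) (subtopology (unit_top G) (rng G ` \<gamma>)) (proj Y)"
    using continuous_proj by (auto simp: continuous_map_in_subtopology U_def intro: continuous_map_from_subtopology)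
  have "continuous_map (subtopology (sptop Y) U) (gtop G) (\<lambda>t. ginv G (arr \<gamma> (proj Y t)))"
    using continuous_map_compose[OF continuous_map_compose[OF p continuous_inv_rng[OF g]] continuous_inv]
    by (simp add: o_def arr_def)
  then have "continuous_map (subtopology (sptop Y) U) (prod_topology (gtop G) (sptop Y))
      (\<lambda>t. (ginv G (arr \<gamma> (proj Y t)), t))"
    by (intro continuous_map_pairedI) (auto intro: continuous_map_from_subtopology)
  moreover have "(ginv G (arr \<gamma> (proj Y t)), t) \<in> act_dom G Y" if "t \<in> U" for t
    using that bisection_arrows[OF g] by (auto simp: act_dom_def U_def arr_rng[OF g] src_inv inv_closed)
  ultimately have "continuous_map (subtopology (sptop Y) U)
      (subtopology (prod_topology (gtop G) (sptop Y)) (act_dom G Y)) (\<lambda>t. (ginv G (arr \<gamma> (proj Y t)), t))"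
    by (auto simp: continuous_map_in_subtopology)
  from continuous_map_compose[OF this continuous_act] show ?thesis by (simp add: o_def)
qed

lemma bisection_preimage_open:
  "\<gamma> \<in> open_bisections G \<Longrightarrow> openin (sptop Y) {t \<in> topspace (sptop Y). proj Y t \<in> rng G ` \<gamma>}"
  using openin_continuous_map_preimage[OF continuous_proj bisection_im_open] .

sublocale fun_galg G Y "continuous_functions (sptop Y)"
  unfolding fun_galg_def using fun_alg_continuous_functions[OF compact] .

lemma proj_continuous_functions:
  assumes "k \<in> continuous_functions (unit_top G)"
  shows "(\<lambda>y. if y \<in> topspace (sptop Y) then k (proj Y y) else 0) \<in> continuous_functions (sptop Y)"
proof -
  have "continuous_map (sptop Y) euclidean (k \<circ> proj Y)"
    using assms continuous_proj by (auto simp: continuous_functions_def intro: continuous_map_compose)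
  then have "continuous_map (sptop Y) euclidean (\<lambda>y. if y \<in> topspace (sptop Y) then k (proj Y y) else 0)"
    by (rule continuous_map_eq) simp
  then show ?thesis by (simp add: continuous_functions_def)
qed

text \<open>The translate must tend to 0 towards the fibres outside the image of \<gamma>. If |f|
  \<le> e/2 + |k|, it is bounded by e/2 plus the translate of |k|, which is continuous and vanishes
  there by \<open>unit_bact_C0\<close>.\<close>

lemma bact_continuous:
  assumes g: "\<gamma> \<in> open_bisections G" and f: "f \<in> continuous_functions (sptop Y)"
    and dom: "dominated G Y (src G ` \<gamma>) f"
  shows "bact (galg G Y (continuous_functions (sptop Y))) \<gamma> f \<in> continuous_functions (sptop Y)"
proof -
  define U where "U = {t \<in> topspace (sptop Y). proj Y t \<in> rng G ` \<gamma>}"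
  have fc: "continuous_map (sptop Y) euclidean f" using f by (simp add: continuous_functions_def)
  have "continuous_map (sptop Y) euclidean
      (\<lambda>t. if t \<in> U then f (act Y (ginv G (arr \<gamma> (proj Y t))) t) else 0)"
  proof (rule continuous_map_extend_by_zero)
    show "openin (sptop Y) U" unfolding U_def by (rule bisection_preimage_open[OF g])
    show "continuous_map (subtopology (sptop Y) U) euclidean (\<lambda>t. f (act Y (ginv G (arr \<gamma> (proj Y t))) t))"
      using continuous_map_compose[OF continuous_bisection_act[OF g] fc] by (simp add: o_def U_def)
    fix t and e :: real assume t: "t \<in> topspace (sptop Y)" "t \<notin> U" and e: "e > 0"
    then obtain k where k: "k \<in> C0_fun G (src G ` \<gamma>)"
      "\<forall>t\<in>topspace (sptop Y). cmod (f t) \<le> e / 2 + cmod (k (proj Y t))"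
      using dom half_gt_zero[OF e] unfolding dominated_def by blast
    have kc: "continuous_map (sptop Y) euclidean (\<lambda>t. unit_bact \<gamma> k (proj Y t))"
      using continuous_map_compose[OF continuous_proj C0_continuous_map[OF unit_bact_C0[OF g k(1)]]]
      by (simp add: o_def)
    have "unit_bact \<gamma> k (proj Y t) = 0" using t by (simp add: unit_bact_def U_def)
    then obtain W where W: "openin (sptop Y) W" "t \<in> W" "\<And>y. y \<in> W \<Longrightarrow> cmod (unit_bact \<gamma> k (proj Y y)) < e / 2"
      using continuous_map_epsD[OF kc t(1) half_gt_zero[OF e]] by (auto simp: dist_norm)
    have "cmod (f (act Y (ginv G (arr \<gamma> (proj Y y))) y)) < e" if y: "y \<in> W \<inter> U" for y
    proof -
      obtain h where h: "h \<in> \<gamma>" "proj Y y = rng G h" "y \<in> topspace (sptop Y)" using y by (auto simp: U_def)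
      have ha: "h \<in> arrows G" using bisection_arrows[OF g h(1)] .
      have d: "(ginv G h, y) \<in> act_dom G Y" using h ha by (simp add: act_dom_def inv_closed src_inv)
      have "cmod (f (act Y (ginv G h) y)) \<le> e / 2 + cmod (k (src G h))"
        using bspec[OF k(2) act_closed[OF d]] proj_act[OF d] ha by (simp add: rng_inv)
      also have "k (src G h) = unit_bact \<gamma> k (proj Y y)" using unit_bact_rng[OF g h(1)] h(2) by simp
      also have "e / 2 + cmod \<dots> < e" using W(3)[of y] y by simp
      finally show ?thesis using arr_rng[OF g h(1)] h(2) by simp
    qed
    then show "\<exists>W. openin (sptop Y) W \<and> t \<in> W \<and>
        (\<forall>y\<in>W \<inter> U. cmod (f (act Y (ginv G (arr \<gamma> (proj Y y))) y)) < e)"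
      using W by blast
  qed
  then show ?thesis
    unfolding continuous_functions_def arr_def by (auto simp: U_def)
qed

sublocale gset G Y "continuous_functions (sptop Y)"
  by unfold_locales
    (auto intro: act_closed proj_act act_unit act_mul proj_continuous_functions bact_continuous
      simp: surj_proj simp del: galg_simps)

end

text \<open>Arrows are coded as \<open>{{g}}\<close> so that the algebra of bounded functions on them is one of the
  test objects for essential extensions.\<close>

definition arrow_code :: "'g \<Rightarrow> 'g set set" where
  "arrow_code g = {{g}}"

definition arrow_decode :: "'g set set \<Rightarrow> 'g" where
  "arrow_decode t = the_elem (the_elem t)"

lemma arrow_decode_code [simp]: "arrow_decode (arrow_code g) = g"
  by (simp add: arrow_decode_def arrow_code_def)

definition arrow_gspace :: "'g groupoid \<Rightarrow> ('g, 'g set set) gspace" where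
  "arrow_gspace G = \<lparr>sptop = discrete_topology (arrow_code ` arrows G),
     proj = (\<lambda>t. rng G (arrow_decode t)),
     act = (\<lambda>h t. arrow_code (gmul G h (arrow_decode t)))\<rparr>"

text \<open>No continuity is imposed: for a family of measures chosen separately on each fibre the
  integrals depend on the arrow in an arbitrary way.\<close>

definition arrow_functions :: "'g groupoid \<Rightarrow> ('g set set \<Rightarrow> complex) set" where
  "arrow_functions G =
     {f. (\<forall>t. t \<notin> arrow_code ` arrows G \<longrightarrow> f t = 0) \<and> (\<exists>B. \<forall>t. cmod (f t) \<le> B)}"

lemma arrow_gspace_simps [simp]:
  "sptop (arrow_gspace G) = discrete_topology (arrow_code ` arrows G)"
  "proj (arrow_gspace G) t = rng G (arrow_decode t)"
  "act (arrow_gspace G) h t = arrow_code (gmul G h (arrow_decode t))"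
  by (simp_all add: arrow_gspace_def)

lemma fun_alg_arrow_functions: "fun_alg (arrow_code ` arrows G) (arrow_functions G)"
proof
  fix f g :: "'a set set \<Rightarrow> complex" and c
  assume f: "f \<in> arrow_functions G"
  then obtain B where B: "\<And>t. cmod (f t) \<le> B" unfolding arrow_functions_def by blast
  show "\<exists>B. \<forall>y\<in>arrow_code ` arrows G. cmod (f y) \<le> B" using B by blast
  show "(\<lambda>y. c * f y) \<in> arrow_functions G"
  proof -
    have "cmod (c * f t) \<le> cmod c * B" for t
      using B by (simp add: norm_mult mult_left_mono)
    then show ?thesis using f unfolding arrow_functions_def by auto
  qed
  show "(\<lambda>y. cnj (f y)) \<in> arrow_functions G"
    using f unfolding arrow_functions_def by auto
  assume g: "g \<in> arrow_functions G"
  then obtain C where C: "\<And>t. cmod (g t) \<le> C" unfolding arrow_functions_def by blast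
  have "cmod (f t + g t) \<le> B + C" for t
    using B C by (meson add_mono norm_triangle_le)
  then show "(\<lambda>y. f y + g y) \<in> arrow_functions G"
    using f g unfolding arrow_functions_def by auto
  have "cmod (f t * g t) \<le> B * C" for t
    using B[of t] C[of t] order_trans[OF norm_ge_zero B] by (simp add: norm_mult mult_mono)
  then show "(\<lambda>y. f y * g y) \<in> arrow_functions G"
    using f g unfolding arrow_functions_def by auto
next
  fix f :: "'a set set \<Rightarrow> complex"
  assume z: "\<And>y. y \<notin> arrow_code ` arrows G \<Longrightarrow> f y = 0"
    and l: "\<And>e. e > 0 \<Longrightarrow> \<exists>g\<in>arrow_functions G. \<forall>y\<in>arrow_code ` arrows G. cmod (f y - g y) \<le> e"
  obtain g where g: "g \<in> arrow_functions G" "\<forall>y\<in>arrow_code ` arrows G. cmod (f y - g y) \<le> 1"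
    using l[of 1] by auto
  obtain B where B: "\<And>t. cmod (g t) \<le> B" using g(1) unfolding arrow_functions_def by blast
  have "cmod (f t) \<le> 1 + B" for t
  proof (cases "t \<in> arrow_code ` arrows G")
    case True
    then have "cmod (f t - g t) \<le> 1" using g(2) by blast
    then show ?thesis using B[of t] norm_triangle_ineq2[of "f t" "g t"] by linarith
  next
    case False
    then show ?thesis using z[OF False] order_trans[OF norm_ge_zero B[of t]] by simp
  qed
  then show "f \<in> arrow_functions G" using z unfolding arrow_functions_def by blast
next
  show "(\<lambda>y. if y \<in> arrow_code ` arrows G then 1 else 0) \<in> arrow_functions G"
    unfolding arrow_functions_def by (auto intro!: exI[of _ 1])
qed (auto simp: arrow_functions_def)

lemma (in compact_groupoid) gset_arrow: "gset G (arrow_gspace G) (arrow_functions G)"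
proof (intro gset.intro gset_axioms.intro compact_groupoid_axioms)
  show "fun_galg (arrow_gspace G) (arrow_functions G)"
    unfolding fun_galg_def using fun_alg_arrow_functions by simp
  have "rng G ` arrows G = units G"
  proof
    show "rng G ` arrows G \<subseteq> units G" using rng_units by blast
    show "units G \<subseteq> rng G ` arrows G"
      using units_subset rng_unit by (metis image_eqI subsetI subsetD)
  qed
  then show "proj (arrow_gspace G) ` topspace (sptop (arrow_gspace G)) = units G"
    by (simp add: image_image)
next
  fix h t assume "(h, t) \<in> act_dom G (arrow_gspace G)"
  then obtain k where k: "t = arrow_code k" "(h, k) \<in> composable G"
    by (auto simp: act_dom_def composable_def)
  show "act (arrow_gspace G) h t \<in> topspace (sptop (arrow_gspace G))"
    using k mul_closed by simp
  show "proj (arrow_gspace G) (act (arrow_gspace G) h t) = rng G h"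
    using k rng_mul by simp
  fix g assume "(g, h) \<in> composable G"
  then show "act (arrow_gspace G) (gmul G g h) t = act (arrow_gspace G) g (act (arrow_gspace G) h t)"
    using k mul_assoc by simp
next
  fix t assume "t \<in> topspace (sptop (arrow_gspace G))"
  then show "act (arrow_gspace G) (proj (arrow_gspace G) t) t = t"
    using rng_mul_unit by auto
next
  fix k assume "k \<in> continuous_functions (unit_top G)"
  then obtain B where "0 < B" "\<And>x. cmod (k x) \<le> B" using X.bound_ex by blast
  then show "(\<lambda>y. if y \<in> topspace (sptop (arrow_gspace G)) then k (proj (arrow_gspace G) y) else 0)
      \<in> arrow_functions G"
    unfolding arrow_functions_def by (auto intro!: exI[of _ B])
next
  fix \<gamma> f assume "f \<in> arrow_functions G"
  then obtain B where "\<And>t. cmod (f t) \<le> B" unfolding arrow_functions_def by blast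
  then have "cmod (bact (galg G (arrow_gspace G) (arrow_functions G)) \<gamma> f t) \<le> max B 0" for t
    by (auto simp: le_max_iff_disj)
  moreover have "bact (galg G (arrow_gspace G) (arrow_functions G)) \<gamma> f t = 0"
    if "t \<notin> arrow_code ` arrows G" for t
    using that by simp
  ultimately show "bact (galg G (arrow_gspace G) (arrow_functions G)) \<gamma> f \<in> arrow_functions G"
    unfolding arrow_functions_def by blast
qed

section \<open>Pullback along equivariant maps\<close>

definition pull :: "('g, 'y) gspace \<Rightarrow> ('y \<Rightarrow> 'z) \<Rightarrow> ('z \<Rightarrow> complex) \<Rightarrow> 'y \<Rightarrow> complex" where
  "pull Y q f = (\<lambda>y. if y \<in> topspace (sptop Y) then f (q y) else 0)"

locale gset_map = Z: gset G Z W + Y: gset G Y V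
  for G :: "'g groupoid" and Z :: "('g, 'z) gspace" and W and Y :: "('g, 'y) gspace" and V +
  fixes q :: "'y \<Rightarrow> 'z"
  assumes map_into: "y \<in> topspace (sptop Y) \<Longrightarrow> q y \<in> topspace (sptop Z)"
    and map_proj: "y \<in> topspace (sptop Y) \<Longrightarrow> proj Z (q y) = proj Y y"
    and map_act: "(g, y) \<in> act_dom G Y \<Longrightarrow> q (act Y g y) = act Z g (q y)"
    and pull_in: "f \<in> W \<Longrightarrow> pull Y q f \<in> V"
begin

lemma pull_bact:
  assumes g: "\<gamma> \<in> open_bisections G"
  shows "pull Y q (bact Z.A \<gamma> f) = bact Y.A \<gamma> (pull Y q f)"
proof
  fix y
  show "pull Y q (bact Z.A \<gamma> f) y = bact Y.A \<gamma> (pull Y q f) y"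
  proof (cases "y \<in> topspace (sptop Y) \<and> proj Y y \<in> rng G ` \<gamma>")
    case True
    then obtain h where h: "h \<in> \<gamma>" "proj Y y = rng G h" by blast
    note a = Y.act_inv[OF conjunct1[OF True] Z.bisection_arrows[OF g h(1)] h(2)]
    have "bact Y.A \<gamma> (pull Y q f) y = pull Y q f (act Y (ginv G h) y)"
      using True by (intro Y.bact_at[OF g h(1) _ h(2)]) simp
    also have "\<dots> = f (act Z (ginv G h) (q y))"
      using a map_act[OF a(1)] by (simp add: pull_def)
    also have "\<dots> = bact Z.A \<gamma> f (q y)"
      using True map_into map_proj h by (intro Z.bact_at[OF g h(1), symmetric]) auto
    finally show ?thesis using True by (simp add: pull_def del: galg_simps)
  next
    case False
    then show ?thesis using map_proj by (auto simp: pull_def)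
  qed
qed

lemma pull_gucp: "gucp_map G Z.A Y.A (pull Y q)"
  unfolding gucp_map_def ucp_map_def compatible_def
proof (intro conjI ballI allI impI)
  fix n X assume "mat_positive Z.A n X"
  then show "mat_positive Y.A n (\<lambda>i j. pull Y q (X i j))"
    unfolding Z.mat_positive_galg Y.mat_positive_galg using pull_in map_into
    by (auto simp: pull_def)
qed (auto simp: pull_in pull_bact simp del: galg_simps(9),
     auto simp: pull_def fun_eq_iff map_into map_proj)

text \<open>Every point of Z has a preimage in Y, at which positivity and equality can be read
  off.\<close>

lemma pull_gembedding:
  assumes surj: "q ` topspace (sptop Y) = topspace (sptop Z)"
  shows "gembedding G Z.A Y.A (pull Y q)"
  unfolding gembedding_def complete_order_embedding_def
proof (intro conjI allI impI pull_gucp)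
  show "ucp_map Z.A Y.A (pull Y q)" using pull_gucp by (simp add: gucp_map_def)
  show "inj_on (pull Y q) (carrier Z.A)"
  proof (rule inj_onI, rule ext)
    fix f g z assume fg: "f \<in> carrier Z.A" "g \<in> carrier Z.A" and eq: "pull Y q f = pull Y q g"
    show "f z = g z"
    proof (cases "z \<in> topspace (sptop Z)")
      case True
      then obtain y where "y \<in> topspace (sptop Y)" "z = q y" using surj by blast
      then show ?thesis using fun_cong[OF eq, of y] by (simp add: pull_def)
    next
      case False
      then show ?thesis using fg Z.vanish[of f z] Z.vanish[of g z] by simp
    qed
  qed
  fix n X assume X: "mat_carrier Z.A n X" "mat_positive Y.A n (\<lambda>i j. pull Y q (X i j))"
  have "psd n (\<lambda>i j. X i j z)" if z: "z \<in> topspace (sptop Z)" for z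
  proof -
    obtain y where "y \<in> topspace (sptop Y)" "z = q y" using z surj by blast
    then show ?thesis using X(2) unfolding Y.mat_positive_galg by (auto simp: pull_def)
  qed
  then show "mat_positive Z.A n X"
    using X(1) unfolding Z.mat_positive_galg mat_carrier_def by simp
qed

end


section \<open>Riesz representation on compact Hausdorff spaces\<close>

lemma sets_borel_sigma: "sets (borel_sigma Y) = sigma_sets (topspace Y) {U. openin Y U}"
  unfolding borel_sigma_def by (rule sets_measure_of) (auto dest: openin_subset)

lemma space_borel_sigma [simp]: "space (borel_sigma Y) = topspace Y"
  unfolding borel_sigma_def by (rule space_measure_of) (auto dest: openin_subset)

locale positive_functional =
  fixes Y :: "'y topology" and I :: "('y \<Rightarrow> real) \<Rightarrow> real"
  assumes compact: "compact_space Y" and Hausdorff: "Hausdorff_space Y"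
    and I_add: "continuous_map Y euclideanreal u \<Longrightarrow> continuous_map Y euclideanreal v \<Longrightarrow>
      I (\<lambda>y. u y + v y) = I u + I v"
    and I_scale: "continuous_map Y euclideanreal u \<Longrightarrow> I (\<lambda>y. c * u y) = c * I u"
    and I_nonneg: "continuous_map Y euclideanreal u \<Longrightarrow> (\<And>y. y \<in> topspace Y \<Longrightarrow> 0 \<le> u y) \<Longrightarrow> 0 \<le> I u"
    and I_one: "I (\<lambda>y. 1) = 1"
begin

abbreviation cont where "cont u \<equiv> continuous_map Y euclideanreal u"
abbreviation T where "T \<equiv> topspace Y"

lemma I_const: "I (\<lambda>y. c) = c"
  using I_scale[of "\<lambda>_. 1" c] I_one by simp

text \<open>Applied in both directions it shows that I depends only on values on T; the functions
  here are not normalised off T.\<close>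

lemma I_mono:
  assumes u: "cont u" and v: "cont v" and le: "\<And>y. y \<in> T \<Longrightarrow> u y \<le> v y"
  shows "I u \<le> I v"
proof -
  have m: "cont (\<lambda>y. - 1 * u y)" using u by (intro continuous_map_real_mult) auto
  have "0 \<le> I (\<lambda>y. v y + - 1 * u y)"
    using u v m le by (intro I_nonneg continuous_map_add) auto
  then show ?thesis
    using I_add[OF v m] I_scale[OF u, of "-1"] by simp
qed

lemma I_sum:
  assumes "\<And>i. i \<in> A \<Longrightarrow> cont (u i)"
  shows "I (\<lambda>y. \<Sum>i\<in>A. u i y) = (\<Sum>i\<in>A. I (u i))"
  using assms
proof (induction A rule: infinite_finite_induct)
  case (insert a A)
  have "cont (\<lambda>y. \<Sum>i\<in>A. u i y)"
    using insert by (intro continuous_map_sum) auto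
  then show ?case using insert by (simp add: I_add)
qed (simp_all add: I_const)

section \<open>The outer measure of a positive functional\<close>

definition under :: "'y set \<Rightarrow> ('y \<Rightarrow> real) \<Rightarrow> bool" where
  "under U u \<longleftrightarrow> cont u \<and> (\<forall>y\<in>T. 0 \<le> u y \<and> u y \<le> 1) \<and> (\<forall>y\<in>T - U. u y = 0)"

text \<open>The content of an open set in Riesz's construction. The competing functions vanish off U
  but need not have support inside U; \<open>under_cut\<close> makes up for this.\<close>

definition lam :: "'y set \<Rightarrow> real" where
  "lam U = Sup (I ` {u. under U u})"

lemma under_zero: "under U (\<lambda>y. 0)"
  by (simp add: under_def)

lemma under_le_1: "under U u \<Longrightarrow> I u \<le> 1"
  using I_mono[of u "\<lambda>y. 1"] I_one by (simp add: under_def)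

lemma le_lam: "under U u \<Longrightarrow> I u \<le> lam U"
  unfolding lam_def using under_le_1 by (intro cSup_upper) (auto intro!: bdd_aboveI[of _ 1])

lemma lam_le: "(\<And>u. under U u \<Longrightarrow> I u \<le> c) \<Longrightarrow> lam U \<le> c"
  unfolding lam_def using under_zero by (intro cSup_least) auto

lemma lam_nonneg: "0 \<le> lam U"
  using le_lam[OF under_zero, of U] I_const[of 0] by simp

lemma lam_le_1: "lam U \<le> 1"
  by (rule lam_le) (rule under_le_1)

lemma lam_top: "lam T = 1"
  using le_lam[of T "\<lambda>_. 1"] lam_le_1[of T] I_one by (simp add: under_def)

lemma lam_empty: "lam {} = 0"
proof -
  have "I u \<le> 0" if "under {} u" for u
    using that I_mono[of u "\<lambda>_. 0"] I_const[of 0] by (auto simp: under_def)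
  then show ?thesis using lam_nonneg[of "{}"] lam_le[of "{}" 0] by force
qed

lemma lam_mono: "U \<subseteq> V \<Longrightarrow> lam U \<le> lam V"
  by (rule lam_le, rule le_lam) (unfold under_def, blast)

lemma normal: "normal_space Y"
  using compact Hausdorff by (rule compact_Hausdorff_or_regular_imp_normal_space[OF _ disjI1])

lemma Urysohn:
  assumes "closedin Y S" "closedin Y C" "S \<inter> C = {}"
  obtains u where "cont u" "\<And>y. y \<in> T \<Longrightarrow> 0 \<le> u y \<and> u y \<le> 1" "\<And>y. y \<in> S \<Longrightarrow> u y = 0" "\<And>y. y \<in> C \<Longrightarrow> u y = 1"
proof -
  obtain f where f: "continuous_map Y (top_of_set {0..1::real}) f" "f ` S \<subseteq> {0}" "f ` C \<subseteq> {1}"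
    using Urysohn_lemma[OF normal assms(1,2), of 0 1] assms(3) by (auto simp: disjnt_def)
  show thesis
    using that[of f] continuous_map_into_fulltopology[OF f(1)] continuous_map_image_subset_topspace[OF f(1)] f(2,3)
    by (auto simp: image_subset_iff)
qed

text \<open>Cutting off at height e costs at most e and leaves a function that vanishes off the
  closed set where f \<ge> e. That set lies in U, as f vanishes on T - U, and takes the place of a
  compact support.\<close>

lemma under_cut:
  assumes f: "under U f" and e: "0 < e"
  defines "g \<equiv> \<lambda>y. max 0 (f y - e)"
  shows "under U g" "I f \<le> I g + e" "closedin Y {y \<in> T. e \<le> f y}"
    "\<And>y. y \<in> T \<Longrightarrow> y \<notin> {y \<in> T. e \<le> f y} \<Longrightarrow> g y = 0"
proof -
  have fc: "cont f" using f by (simp add: under_def)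
  have gc: "cont g" unfolding g_def using fc by (intro continuous_intros) auto
  show "under U g" using f e gc by (force simp: under_def g_def)
  have "I f \<le> I (\<lambda>y. g y + e)"
    using fc gc by (intro I_mono continuous_intros) (auto simp: g_def)
  then show "I f \<le> I g + e" using I_add[OF gc, of "\<lambda>_. e"] I_const[of e] by simp
  have "closedin euclideanreal {e..}" by simp
  from closedin_continuous_map_preimage[OF fc this] show "closedin Y {y \<in> T. e \<le> f y}" by simp
  show "g y = 0" if "y \<in> T" "y \<notin> {y \<in> T. e \<le> f y}" for y
    using that by (auto simp: g_def)
qed

lemma lam_Un:
  assumes U: "openin Y U" and V: "openin Y V"
  shows "lam (U \<union> V) \<le> lam U + lam V"
proof (rule lam_le, rule field_le_epsilon)
  fix f and e :: real assume f: "under (U \<union> V) f" and e: "0 < e"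
  define g where "g y = max 0 (f y - e)" for y
  define C where "C = {y \<in> T. e \<le> f y}"
  note c = under_cut[OF f e, folded g_def C_def]
  \<comment> \<open>To split g into g u under U and g (1 - u) under V, u has to vanish off U and to
    be 1 on the part of C outside V.\<close>
  have "closedin Y (T - U)" "closedin Y (C - V)" "(T - U) \<inter> (C - V) = {}"
    using U V c(3,4) f e by (auto simp: under_def C_def intro!: closedin_diff)
  then obtain u where u: "cont u" "\<And>y. y \<in> T \<Longrightarrow> 0 \<le> u y \<and> u y \<le> 1"
    "\<And>y. y \<in> T - U \<Longrightarrow> u y = 0" "\<And>y. y \<in> C - V \<Longrightarrow> u y = 1"
    by (rule Urysohn) blast
  have gc: "cont g" using c(1) by (simp add: under_def)
  have g01: "0 \<le> g y \<and> g y \<le> 1" if "y \<in> T" for y using c(1) that by (simp add: under_def)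
  have c1: "cont (\<lambda>y. g y * u y)" and c2: "cont (\<lambda>y. g y * (1 - u y))"
    using gc u(1) by (auto intro!: continuous_intros)
  have "under U (\<lambda>y. g y * u y)"
    unfolding under_def using c1 u g01 by (auto simp: mult_le_one)
  moreover have "under V (\<lambda>y. g y * (1 - u y))"
    unfolding under_def
  proof (intro conjI ballI c2)
    show "g y * (1 - u y) = 0" if "y \<in> T - V" for y
      using that c(4) u(4) by (cases "y \<in> C") auto
  qed (use u(2) g01 in \<open>auto simp: mult_le_one\<close>)
  moreover have "I g = I (\<lambda>y. g y * u y) + I (\<lambda>y. g y * (1 - u y))"
    using I_add[OF c1 c2] by (simp add: algebra_simps)
  ultimately show "I f \<le> lam U + lam V + e"
    using c(2) le_lam by (smt (verit))
qed

lemma lam_finite_Union: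
  fixes n :: nat
  assumes "\<And>i. openin Y (U i)"
  shows "lam (\<Union>i<n. U i) \<le> (\<Sum>i<n. lam (U i))"
proof (induction n)
  case (Suc n)
  have "(\<Union>i<Suc n. U i) = (\<Union>i<n. U i) \<union> U n" by (auto simp: less_Suc_eq)
  moreover have "openin Y (\<Union>i<n. U i)"
    using assms by (intro openin_Union) auto
  ultimately show ?case
    using lam_Un[of "\<Union>i<n. U i" "U n"] Suc assms[of n] by simp
qed (simp add: lam_empty)

text \<open>After cutting at height e only the compact set C has to be covered, so finitely many of
  the open sets suffice.\<close>

lemma lam_Union:
  assumes U: "\<And>i::nat. openin Y (U i)"
  shows "ennreal (lam (\<Union>i. U i)) \<le> (\<Sum>i. ennreal (lam (U i)))"
proof (rule ennreal_le_epsilon)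
  fix e :: real assume e: "0 < e" and fin: "(\<Sum>i. ennreal (lam (U i))) < Orderings.top"
  have s: "summable (\<lambda>i. lam (U i))"
    using fin lam_nonneg summable_suminf_not_top[of "\<lambda>i. lam (U i)"] by (simp add: less_top)
  have "lam (\<Union>i. U i) \<le> (\<Sum>i. lam (U i)) + e"
  proof (rule lam_le)
    fix f assume f: "under (\<Union>i. U i) f"
    define g where "g y = max 0 (f y - e)" for y
    define C where "C = {y \<in> T. e \<le> f y}"
    note c = under_cut[OF f e, folded g_def C_def]
    have "compactin Y C" using compact c(3) by (rule closedin_compact_space)
    moreover have "C \<subseteq> \<Union>(range U)" using f e by (force simp: under_def C_def)
    ultimately obtain F where F: "finite F" "F \<subseteq> range U" "C \<subseteq> \<Union>F"
      using compactinD[of Y C "range U"] U by blast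
    obtain J where J: "finite J" "F = U ` J"
      using finite_subset_image[OF F(1,2)] by metis
    obtain n where n: "J \<subseteq> {..<n}" using J(1) finite_nat_bounded by blast
    have Cn: "C \<subseteq> (\<Union>i<n. U i)" using F(3) J n by blast
    have "under (\<Union>i<n. U i) g"
      using c(1) c(4) Cn unfolding under_def by blast
    then have "I g \<le> (\<Sum>i<n. lam (U i))"
      using lam_finite_Union[of U n] U le_lam by force
    also have "\<dots> \<le> (\<Sum>i. lam (U i))"
      using s lam_nonneg by (intro sum_le_suminf) auto
    finally show "I f \<le> (\<Sum>i. lam (U i)) + e" using c(2) by linarith
  qed
  then have "ennreal (lam (\<Union>i. U i)) \<le> ennreal ((\<Sum>i. lam (U i)) + e)"
    by (rule ennreal_leI)
  also have "\<dots> = ennreal (\<Sum>i. lam (U i)) + ennreal e"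
    using e s lam_nonneg by (intro ennreal_plus suminf_nonneg) auto
  also have "ennreal (\<Sum>i. lam (U i)) = (\<Sum>i. ennreal (lam (U i)))"
    using s lam_nonneg by (intro suminf_ennreal2[symmetric]) auto
  finally show "ennreal (lam (\<Union>i. U i)) \<le> (\<Sum>i. ennreal (lam (U i))) + ennreal e" .
qed

definition outer :: "'y set \<Rightarrow> real" where
  "outer E = Inf (lam ` {U. openin Y U \<and> E \<subseteq> U})"

lemma outer_le: "openin Y U \<Longrightarrow> E \<subseteq> U \<Longrightarrow> outer E \<le> lam U"
  unfolding outer_def using lam_nonneg by (intro cInf_lower) (auto intro!: bdd_belowI[of _ 0])

lemma le_outer: "E \<subseteq> T \<Longrightarrow> (\<And>U. openin Y U \<Longrightarrow> E \<subseteq> U \<Longrightarrow> c \<le> lam U) \<Longrightarrow> c \<le> outer E"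
  unfolding outer_def by (intro cInf_greatest) auto

lemma outer_nonneg: "E \<subseteq> T \<Longrightarrow> 0 \<le> outer E"
  by (rule le_outer) (auto intro: lam_nonneg)

lemma outer_open: "openin Y U \<Longrightarrow> outer U = lam U"
  by (intro antisym outer_le le_outer) (auto intro: lam_mono openin_subset[THEN subsetD])

lemma outer_mono: "E \<subseteq> E' \<Longrightarrow> E' \<subseteq> T \<Longrightarrow> outer E \<le> outer E'"
  by (rule le_outer) (auto intro: outer_le)

lemma outer_approx:
  assumes "E \<subseteq> T" "0 < e"
  obtains U where "openin Y U" "E \<subseteq> U" "lam U < outer E + e"
  using le_outer[of E "outer E + e"] assms by (metis add_le_same_cancel1 not_le)

lemma outer_measure_space_outer: "outer_measure_space (Pow T) (\<lambda>E. ennreal (outer E))"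
  unfolding outer_measure_space_def
proof (intro conjI)
  show "positive (Pow T) (\<lambda>E. ennreal (outer E))"
    using outer_open[of "{}"] lam_empty by (simp add: positive_def)
  show "increasing (Pow T) (\<lambda>E. ennreal (outer E))"
    unfolding increasing_def by (auto intro!: ennreal_leI outer_mono)
  show "countably_subadditive (Pow T) (\<lambda>E. ennreal (outer E))"
    unfolding countably_subadditive_def
  proof (intro allI impI)
    fix A :: "nat \<Rightarrow> 'y set" assume A: "range A \<subseteq> Pow T"
    show "ennreal (outer (\<Union>i. A i)) \<le> (\<Sum>i. ennreal (outer (A i)))"
    proof (rule ennreal_le_epsilon)
      fix e :: real assume e: "0 < e"
      \<comment> \<open>The enlargement of \<open>A n\<close> may cost e * 2^-(n + 1), which sums to
        e.\<close>
      have "\<exists>U. openin Y U \<and> A n \<subseteq> U \<and> lam U < outer (A n) + e * (1/2)^Suc n" for n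
      proof -
        have "A n \<subseteq> T" "0 < e * (1/2)^Suc n" using A e by auto
        then show ?thesis by (rule outer_approx) blast
      qed
      then obtain U where U: "\<And>n. openin Y (U n)" "\<And>n. A n \<subseteq> U n"
        "\<And>n. lam (U n) < outer (A n) + e * (1/2)^Suc n" by metis
      have An: "0 \<le> outer (A n)" for n using A outer_nonneg by blast
      have "ennreal (outer (\<Union>i. A i)) \<le> ennreal (lam (\<Union>i. U i))"
        using U by (intro ennreal_leI outer_le) (auto intro: openin_Union)
      also have "\<dots> \<le> (\<Sum>i. ennreal (lam (U i)))"
        by (rule lam_Union[OF U(1)])
      also have "\<dots> \<le> (\<Sum>n. ennreal (outer (A n)) + ennreal e * ennreal ((1/2) ^ Suc n))"
      proof (rule suminf_le)
        show "ennreal (lam (U n)) \<le> ennreal (outer (A n)) + ennreal e * ennreal ((1/2) ^ Suc n)" for n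
          using ennreal_leI[OF less_imp_le[OF U(3)[of n]]] An e
          by (simp add: ennreal_plus[symmetric] ennreal_mult[symmetric] del: ennreal_plus)
      qed auto
      also have "\<dots> = (\<Sum>n. ennreal (outer (A n))) + (\<Sum>n. ennreal e * ennreal ((1/2) ^ Suc n))"
        by (rule suminf_add[symmetric]) auto
      also have "(\<Sum>n. ennreal e * ennreal ((1/2) ^ Suc n)) = ennreal e"
        unfolding ennreal_suminf_cmult
        by (subst suminf_ennreal_eq[OF zero_le_power power_half_series]) auto
      finally show "ennreal (outer (\<Union>i. A i)) \<le> (\<Sum>i. ennreal (outer (A i))) + ennreal e" .
    qed
  qed
qed

text \<open>Caratheodory's criterion. Let V be an open set containing E, let f be under U \<inter> V
  and let C be the closed set off which the cut function g vanishes. Any h under V - C can be added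
  to g and the sum stays under V, while V - C still contains E - U.\<close>

lemma open_lambda_system:
  assumes U: "openin Y U"
  shows "U \<in> lambda_system T (Pow T) (\<lambda>E. ennreal (outer E))"
proof -
  have UT: "U \<subseteq> T" using U by (rule openin_subset)
  have ge: "outer (U \<inter> E) + outer ((T - U) \<inter> E) \<le> outer E" if E: "E \<subseteq> T" for E
  proof (rule le_outer[OF E])
    fix V assume V: "openin Y V" "E \<subseteq> V"
    define r where "r = outer ((T - U) \<inter> E)"
    have "lam (U \<inter> V) \<le> lam V - r"
    proof (rule lam_le, rule field_le_epsilon)
      fix f and e :: real assume f: "under (U \<inter> V) f" and e: "0 < e"
      define g where "g y = max 0 (f y - e)" for y
      define C where "C = {y \<in> T. e \<le> f y}"
      note c = under_cut[OF f e, folded g_def C_def]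
      have CU: "C \<subseteq> U" using f e by (force simp: under_def C_def)
      have W: "openin Y (V - C)" using V(1) c(3) by (rule openin_diff)
      have "(T - U) \<inter> E \<subseteq> V - C" using V(2) CU by blast
      then have "r \<le> lam (V - C)" unfolding r_def using W by (rule outer_le[rotated])
      also have "lam (V - C) \<le> lam V - I g"
      proof (rule lam_le)
        fix h assume h: "under (V - C) h"
        have "under V (\<lambda>y. h y + g y)"
          unfolding under_def
        proof (intro conjI ballI)
          show "cont (\<lambda>y. h y + g y)" using h c(1) by (auto simp: under_def intro!: continuous_intros)
          show "0 \<le> h y + g y" if "y \<in> T" for y using that h c(1) by (simp add: under_def)
          show "h y + g y \<le> 1" if "y \<in> T" for y
            using that h c(1) c(4)[OF that] by (cases "y \<in> C") (auto simp: under_def)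
          show "h y + g y = 0" if "y \<in> T - V" for y
            using that h c(1) by (auto simp: under_def)
        qed
        then have "I (\<lambda>y. h y + g y) \<le> lam V" by (rule le_lam)
        moreover have "I (\<lambda>y. h y + g y) = I h + I g"
          using h c(1) by (intro I_add) (auto simp: under_def)
        ultimately show "I h \<le> lam V - I g" by linarith
      qed
      finally show "I f \<le> lam V - r + e" using c(2) by linarith
    qed
    moreover have "outer (U \<inter> E) \<le> lam (U \<inter> V)"
      using U V by (intro outer_le) auto
    ultimately show "outer (U \<inter> E) + outer ((T - U) \<inter> E) \<le> lam V"
      unfolding r_def by linarith
  qed
  interpret P: sigma_algebra T "Pow T" by (rule sigma_algebra_Pow)
  have sub: "subadditive (Pow T) (\<lambda>E. ennreal (outer E))"
    using P.countably_subadditive_subadditive outer_measure_space_outer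
    unfolding outer_measure_space_def by blast
  have le: "ennreal (outer E) \<le> ennreal (outer (U \<inter> E)) + ennreal (outer ((T - U) \<inter> E))" if "E \<subseteq> T" for E
  proof -
    have "E = (U \<inter> E) \<union> ((T - U) \<inter> E)" using that by blast
    moreover have "(U \<inter> E) \<inter> ((T - U) \<inter> E) = {}" "U \<inter> E \<in> Pow T" "(T - U) \<inter> E \<in> Pow T"
      using that by auto
    ultimately show ?thesis using subadditiveD[OF sub] by metis
  qed
  have "ennreal (outer (U \<inter> E)) + ennreal (outer ((T - U) \<inter> E)) = ennreal (outer E)" if E: "E \<subseteq> T" for E
  proof (rule antisym[OF _ le[OF E]])
    have "U \<inter> E \<subseteq> T" "(T - U) \<inter> E \<subseteq> T" using E by auto
    then show "ennreal (outer (U \<inter> E)) + ennreal (outer ((T - U) \<inter> E)) \<le> ennreal (outer E)"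
      using ennreal_leI[OF ge[OF E]] outer_nonneg by (simp add: ennreal_plus[symmetric] del: ennreal_plus)
  qed
  then show ?thesis
    unfolding lambda_system_def using UT by simp
qed

definition riesz_measure :: "'y measure" where
  "riesz_measure = measure_of T {U. openin Y U} (\<lambda>E. ennreal (outer E))"

lemma sets_riesz: "sets riesz_measure = sigma_sets T {U. openin Y U}"
  unfolding riesz_measure_def by (rule sets_measure_of) (auto dest: openin_subset)

lemma space_riesz: "space riesz_measure = T"
  unfolding riesz_measure_def by (rule space_measure_of) (auto dest: openin_subset)

lemma sigma_sets_T: "A \<in> sets riesz_measure \<Longrightarrow> A \<subseteq> T"
  using sets.sets_into_space[of A riesz_measure] by (simp add: space_riesz)

text \<open>By \<open>open_lambda_system\<close> the sigma-algebra of Caratheodory measurable sets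
  contains the Borel sets, and the outer measure is countably additive on it.\<close>

lemma emeasure_riesz: "A \<in> sets riesz_measure \<Longrightarrow> emeasure riesz_measure A = ennreal (outer A)"
proof -
  assume A: "A \<in> sets riesz_measure"
  interpret P: sigma_algebra T "Pow T" by (rule sigma_algebra_Pow)
  have m: "measure_space T (lambda_system T (Pow T) (\<lambda>E. ennreal (outer E))) (\<lambda>E. ennreal (outer E))"
    by (rule P.caratheodory_lemma[OF outer_measure_space_outer])
  have "sigma_algebra T (lambda_system T (Pow T) (\<lambda>E. ennreal (outer E)))"
    using m[unfolded measure_space_def] by (rule conjunct1)
  then have "sigma_sets T {U. openin Y U} \<subseteq> lambda_system T (Pow T) (\<lambda>E. ennreal (outer E))"
    using open_lambda_system by (intro sigma_algebra.sigma_sets_subset) auto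
  moreover have sa: "sigma_algebra T (sigma_sets T {U. openin Y U})"
    by (rule sigma_algebra_sigma_sets) (auto dest: openin_subset)
  ultimately have "measure_space T (sigma_sets T {U. openin Y U}) (\<lambda>E. ennreal (outer E))"
    using measure_down[OF m sa] by blast
  then show ?thesis
    using A unfolding sets_riesz
    by (intro emeasure_measure_of[OF riesz_measure_def])
      (auto simp: measure_space_def sets_riesz dest: openin_subset)
qed

lemma measure_riesz: "A \<in> sets riesz_measure \<Longrightarrow> measure riesz_measure A = outer A"
  using emeasure_riesz outer_nonneg[OF sigma_sets_T] by (simp add: measure_def)

lemma open_sets_riesz: "openin Y U \<Longrightarrow> U \<in> sets riesz_measure"
  unfolding sets_riesz by (rule sigma_sets.Basic) simp

lemma prob_space_riesz: "prob_space riesz_measure"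
proof
  show "emeasure riesz_measure (space riesz_measure) = 1"
    using emeasure_riesz[OF open_sets_riesz[OF openin_topspace]] outer_open[OF openin_topspace] lam_top
    by (simp add: space_riesz)
qed

text \<open>Inner regularity of B is outer regularity of its complement, since complements of open
  sets are compact here.\<close>

lemma riesz_prob_measures: "riesz_measure \<in> prob_measures Y"
proof -
  interpret prob_space riesz_measure by (rule prob_space_riesz)
  have "\<exists>K. compactin Y K \<and> K \<subseteq> B \<and> measure riesz_measure B < measure riesz_measure K + e"
    if B: "B \<in> sets riesz_measure" and e: "0 < e" for B e
  proof -
    have B': "T - B \<in> sets riesz_measure" using sets.compl_sets[OF B] by (simp add: space_riesz)
    obtain U where U: "openin Y U" "T - B \<subseteq> U" "lam U < outer (T - B) + e"
      using outer_approx[of "T - B" e] e by auto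
    have cl: "closedin Y (T - U)" using U(1) by (intro closedin_diff closedin_topspace)
    then have "compactin Y (T - U)" using compact by (rule closedin_compact_space[rotated])
    moreover have "T - U \<subseteq> B" using U(2) by blast
    moreover have "measure riesz_measure (T - U) = 1 - lam U"
      using prob_compl[OF open_sets_riesz[OF U(1)]] measure_riesz[OF open_sets_riesz[OF U(1)]] outer_open[OF U(1)]
      by (simp add: space_riesz)
    moreover have "measure riesz_measure B = 1 - outer (T - B)"
      using prob_compl[OF B'] measure_riesz[OF B'] sigma_sets_T[OF B] by (simp add: space_riesz double_diff)
    ultimately show ?thesis using U(3) by (intro exI[of _ "T - U"]) auto
  qed
  then show ?thesis
    unfolding prob_measures_def using prob_space_riesz
    by (auto simp: sets_riesz sets_borel_sigma)
qed

section \<open>Integration against the Riesz measure\<close>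

lemma measurable_cont: "cont u \<Longrightarrow> u \<in> borel_measurable riesz_measure"
proof (rule borel_measurableI)
  fix S :: "real set" assume u: "cont u" and "open S"
  then have "openin Y {y \<in> T. u y \<in> S}" by (intro openin_continuous_map_preimage[OF u]) simp
  moreover have "{y \<in> T. u y \<in> S} = u -` S \<inter> space riesz_measure" by (auto simp: space_riesz)
  ultimately show "u -` S \<inter> space riesz_measure \<in> sets riesz_measure" using open_sets_riesz by simp
qed

lemma cont_bounded:
  assumes "cont u"
  obtains B where "0 < B" "\<And>y. y \<in> T \<Longrightarrow> \<bar>u y\<bar> \<le> B"
proof -
  have "compactin euclideanreal (u ` T)"
    using assms compact by (intro image_compactin) (auto simp: compact_space_def)
  then have "bounded (u ` T)" by (simp add: compact_imp_bounded)
  then obtain B where "\<forall>y\<in>T. \<bar>u y\<bar> \<le> B" by (auto simp: bounded_iff)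
  then show thesis using that[of "max B 1"] by fastforce
qed

lemma integrable_cont: "cont u \<Longrightarrow> integrable riesz_measure u"
proof -
  assume u: "cont u"
  interpret prob_space riesz_measure by (rule prob_space_riesz)
  obtain B where B: "0 < B" "\<And>y. y \<in> T \<Longrightarrow> \<bar>u y\<bar> \<le> B" using cont_bounded[OF u] by blast
  show ?thesis
    using measurable_cont[OF u] B by (intro integrable_const_bound[of _ B]) (auto simp: space_riesz)
qed

text \<open>Slicing \<open>u\<close> into layers of height \<open>1/n\<close>: each layer is bounded above by the measure of the
  superlevel set at its base and below by that of the superlevel set at its top.\<close>

lemma I_le_integral:
  assumes u: "cont u" and u01: "\<And>y. y \<in> T \<Longrightarrow> 0 \<le> u y \<and> u y \<le> 1"
  shows "I u \<le> (\<integral>y. u y \<partial>riesz_measure)"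
proof (rule field_le_epsilon)
  interpret prob_space riesz_measure by (rule prob_space_riesz)
  fix e :: real assume "0 < e"
  then obtain m :: nat where m: "1 / real (Suc m) < e"
    by (rule nat_approx_posE)
  define n where "n = Suc m"
  have n0: "0 < real n" by (simp add: n_def)
  \<comment> \<open>The part of the graph of u between the heights i/n and (i + 1)/n.\<close>
  define l where "l i y = min (1 / n) (max 0 (u y - i / n))" for i :: nat and y
  have lc: "cont (l i)" for i
    unfolding l_def using u by (intro continuous_map_real_min continuous_map_real_max continuous_map_diff) auto
  have step: "min a x + min d (max 0 (x - a)) = min (a + d) x" if "0 < d" for a d x :: real
    using that by (auto simp: min_def max_def)
  have partial: "(\<Sum>i<k. l i y) = min (k / n) (u y)" if "y \<in> T" for k y
  proof (induction k)
    case (Suc k)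
    have "(\<Sum>i<Suc k. l i y) = min (k / n) (u y) + min (1 / n) (max 0 (u y - k / n))"
      using Suc by (simp add: l_def)
    also have "\<dots> = min (k / n + 1 / n) (u y)"
      using n0 by (intro step) auto
    finally show ?case by (simp add: add_divide_distrib add.commute)
  qed (use u01[OF that] in simp)
  then have total: "(\<Sum>i<n. l i y) = u y" if "y \<in> T" for y
    using that u01[OF that] n0 by simp
  define U where "U i = {y \<in> T. i / n < u y}" for i :: nat
  have Uo: "openin Y (U i)" for i
    using openin_continuous_map_preimage[OF u, of "{i / n<..}"] by (simp add: U_def)
  have Il: "I (l i) \<le> lam (U i) / n" for i
  proof -
    have "under (U i) (\<lambda>y. n * l i y)"
      unfolding under_def
    proof (intro conjI ballI)
      show "cont (\<lambda>y. n * l i y)" using lc by (intro continuous_map_real_mult) auto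
      have nl: "n * l i y = min 1 (max 0 (n * u y - i))" for y
      proof -
        have mono: "mono (\<lambda>x. real n * x)" using n0 by (auto intro!: monoI mult_left_mono)
        have "n * l i y = min (n * (1 / n)) (max (real n * 0) (n * (u y - i / n)))"
          unfolding l_def by (simp only: min_of_mono[OF mono] max_of_mono[OF mono])
        then show ?thesis using n0 by (simp add: right_diff_distrib)
      qed
      show "0 \<le> n * l i y" "n * l i y \<le> 1" for y unfolding nl by auto
      show "n * l i y = 0" if "y \<in> T - U i" for y
        using that n0 unfolding nl by (auto simp: U_def field_simps)
    qed
    then have "I (\<lambda>y. n * l i y) \<le> lam (U i)" by (rule le_lam)
    then show ?thesis using I_scale[OF lc, of "real n" i] n0 by (simp add: field_simps)
  qed
  have li: "lam (U (Suc i)) / n \<le> (\<integral>y. l i y \<partial>riesz_measure)" for i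
  proof -
    have "lam (U (Suc i)) / n = (\<integral>y. indicator (U (Suc i)) y / n \<partial>riesz_measure)"
      using measure_riesz[OF open_sets_riesz[OF Uo]] outer_open[OF Uo] open_sets_riesz[OF Uo]
        sets.sets_into_space[OF open_sets_riesz[OF Uo]]
      by (simp add: Int_absorb2)
    also have "\<dots> \<le> (\<integral>y. l i y \<partial>riesz_measure)"
    proof (rule integral_mono)
      show "integrable riesz_measure (\<lambda>y. indicator (U (Suc i)) y / real n)"
        using open_sets_riesz[OF Uo] by (auto intro!: integrable_divide integrable_real_indicator simp: emeasure_eq_measure)
      show "integrable riesz_measure (l i)" by (rule integrable_cont[OF lc])
      fix y assume "y \<in> space riesz_measure"
      show "indicator (U (Suc i)) y / real n \<le> l i y"
        using n0 by (auto simp: indicator_def U_def l_def add_divide_distrib)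
    qed
    finally show ?thesis .
  qed
  have "I u \<le> I (\<lambda>y. \<Sum>i<n. l i y)"
    using total lc u by (intro I_mono continuous_map_sum) auto
  also have "\<dots> = (\<Sum>i<n. I (l i))" by (rule I_sum[OF lc])
  also have "\<dots> \<le> (\<Sum>i<n. lam (U i) / n)" by (intro sum_mono Il)
  \<comment> \<open>The upper bound for layer i + 1 and the lower bound for layer i use the same
    superlevel set, so shifting the index by one loses only the bottom layer, which is at most
    1/n.\<close>
  also have "\<dots> = lam (U 0) / n + (\<Sum>i<m. lam (U (Suc i)) / n)"
    unfolding n_def by (rule sum.lessThan_Suc_shift)
  also have "\<dots> \<le> 1 / n + (\<Sum>i<m. \<integral>y. l i y \<partial>riesz_measure)"
    using n0 by (intro add_mono sum_mono li divide_right_mono lam_le_1) auto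
  also have "(\<Sum>i<m. \<integral>y. l i y \<partial>riesz_measure) = (\<integral>y. (\<Sum>i<m. l i y) \<partial>riesz_measure)"
    by (intro Bochner_Integration.integral_sum[symmetric] integrable_cont lc)
  also have "\<dots> \<le> (\<integral>y. u y \<partial>riesz_measure)"
    using partial by (intro integral_mono integrable_cont u continuous_map_sum lc) (auto simp: space_riesz)
  finally show "I u \<le> (\<integral>y. u y \<partial>riesz_measure) + e" using m by (simp add: n_def)
qed

text \<open>The reverse inequality is \<open>I_le_integral\<close> for 1 - v. An affine change
  brings a general u between 0 and 1, where B is a bound for |u|.\<close>

lemma I_eq_integral:
  assumes u: "cont u"
  shows "I u = (\<integral>y. u y \<partial>riesz_measure)"
proof -
  interpret prob_space riesz_measure by (rule prob_space_riesz)
  have eq01: "I v = (\<integral>y. v y \<partial>riesz_measure)"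
    if v: "cont v" and v01: "\<And>y. y \<in> T \<Longrightarrow> 0 \<le> v y \<and> v y \<le> 1" for v
  proof (rule antisym)
    show "I v \<le> (\<integral>y. v y \<partial>riesz_measure)" by (rule I_le_integral[OF v v01])
    have c: "cont (\<lambda>y. - 1 * v y)" "cont (\<lambda>y. 1 + - 1 * v y)"
      using v by (auto intro!: continuous_intros)
    have "I (\<lambda>y. 1 + - 1 * v y) \<le> (\<integral>y. 1 + - 1 * v y \<partial>riesz_measure)"
      using v01 by (intro I_le_integral c) auto
    also have "\<dots> = 1 - (\<integral>y. v y \<partial>riesz_measure)"
      using integrable_cont[OF v] by (simp add: prob_space)
    also have "I (\<lambda>y. 1 + - 1 * v y) = 1 - I v"
      using I_add[OF _ c(1), of "\<lambda>_. 1"] I_scale[OF v, of "-1"] I_one by simp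
    finally show "(\<integral>y. v y \<partial>riesz_measure) \<le> I v" by simp
  qed
  obtain B where B: "0 < B" "\<And>y. y \<in> T \<Longrightarrow> \<bar>u y\<bar> \<le> B" using cont_bounded[OF u] by blast
  define v where "v y = (1 / (2 * B)) * (u y + B)" for y
  have v: "cont v" unfolding v_def using u B(1) by (auto intro!: continuous_intros)
  have v01: "0 \<le> v y \<and> v y \<le> 1" if "y \<in> T" for y
    using B(1) B(2)[OF that] by (auto simp: v_def field_simps)
  have uB: "cont (\<lambda>y. u y + B)" using u by (auto intro!: continuous_intros)
  have "I v = (1 / (2 * B)) * (I u + B)"
    unfolding v_def I_scale[OF uB] using I_add[OF u, of "\<lambda>_. B"] I_const by simp
  moreover have "(\<integral>y. v y \<partial>riesz_measure) = (1 / (2 * B)) * ((\<integral>y. u y \<partial>riesz_measure) + B)"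
    unfolding v_def using integrable_cont[OF u] by (simp add: prob_space)
  ultimately show ?thesis using eq01[OF v v01] B(1) by simp
qed

end

lemma continuous_functions_measurable:
  assumes "f \<in> continuous_functions Y" "sets \<mu> = sets (borel_sigma Y)"
  shows "f \<in> borel_measurable \<mu>"
proof (rule borel_measurableI)
  fix S :: "complex set" assume "open S"
  have sp: "space \<mu> = topspace Y"
    using sets_eq_imp_space_eq[OF assms(2)] by simp
  have "openin Y {y \<in> topspace Y. f y \<in> S}"
    using assms(1) \<open>open S\<close> by (intro openin_continuous_map_preimage[of Y euclidean]) (auto simp: continuous_functions_def)
  moreover have "{y \<in> topspace Y. f y \<in> S} = f -` S \<inter> space \<mu>" by (auto simp: sp)
  ultimately show "f -` S \<inter> space \<mu> \<in> sets \<mu>"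
    unfolding assms(2) sets_borel_sigma by (simp add: sigma_sets.Basic)
qed

lemma riesz_representation:
  fixes L :: "('y \<Rightarrow> complex) \<Rightarrow> complex"
  assumes Y: "compact_space Y" "Hausdorff_space Y"
    and add: "\<And>f g. f \<in> continuous_functions Y \<Longrightarrow> g \<in> continuous_functions Y \<Longrightarrow>
      L (\<lambda>y. f y + g y) = L f + L g"
    and scale: "\<And>c f. f \<in> continuous_functions Y \<Longrightarrow> L (\<lambda>y. c * f y) = c * L f"
    and one: "L (\<lambda>y. if y \<in> topspace Y then 1 else 0) = 1"
    and pos: "\<And>f. f \<in> continuous_functions Y \<Longrightarrow> (\<And>y. Im (f y) = 0 \<and> 0 \<le> Re (f y)) \<Longrightarrow>
      Im (L f) = 0 \<and> 0 \<le> Re (L f)"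
  obtains \<mu> where "\<mu> \<in> prob_measures Y" "\<And>f. f \<in> continuous_functions Y \<Longrightarrow> L f = (\<integral>y. f y \<partial>\<mu>)"
proof -
  interpret C: fun_alg "topspace Y" "continuous_functions Y"
    using fun_alg_continuous_functions[OF Y(1)] .
  define cx where "cx u y = (if y \<in> topspace Y then complex_of_real (u y) else 0)" for u and y
  define J where "J u = Re (L (cx u))" for u
  have cx_in: "cx u \<in> continuous_functions Y" if "continuous_map Y euclideanreal u" for u
    using continuous_functions_of_real[OF that] by (simp add: cx_def[abs_def])
  interpret positive_functional Y J
  proof
    fix u v :: "'y \<Rightarrow> real" and c assume u: "continuous_map Y euclideanreal u"
    have "cx (\<lambda>y. c * u y) = (\<lambda>y. of_real c * cx u y)" by (auto simp: cx_def)
    then show "J (\<lambda>y. c * u y) = c * J u" using scale[OF cx_in[OF u]] by (simp add: J_def)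
    show "0 \<le> J u" if "\<And>y. y \<in> topspace Y \<Longrightarrow> 0 \<le> u y"
      using pos[OF cx_in[OF u]] that by (auto simp: J_def cx_def)
    assume v: "continuous_map Y euclideanreal v"
    have "cx (\<lambda>y. u y + v y) = (\<lambda>y. cx u y + cx v y)" by (auto simp: cx_def)
    then show "J (\<lambda>y. u y + v y) = J u + J v" using add[OF cx_in[OF u] cx_in[OF v]] by (simp add: J_def)
  next
    show "J (\<lambda>y. 1) = 1" by (simp add: J_def cx_def[abs_def] one cong: if_cong)
  qed (use Y in auto)
  \<comment> \<open>The hypothesis \<open>pos\<close> concerns nonnegative functions, so u is
    shifted by a bound B first.\<close>
  have real: "Im (L (cx u)) = 0" if u: "continuous_map Y euclideanreal u" for u
  proof -
    obtain B where B: "0 < B" "\<And>y. y \<in> topspace Y \<Longrightarrow> \<bar>u y\<bar> \<le> B" using cont_bounded[OF u] by blast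
    have uB: "continuous_map Y euclideanreal (\<lambda>y. u y + B)" using u by (auto intro!: continuous_intros)
    have "0 \<le> u y + B" if "y \<in> topspace Y" for y using B(2)[OF that] by linarith
    then have "Im (L (cx (\<lambda>y. u y + B))) = 0"
      using pos[OF cx_in[OF uB]] by (auto simp: cx_def)
    moreover have "cx (\<lambda>y. u y + B) = (\<lambda>y. cx u y + of_real B * (if y \<in> topspace Y then 1 else 0))"
      by (auto simp: cx_def)
    ultimately show ?thesis
      using add[OF cx_in[OF u] C.scale_in[OF C.one_in]] scale[OF C.one_in] one by simp
  qed
  show thesis
  proof (rule that[OF riesz_prob_measures])
    fix f assume f: "f \<in> continuous_functions Y"
    have fc: "continuous_map Y euclidean f" using f by (simp add: continuous_functions_def)
    have re: "continuous_map Y euclideanreal (\<lambda>y. Re (f y))" and im: "continuous_map Y euclideanreal (\<lambda>y. Im (f y))"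
      by (rule continuous_map_compose_continuous_on[OF fc], intro continuous_intros)+
    have Lr: "L (cx u) = of_real (\<integral>y. u y \<partial>riesz_measure)" if "continuous_map Y euclideanreal u" for u
    proof (rule complex_eqI)
      show "Re (L (cx u)) = Re (of_real (\<integral>y. u y \<partial>riesz_measure))"
        unfolding Re_complex_of_real using I_eq_integral[OF that] by (simp only: J_def)
      show "Im (L (cx u)) = Im (of_real (\<integral>y. u y \<partial>riesz_measure))"
        unfolding Im_complex_of_real by (rule real[OF that])
    qed
    have f_eq: "f y = cx (\<lambda>y. Re (f y)) y + \<i> * cx (\<lambda>y. Im (f y)) y" for y
    proof (cases "y \<in> topspace Y")
      case True
      show ?thesis unfolding cx_def if_P[OF True] by (rule complex_eq)
    next
      case False
      show ?thesis unfolding cx_def if_not_P[OF False] using C.vanish[OF f False] by simp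
    qed
    have "f = (\<lambda>y. cx (\<lambda>y. Re (f y)) y + \<i> * cx (\<lambda>y. Im (f y)) y)"
      by (rule ext) (rule f_eq)
    then have "L f = L (\<lambda>y. cx (\<lambda>y. Re (f y)) y + \<i> * cx (\<lambda>y. Im (f y)) y)"
      by (rule arg_cong)
    also have "\<dots> = L (cx (\<lambda>y. Re (f y))) + \<i> * L (cx (\<lambda>y. Im (f y)))"
      by (simp add: add scale cx_in re im C.scale_in)
    also have "\<dots> = of_real (\<integral>y. Re (f y) \<partial>riesz_measure) + \<i> * of_real (\<integral>y. Im (f y) \<partial>riesz_measure)"
      by (simp add: Lr re im)
    also have "\<dots> = (\<integral>y. f y \<partial>riesz_measure)"
    proof -
      have "integrable riesz_measure (\<lambda>y. complex_of_real (Re (f y)) + \<i> * complex_of_real (Im (f y)))"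
        by (intro Bochner_Integration.integrable_add integrable_mult_right integrable_of_real integrable_cont re im)
      then have "integrable riesz_measure f" unfolding complex_eq[symmetric] .
      then show ?thesis by (simp add: complex_eq_iff)
    qed
    finally show "L f = (\<integral>y. f y \<partial>riesz_measure)" .
  qed
qed


section \<open>Measures on fibres and maps dual to ucp maps\<close>

lemma prob_measuresD:
  assumes "\<mu> \<in> prob_measures Y"
  shows "prob_space \<mu>" "sets \<mu> = sets (borel_sigma Y)" "space \<mu> = topspace Y"
    "\<And>B e. B \<in> sets \<mu> \<Longrightarrow> e > 0 \<Longrightarrow> \<exists>K. compactin Y K \<and> K \<subseteq> B \<and> measure \<mu> B < measure \<mu> K + e"
  using assms sets_eq_imp_space_eq[of \<mu> "borel_sigma Y"] by (auto simp: prob_measures_def)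

lemma sets_borel_open: "openin Y U \<Longrightarrow> U \<in> sets (borel_sigma Y)"
  unfolding sets_borel_sigma by (rule sigma_sets.Basic) simp

lemma sets_borel_closed: "closedin Y C \<Longrightarrow> C \<in> sets (borel_sigma Y)"
proof -
  assume "closedin Y C"
  then have "topspace Y - (topspace Y - C) = C" "openin Y (topspace Y - C)"
    using closedin_subset by (auto simp: closedin_def)
  then show ?thesis
    using sets.compl_sets[OF sets_borel_open, of Y "topspace Y - C"] by simp
qed

lemma continuous_map_measurable:
  assumes f: "continuous_map X Y f" and M: "sets M = sets (borel_sigma X)"
  shows "f \<in> measurable M (borel_sigma Y)"
  unfolding borel_sigma_def
proof (rule measurable_measure_of)
  have sp: "space M = topspace X" using sets_eq_imp_space_eq[OF M] by simp
  show "f \<in> space M \<rightarrow> topspace Y"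
    using continuous_map_image_subset_topspace[OF f] by (auto simp: sp)
  fix U assume "U \<in> {U. openin Y U}"
  then have "openin X {x \<in> topspace X. f x \<in> U}" using openin_continuous_map_preimage[OF f] by simp
  moreover have "{x \<in> topspace X. f x \<in> U} = f -` U \<inter> space M" by (auto simp: sp)
  ultimately show "f -` U \<inter> space M \<in> sets M" unfolding M using sets_borel_open by metis
qed (auto dest: openin_subset)

lemma continuous_functions_integrable:
  assumes Y: "compact_space Y" and \<mu>: "\<mu> \<in> prob_measures Y" and f: "f \<in> continuous_functions Y"
  shows "integrable \<mu> f"
proof -
  interpret prob_space \<mu> using prob_measuresD[OF \<mu>] by blast
  interpret C: fun_alg "topspace Y" "continuous_functions Y" by (rule fun_alg_continuous_functions[OF Y])
  obtain B where "\<And>y. cmod (f y) \<le> B" using C.bound_ex[OF f] by blast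
  then show ?thesis
    using continuous_functions_measurable[OF f prob_measuresD(2)[OF \<mu>]]
    by (intro integrable_const_bound[of _ B]) auto
qed

lemma measure_dirac:
  assumes "y \<in> topspace Y" "B \<in> sets (borel_sigma Y)"
  shows "measure (dirac Y y) B = indicator B y"
  using assms unfolding dirac_def by (intro measure_return)

lemma dirac_prob_measures:
  assumes H: "Hausdorff_space Y" and y: "y \<in> topspace Y"
  shows "dirac Y y \<in> prob_measures Y"
proof -
  have p: "prob_space (dirac Y y)"
    unfolding dirac_def using y by (intro prob_space_return) simp
  have s: "sets (dirac Y y) = sets (borel_sigma Y)" by (simp add: dirac_def)
  have ys: "{y} \<in> sets (borel_sigma Y)"
    using H y by (intro sets_borel_closed closedin_Hausdorff_singleton)
  have "\<exists>K. compactin Y K \<and> K \<subseteq> B \<and> measure (dirac Y y) B < measure (dirac Y y) K + e"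
    if B: "B \<in> sets (borel_sigma Y)" and e: "e > 0" for B e
  proof (cases "y \<in> B")
    case True
    then show ?thesis using measure_dirac[OF y ys] measure_dirac[OF y B] e y
      by (intro exI[of _ "{y}"]) (simp add: compactin_sing)
  next
    case False
    then show ?thesis using measure_dirac[OF y B] e by (intro exI[of _ "{}"]) simp
  qed
  then show ?thesis
    using p s unfolding prob_measures_def by simp
qed

lemma integral_dirac:
  assumes "y \<in> topspace Y" "f \<in> continuous_functions Y"
  shows "(\<integral>z. f z \<partial>dirac Y y) = f y"
  unfolding dirac_def using assms
  by (intro integral_return continuous_functions_measurable) auto

lemma continuous_functions_separate:
  assumes "compact_space Y" "Hausdorff_space Y" "closedin Y C" "y \<in> topspace Y" "y \<notin> C"
  obtains u where "continuous_map Y euclideanreal u" "\<And>z. z \<in> topspace Y \<Longrightarrow> 0 \<le> u z" "\<And>z. z \<in> C \<Longrightarrow> u z = 0"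
    "u y = 1"
proof -
  have n: "normal_space Y"
    using assms(1,2) by (rule compact_Hausdorff_or_regular_imp_normal_space[OF _ disjI1])
  obtain f where f: "continuous_map Y (top_of_set {0..1::real}) f" "f ` C \<subseteq> {0}" "f ` {y} \<subseteq> {1}"
    using Urysohn_lemma[OF n assms(3) closedin_Hausdorff_singleton[OF assms(2,4)], of 0 1] assms(5)
    by (auto simp: disjnt_def)
  show thesis
    using that[of f] continuous_map_into_fulltopology[OF f(1)] continuous_map_image_subset_topspace[OF f(1)] f(2,3)
    by (auto simp: image_subset_iff)
qed

section \<open>Measures on fibres and their translates by arrows\<close>

context compact_galg
begin

abbreviation "P \<equiv> prob_measures (sptop Y)"
abbreviation "CY \<equiv> continuous_functions (sptop Y)"

definition fibre :: "'g \<Rightarrow> 'y set" where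
  "fibre x = {y \<in> topspace (sptop Y). proj Y y = x}"

lemma fibre_closed: "x \<in> units G \<Longrightarrow> closedin (sptop Y) (fibre x)"
  using closedin_continuous_map_preimage[OF continuous_proj closedin_Hausdorff_singleton[OF Hausdorff_units, of x]]
  by (simp add: fibre_def)

lemma fibre_sets: "x \<in> units G \<Longrightarrow> \<mu> \<in> P \<Longrightarrow> fibre x \<in> sets \<mu>"
  using sets_borel_closed[OF fibre_closed] prob_measuresD(2) by blast

text \<open>The almost-everywhere form of the condition that the push-forward to the units is the
  Dirac measure at x, see \<open>over_iff\<close>; it is the form that integrals can use.\<close>

definition over :: "'y measure \<Rightarrow> 'g \<Rightarrow> bool" where
  "over \<mu> x \<longleftrightarrow> \<mu> \<in> P \<and> x \<in> units G \<and> (AE y in \<mu>. proj Y y = x)"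

lemma over_iff:
  assumes "\<mu> \<in> P" "x \<in> units G"
  shows "over \<mu> x \<longleftrightarrow> distr \<mu> (borel_sigma (unit_top G)) (proj Y) = dirac (unit_top G) x"
proof
  interpret prob_space \<mu> using prob_measuresD[OF assms(1)] by blast
  note sp = prob_measuresD(3)[OF assms(1)]
  have m: "proj Y \<in> measurable \<mu> (borel_sigma (unit_top G))"
    by (rule continuous_map_measurable[OF continuous_proj prob_measuresD(2)[OF assms(1)]])
  {
    assume eq: "distr \<mu> (borel_sigma (unit_top G)) (proj Y) = dirac (unit_top G) x"
    have xs: "{x} \<in> sets (borel_sigma (unit_top G))"
      using assms(2) Hausdorff_units by (intro sets_borel_closed closedin_Hausdorff_singleton) auto
    have "measure \<mu> (proj Y -` {x} \<inter> space \<mu>) = 1"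
      using measure_distr[OF m xs] measure_dirac[of x "unit_top G" "{x}"] xs assms(2) by (simp add: eq)
    moreover have "proj Y -` {x} \<inter> space \<mu> \<in> sets \<mu>" using m xs by (rule measurable_sets)
    ultimately have "AE y in \<mu>. y \<in> proj Y -` {x} \<inter> space \<mu>" using AE_in_set_eq_1 by blast
    then show "over \<mu> x" unfolding over_def using assms by auto
  }
  assume "over \<mu> x"
  then have ae: "AE y in \<mu>. proj Y y = x" by (simp add: over_def)
  show "distr \<mu> (borel_sigma (unit_top G)) (proj Y) = dirac (unit_top G) x"
  proof (rule measure_eqI)
    fix A assume "A \<in> sets (distr \<mu> (borel_sigma (unit_top G)) (proj Y))"
    then have A: "A \<in> sets (borel_sigma (unit_top G))" by simp
    have pA: "proj Y -` A \<inter> space \<mu> \<in> sets \<mu>" using m A by (rule measurable_sets)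
    have "emeasure \<mu> (proj Y -` A \<inter> space \<mu>) = emeasure \<mu> (if x \<in> A then space \<mu> else {})"
      using ae pA by (intro emeasure_eq_AE) auto
    then show "emeasure (distr \<mu> (borel_sigma (unit_top G)) (proj Y)) A = emeasure (dirac (unit_top G) x) A"
      using m A assms(2) by (simp add: emeasure_distr dirac_def emeasure_space_1)
  qed (simp add: dirac_def)
qed

lemma over_AE: "over \<mu> x \<Longrightarrow> AE y in \<mu>. y \<in> fibre x"
proof -
  assume o: "over \<mu> x"
  then have \<mu>: "\<mu> \<in> P" and "AE y in \<mu>. proj Y y = x" by (auto simp: over_def)
  from this(2) AE_space show ?thesis
    by eventually_elim (simp add: fibre_def prob_measuresD(3)[OF \<mu>])
qed

lemma fibre_family_over:
  "fibre_family G Y \<mu> \<longleftrightarrow> (\<forall>x\<in>units G. over (\<mu> x) x)"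
  unfolding fibre_family_def using over_iff by (auto simp: over_def)

lemma integrable_CY: "\<mu> \<in> P \<Longrightarrow> f \<in> CY \<Longrightarrow> integrable \<mu> f"
  by (rule continuous_functions_integrable[OF compact])

text \<open>If the complement of the fibre had positive mass, inner regularity would give a compact
  K of positive mass in it. A function on the units that is 1 on the projection of K and 0 at x
  would then have integral 0, and yet at least the mass of K.\<close>

lemma overI_integral:
  assumes \<mu>: "\<mu> \<in> P" and x: "x \<in> units G"
    and int: "\<And>k. k \<in> continuous_functions (unit_top G) \<Longrightarrow>
      (\<integral>y. (if y \<in> topspace (sptop Y) then k (proj Y y) else 0) \<partial>\<mu>) = k x"
  shows "over \<mu> x"
proof -
  interpret prob_space \<mu> using prob_measuresD[OF \<mu>] by blast
  let ?T = "topspace (sptop Y)"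
  note sp = prob_measuresD(3)[OF \<mu>]
  define U where "U = ?T - fibre x"
  have Us: "U \<in> sets \<mu>"
    unfolding U_def using sets.compl_sets[OF fibre_sets[OF x \<mu>]] by (simp add: sp)
  have "measure \<mu> U = 0"
  proof (rule ccontr)
    assume "measure \<mu> U \<noteq> 0"
    then have "0 < measure \<mu> U" by (simp add: zero_less_measure_iff)
    \<comment> \<open>The tolerance is the mass of U itself, which makes the mass of K
      positive.\<close>
    then obtain K where K: "compactin (sptop Y) K" "K \<subseteq> U" "measure \<mu> U < measure \<mu> K + measure \<mu> U"
      using prob_measuresD(4)[OF \<mu> Us] by blast
    have Kc: "closedin (sptop Y) K" using Hausdorff K(1) by (rule compactin_imp_closedin)
    then have Ks: "K \<in> sets \<mu>" using sets_borel_closed prob_measuresD(2)[OF \<mu>] by blast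
    have KT: "K \<subseteq> ?T" by (rule closedin_subset[OF Kc])
    have pK: "closedin (unit_top G) (proj Y ` K)"
      using image_compactin[OF K(1) continuous_proj] Hausdorff_units by (rule compactin_imp_closedin[rotated])
    have "openin (unit_top G) (units G - {x})"
      using closedin_Hausdorff_singleton[OF Hausdorff_units, of x] x by (auto simp: closedin_def)
    moreover have "proj Y ` K \<subseteq> units G - {x}"
      using K(2) closedin_subset[OF pK] by (auto simp: U_def fibre_def)
    ultimately obtain v where v: "\<And>x. 0 \<le> v x" "\<And>x. v x \<le> 1" "\<And>x. x \<in> proj Y ` K \<Longrightarrow> v x = 1"
      "\<And>y. y \<notin> units G - {x} \<Longrightarrow> v y = 0" "(\<lambda>x. complex_of_real (v x)) \<in> C0_fun G (units G - {x})"
      using Urysohn_C0[OF _ pK, of "units G - {x}"] by metis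
    define w where "w y = (if y \<in> ?T then v (proj Y y) else 0)" for y
    have w_in: "(\<lambda>y. complex_of_real (w y)) \<in> CY"
      using proj_continuous_functions[OF C0_continuous[OF v(5)]] by (simp add: w_def if_distrib cong: if_cong)
    have "complex_of_real (\<integral>y. w y \<partial>\<mu>) = (\<integral>y. complex_of_real (w y) \<partial>\<mu>)" by simp
    also have "\<dots> = (\<integral>y. (if y \<in> ?T then complex_of_real (v (proj Y y)) else 0) \<partial>\<mu>)"
      by (simp add: w_def if_distrib cong: if_cong)
    also have "\<dots> = complex_of_real (v x)" by (rule int[OF C0_continuous[OF v(5)]])
    finally have w0: "(\<integral>y. w y \<partial>\<mu>) = 0" using v(4)[of x] by (simp del: integral_complex_of_real)
    have "measure \<mu> K = (\<integral>y. indicator K y \<partial>\<mu>)"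
      using Ks sets.sets_into_space[OF Ks] by (simp add: Int_absorb2)
    also have "\<dots> \<le> (\<integral>y. w y \<partial>\<mu>)"
    proof (rule integral_mono)
      show "integrable \<mu> (\<lambda>y. indicator K y :: real)"
        using Ks by (auto intro!: integrable_real_indicator simp: emeasure_eq_measure)
      show "integrable \<mu> w"
        using integrable_CY[OF \<mu> w_in] by (simp add: complex_of_real_integrable_eq)
      show "indicator K y \<le> w y" for y
        using v KT by (auto simp: indicator_def w_def)
    qed
    finally show False using w0 K(3) by simp
  qed
  then have "AE y in \<mu>. y \<notin> U" using prob_eq_0[OF Us] by simp
  from this AE_space have "AE y in \<mu>. proj Y y = x"
    by eventually_elim (auto simp: U_def fibre_def sp)
  then show ?thesis
    unfolding over_def using \<mu> x by simp
qed

lemma act_fibre: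
  "g \<in> arrows G \<Longrightarrow> y \<in> fibre (src G g) \<Longrightarrow> (g, y) \<in> act_dom G Y"
  by (simp add: act_dom_def fibre_def)

lemma continuous_act_fibre:
  assumes g: "g \<in> arrows G"
  shows "continuous_map (subtopology (sptop Y) (fibre (src G g))) (sptop Y) (act Y g)"
proof -
  have "continuous_map (subtopology (sptop Y) (fibre (src G g))) (prod_topology (gtop G) (sptop Y)) (\<lambda>y. (g, y))"
    using g by (intro continuous_map_pairedI) (auto intro: continuous_map_from_subtopology)
  then have "continuous_map (subtopology (sptop Y) (fibre (src G g)))
      (subtopology (prod_topology (gtop G) (sptop Y)) (act_dom G Y)) (\<lambda>y. (g, y))"
    using act_fibre[OF g] by (auto simp: continuous_map_in_subtopology)
  from continuous_map_compose[OF this continuous_act] show ?thesis by (simp add: o_def)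
qed

text \<open>An arrow acts continuously on one closed fibre; open sets pull back to relatively open
  subsets of it, which are Borel because the fibre is.\<close>

lemma act_measurable:
  assumes g: "g \<in> arrows G" and \<mu>: "\<mu> \<in> P"
  shows "act Y g \<in> measurable (restrict_space \<mu> (fibre (src G g))) (borel_sigma (sptop Y))"
  unfolding borel_sigma_def
proof (rule measurable_measure_of)
  let ?F = "fibre (src G g)"
  have F: "?F \<in> sets \<mu>" by (rule fibre_sets[OF src_units[OF g] \<mu>])
  have sp: "space (restrict_space \<mu> ?F) = ?F"
    using sets.sets_into_space[OF F] by (simp add: space_restrict_space Int_absorb2)
  show "act Y g \<in> space (restrict_space \<mu> ?F) \<rightarrow> topspace (sptop Y)"
    using act_fibre[OF g] act_closed by (auto simp: sp)
  fix U assume "U \<in> {U. openin (sptop Y) U}"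
  then have "openin (subtopology (sptop Y) ?F) {y \<in> topspace (subtopology (sptop Y) ?F). act Y g y \<in> U}"
    using openin_continuous_map_preimage[OF continuous_act_fibre[OF g]] by simp
  then obtain O' where O: "openin (sptop Y) O'"
    "{y \<in> topspace (subtopology (sptop Y) ?F). act Y g y \<in> U} = O' \<inter> ?F"
    by (auto simp: openin_subtopology)
  have "act Y g -` U \<inter> space (restrict_space \<mu> ?F) = O' \<inter> ?F"
    unfolding sp O(2)[symmetric] by (auto simp: fibre_def)
  moreover have "O' \<inter> ?F \<in> sets \<mu>"
    using sets_borel_open[OF O(1)] prob_measuresD(2)[OF \<mu>] F by blast
  ultimately show "act Y g -` U \<inter> space (restrict_space \<mu> ?F) \<in> sets (restrict_space \<mu> ?F)"
    using F sets.sets_into_space[OF F] by (simp add: sets_restrict_space_iff Int_absorb2)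
qed (auto dest: openin_subset)

lemma gpush_fibre: "gpush G Y g \<mu> = distr (restrict_space \<mu> (fibre (src G g))) (borel_sigma (sptop Y)) (act Y g)"
  unfolding gpush_def fibre_def ..

lemma over_fibre: "over \<mu> x \<Longrightarrow> measure \<mu> (fibre x) = 1"
proof -
  assume o: "over \<mu> x"
  then have \<mu>: "\<mu> \<in> P" and x: "x \<in> units G" by (auto simp: over_def)
  interpret prob_space \<mu> using prob_measuresD[OF \<mu>] by blast
  show ?thesis using over_AE[OF o] AE_in_set_eq_1[OF fibre_sets[OF x \<mu>]] by blast
qed

text \<open>Inner regularity is inherited, since g maps a compact subset of the fibre onto a compact
  set of at least the same mass.\<close>

lemma gpush_prob:
  assumes g: "g \<in> arrows G" and o: "over \<mu> (src G g)"
  shows "gpush G Y g \<mu> \<in> P"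
proof -
  let ?F = "fibre (src G g)"
  have \<mu>: "\<mu> \<in> P" using o by (simp add: over_def)
  interpret prob_space \<mu> using prob_measuresD[OF \<mu>] by blast
  have F: "?F \<in> sets \<mu>" by (rule fibre_sets[OF src_units[OF g] \<mu>])
  have FT: "?F \<subseteq> space \<mu>" using F by (rule sets.sets_into_space)
  note m = act_measurable[OF g \<mu>]
  have "prob_space (restrict_space \<mu> ?F)"
    using F over_fibre[OF o] by (intro prob_space_restrict_space) (auto simp: emeasure_eq_measure)
  then have p: "prob_space (gpush G Y g \<mu>)"
    unfolding gpush_fibre using m by (rule prob_space.prob_space_distr)
  have s: "sets (gpush G Y g \<mu>) = sets (borel_sigma (sptop Y))" by (simp add: gpush_fibre)
  have meas: "measure (gpush G Y g \<mu>) B = measure \<mu> {y \<in> ?F. act Y g y \<in> B}"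
    "{y \<in> ?F. act Y g y \<in> B} \<in> sets \<mu>" if B: "B \<in> sets (borel_sigma (sptop Y))" for B
  proof -
    have sp: "space (restrict_space \<mu> ?F) = ?F"
      using FT by (simp add: space_restrict_space Int_absorb2)
    have eq: "act Y g -` B \<inter> space (restrict_space \<mu> ?F) = {y \<in> ?F. act Y g y \<in> B}"
      unfolding sp by auto
    have "{y \<in> ?F. act Y g y \<in> B} \<in> sets (restrict_space \<mu> ?F)"
      using measurable_sets[OF m B] unfolding eq .
    then show "{y \<in> ?F. act Y g y \<in> B} \<in> sets \<mu>"
      using F FT by (simp add: sets_restrict_space_iff Int_absorb2)
    show "measure (gpush G Y g \<mu>) B = measure \<mu> {y \<in> ?F. act Y g y \<in> B}"
      unfolding gpush_fibre measure_distr[OF m B] eq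
      using F FT by (intro measure_restrict_space) (auto simp: Int_absorb2)
  qed
  have "\<exists>K. compactin (sptop Y) K \<and> K \<subseteq> B \<and> measure (gpush G Y g \<mu>) B < measure (gpush G Y g \<mu>) K + e"
    if B: "B \<in> sets (borel_sigma (sptop Y))" and e: "e > 0" for B e
  proof -
    obtain K where K: "compactin (sptop Y) K" "K \<subseteq> {y \<in> ?F. act Y g y \<in> B}"
      "measure \<mu> {y \<in> ?F. act Y g y \<in> B} < measure \<mu> K + e"
      using prob_measuresD(4)[OF \<mu> meas(2)[OF B] e] by blast
    have "compactin (subtopology (sptop Y) ?F) K" using K(1,2) by (auto simp: compactin_subtopology)
    then have c: "compactin (sptop Y) (act Y g ` K)"
      using continuous_act_fibre[OF g] by (rule image_compactin)
    have cs: "act Y g ` K \<in> sets (borel_sigma (sptop Y))"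
      using Hausdorff c by (intro sets_borel_closed compactin_imp_closedin)
    have "measure \<mu> K \<le> measure (gpush G Y g \<mu>) (act Y g ` K)"
      unfolding meas(1)[OF cs] using K(2) meas(2)[OF cs] by (intro finite_measure_mono) auto
    then show ?thesis using c K(2,3) meas(1)[OF B] by (intro exI[of _ "act Y g ` K"]) auto
  qed
  then show ?thesis
    using p s unfolding prob_measures_def by auto
qed

lemma integral_gpush:
  assumes g: "g \<in> arrows G" and \<mu>: "\<mu> \<in> P" and f: "f \<in> CY"
  shows "(\<integral>y. f y \<partial>gpush G Y g \<mu>) = (\<integral>y. indicator (fibre (src G g)) y *\<^sub>R f (act Y g y) \<partial>\<mu>)"
proof -
  have F: "fibre (src G g) \<inter> space \<mu> \<in> sets \<mu>" using fibre_sets[OF src_units[OF g] \<mu>] by blast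
  have "(\<integral>y. f y \<partial>gpush G Y g \<mu>) = (\<integral>y. f (act Y g y) \<partial>restrict_space \<mu> (fibre (src G g)))"
    unfolding gpush_fibre
    by (rule integral_distr[OF act_measurable[OF g \<mu>] continuous_functions_measurable[OF f refl]])
  also have "\<dots> = (\<integral>y. indicator (fibre (src G g)) y *\<^sub>R f (act Y g y) \<partial>\<mu>)"
    by (rule integral_restrict_space[OF F])
  finally show ?thesis .
qed

text \<open>The composition of f with g makes sense on one fibre only. It is replaced by a
  continuous function h extending it, and the measure does not see what h does off the
  fibre.\<close>

lemma integral_gpush_eq:
  assumes g: "g \<in> arrows G" and o: "over \<mu> (src G g)" and f: "f \<in> CY" and h: "h \<in> CY"
    and eq: "\<And>y. y \<in> fibre (src G g) \<Longrightarrow> h y = f (act Y g y)"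
  shows "(\<integral>y. f y \<partial>gpush G Y g \<mu>) = (\<integral>y. h y \<partial>\<mu>)"
proof -
  have \<mu>: "\<mu> \<in> P" using o by (simp add: over_def)
  have F: "fibre (src G g) \<in> sets \<mu>" by (rule fibre_sets[OF src_units[OF g] \<mu>])
  have hm: "h \<in> borel_measurable \<mu>"
    using continuous_functions_measurable[OF h prob_measuresD(2)[OF \<mu>]] .
  have "(\<integral>y. f y \<partial>gpush G Y g \<mu>) = (\<integral>y. indicator (fibre (src G g)) y *\<^sub>R f (act Y g y) \<partial>\<mu>)"
    by (rule integral_gpush[OF g \<mu> f])
  also have "\<dots> = (\<integral>y. indicator (fibre (src G g)) y *\<^sub>R h y \<partial>\<mu>)"
    using eq by (intro Bochner_Integration.integral_cong) (auto simp: indicator_def)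
  also have "\<dots> = (\<integral>y. h y \<partial>\<mu>)"
  proof (rule integral_cong_AE)
    show "(\<lambda>y. indicator (fibre (src G g)) y *\<^sub>R h y) \<in> borel_measurable \<mu>"
      using F hm by (intro borel_measurable_scaleR borel_measurable_indicator)
    show "AE y in \<mu>. indicator (fibre (src G g)) y *\<^sub>R h y = h y"
      using over_AE[OF o] by eventually_elim simp
  qed (rule hm)
  finally show ?thesis .
qed

text \<open>Only bisections act on functions, and only on corners: to translate \<open>f\<close> by an arrow \<open>g\<close> it is cut
  off near the range of \<open>g\<close> and moved by a bisection through \<open>g\<inverse>\<close>.\<close>

lemma translate_ex:
  assumes g: "g \<in> arrows G" and f: "f \<in> CY"
  obtains \<gamma> f' where "\<gamma> \<in> open_bisections G" "ginv G g \<in> \<gamma>" "f' \<in> CY"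
    "f' \<in> corner G (galg G Y CY) (src G ` \<gamma>)"
    "\<And>y. y \<in> fibre (rng G g) \<Longrightarrow> f' y = f y"
    "bact (galg G Y CY) \<gamma> f' \<in> CY"
    "\<And>y. y \<in> fibre (src G g) \<Longrightarrow> bact (galg G Y CY) \<gamma> f' y = f (act Y g y)"
proof -
  obtain \<gamma> where \<gamma>: "\<gamma> \<in> open_bisections G" "ginv G g \<in> \<gamma>" using bisection_ex[OF inv_closed[OF g]] by blast
  have rg: "rng G g \<in> src G ` \<gamma>" using \<gamma>(2) src_inv[OF g] by force
  have cl: "closedin (unit_top G) {rng G g}"
    using Hausdorff_units rng_units[OF g] by (intro closedin_Hausdorff_singleton) auto
  obtain v where v: "v (rng G g) = 1" "(\<lambda>x. complex_of_real (v x)) \<in> C0_fun G (src G ` \<gamma>)"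
    by (rule Urysohn_C0[OF bisection_supp_open[OF \<gamma>(1)] cl]) (use rg in auto)
  define k where "k x = complex_of_real (v x)" for x
  have k: "k \<in> C0_fun G (src G ` \<gamma>)" using v(2) by (simp add: k_def[abs_def])
  define f' where "f' y = (if y \<in> topspace (sptop Y) then k (proj Y y) else 0) * f y" for y
  have f'_in: "f' \<in> CY"
    unfolding f'_def[abs_def] by (intro mult_in proj_continuous_functions C0_continuous[OF k] f)
  obtain B where B: "0 < B" "\<And>y. cmod (f y) \<le> B" using bound_ex[OF f] by blast
  have "(\<lambda>x. of_real B * k x) \<in> C0_fun G (src G ` \<gamma>)"
    using k X.scale_in[of k "of_real B"] by (simp add: C0_fun_def)
  moreover have "cmod (f' y) \<le> cmod (of_real B * k (proj Y y))" if "y \<in> topspace (sptop Y)" for y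
    using B(1) mult_right_mono[OF B(2), of "cmod (k (proj Y y))" y] that
    by (simp add: f'_def norm_mult mult.commute)
  ultimately have "dominated G Y (src G ` \<gamma>) f'"
    unfolding dominated_def by (fastforce intro: add_increasing less_imp_le)
  then have c: "f' \<in> corner G (galg G Y CY) (src G ` \<gamma>)" using f'_in by (simp add: corner_eq)
  have f'_eq: "f' y = f y" if "y \<in> fibre (rng G g)" for y
    using that v(1) by (simp add: f'_def fibre_def k_def)
  have b: "bact (galg G Y CY) \<gamma> f' \<in> CY"
    using bact_corner[OF \<gamma>(1) c] corner_eq by auto
  have "bact (galg G Y CY) \<gamma> f' y = f (act Y g y)" if y: "y \<in> fibre (src G g)" for y
  proof -
    have "bact (galg G Y CY) \<gamma> f' y = f' (act Y (ginv G (ginv G g)) y)"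
      using y g by (intro bact_at[OF \<gamma>]) (auto simp: fibre_def rng_inv)
    also have "\<dots> = f' (act Y g y)" by (simp add: inv_inv[OF g])
    also have "\<dots> = f (act Y g y)"
      using act_closed[OF act_fibre[OF g y]] proj_act[OF act_fibre[OF g y]] by (intro f'_eq) (simp add: fibre_def)
    finally show ?thesis .
  qed
  then show thesis using that[OF \<gamma> f'_in c f'_eq b] by blast
qed

end

section \<open>Ucp maps between algebras of continuous functions\<close>

lemma psd_1: "psd 1 (\<lambda>i j. c) \<longleftrightarrow> Im c = 0 \<and> 0 \<le> Re c"
proof
  assume p: "psd 1 (\<lambda>i j. c)"
  show "Im c = 0 \<and> 0 \<le> Re c"
    using psd_hermitian[OF p, of 0 0] psd_nonneg[OF p, of "\<lambda>_. 1"] by (simp add: complex_eq_iff)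
next
  assume c: "Im c = 0 \<and> 0 \<le> Re c"
  have "0 \<le> Re (cnj z * c * z)" for z
  proof -
    have "Re (cnj z * c * z) = Re c * ((Re z)\<^sup>2 + (Im z)\<^sup>2)"
      using c by (simp add: algebra_simps power2_eq_square)
    then show ?thesis using c by simp
  qed
  then show "psd 1 (\<lambda>i j. c)"
    unfolding psd_def using c by (simp add: complex_eq_iff)
qed

text \<open>Compatibility with bisections is deferred to \<open>gucp_pair\<close>. For a map that
  factors through an algebra with its own norm, it can be verified only after
  \<open>psi_dominated\<close> has located the images in the corners.\<close>

locale ucp_pair = Z: compact_galg G Z + Y: compact_galg G Y
  for G :: "'g groupoid" and Z :: "('g, 'z) gspace" and Y :: "('g, 'y) gspace" +
  fixes \<psi> :: "('z \<Rightarrow> complex) \<Rightarrow> 'y \<Rightarrow> complex"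
  assumes ucp: "ucp_map (C_galg G Z) (C_galg G Y) \<psi>"
    and psi_incl: "k \<in> continuous_functions (unit_top G) \<Longrightarrow> \<psi> (incl (C_galg G Z) k) = incl (C_galg G Y) k"
begin

lemma psi_in: "f \<in> Z.CY \<Longrightarrow> \<psi> f \<in> Y.CY"
  using ucp unfolding ucp_map_def C_galg_eq_galg by simp

lemma psi_pos:
  assumes f: "f \<in> Z.CY" and pos: "\<And>z. Im (f z) = 0 \<and> 0 \<le> Re (f z)" and y: "y \<in> topspace (sptop Y)"
  shows "Im (\<psi> f y) = 0 \<and> 0 \<le> Re (\<psi> f y)"
proof -
  have "psd 1 (\<lambda>i j. f t)" for t using pos psd_1 by blast
  then have "mat_positive (C_galg G Z) 1 (\<lambda>i j. f)"
    unfolding C_galg_eq_galg Z.mat_positive_galg using f by simp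
  then have "mat_positive (C_galg G Y) 1 (\<lambda>i j. \<psi> f)"
    using ucp unfolding ucp_map_def by blast
  then show ?thesis
    unfolding C_galg_eq_galg Y.mat_positive_galg using y psd_1 by blast
qed

text \<open>Riesz representation of f \<mapsto> \<psi> f y; compatibility with the inclusion of the
  units places the measure on the fibre of y.\<close>

lemma measure_ex:
  assumes y: "y \<in> topspace (sptop Y)"
  shows "\<exists>\<mu>. Z.over \<mu> (proj Y y) \<and> (\<forall>f\<in>Z.CY. \<psi> f y = (\<integral>z. f z \<partial>\<mu>))"
proof -
  obtain \<mu> where \<mu>: "\<mu> \<in> Z.P" "\<And>f. f \<in> Z.CY \<Longrightarrow> \<psi> f y = (\<integral>z. f z \<partial>\<mu>)"
  proof (rule riesz_representation[of "sptop Z" "\<lambda>f. \<psi> f y"])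
    show "compact_space (sptop Z)" "Hausdorff_space (sptop Z)" by (rule Z.compact Z.Hausdorff)+
    show "\<psi> (\<lambda>z. f z + g z) y = \<psi> f y + \<psi> g y" if "f \<in> Z.CY" "g \<in> Z.CY" for f g
      using ucp that unfolding ucp_map_def C_galg_eq_galg by simp
    show "\<psi> (\<lambda>z. c * f z) y = c * \<psi> f y" if "f \<in> Z.CY" for f c
      using ucp that unfolding ucp_map_def C_galg_eq_galg by simp
    show "\<psi> (\<lambda>z. if z \<in> topspace (sptop Z) then 1 else 0) y = 1"
      using ucp y unfolding ucp_map_def C_galg_eq_galg by simp
    show "Im (\<psi> f y) = 0 \<and> 0 \<le> Re (\<psi> f y)" if "f \<in> Z.CY" "\<And>z. Im (f z) = 0 \<and> 0 \<le> Re (f z)" for f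
      using psi_pos[OF that y] .
  qed blast
  have "Z.over \<mu> (proj Y y)"
  proof (rule Z.overI_integral[OF \<mu>(1) Y.proj_units[OF y]])
    fix k assume k: "k \<in> continuous_functions (unit_top G)"
    have "(\<integral>z. (if z \<in> topspace (sptop Z) then k (proj Z z) else 0) \<partial>\<mu>) = \<psi> (incl (C_galg G Z) k) y"
      using \<mu>(2)[OF Z.proj_continuous_functions[OF k]] unfolding C_galg_eq_galg by simp
    also have "\<dots> = k (proj Y y)" using psi_incl[OF k] y unfolding C_galg_eq_galg by simp
    finally show "(\<integral>z. (if z \<in> topspace (sptop Z) then k (proj Z z) else 0) \<partial>\<mu>) = k (proj Y y)" .
  qed
  then show ?thesis using \<mu>(2) by blast
qed

text \<open>The measure at y lives on one fibre, where the bound e + |k| is constant.\<close>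

lemma psi_dominated:
  assumes f: "f \<in> Z.CY" and dom: "dominated G Z U f"
  shows "dominated G Y U (\<psi> f)"
  unfolding dominated_def
proof (intro allI impI)
  fix e :: real assume "e > 0"
  then obtain k where k: "k \<in> C0_fun G U" "\<forall>z\<in>topspace (sptop Z). cmod (f z) \<le> e + cmod (k (proj Z z))"
    using dom unfolding dominated_def by blast
  have "cmod (\<psi> f y) \<le> e + cmod (k (proj Y y))" if y: "y \<in> topspace (sptop Y)" for y
  proof -
    obtain \<mu> where \<mu>: "Z.over \<mu> (proj Y y)" "\<And>f. f \<in> Z.CY \<Longrightarrow> \<psi> f y = (\<integral>z. f z \<partial>\<mu>)"
      using measure_ex[OF y] by blast
    have \<mu>P: "\<mu> \<in> Z.P" using \<mu>(1) by (simp add: Z.over_def)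
    interpret prob_space \<mu> using prob_measuresD[OF \<mu>P] by blast
    have i: "integrable \<mu> f" by (rule Z.integrable_CY[OF \<mu>P f])
    have "cmod (\<psi> f y) \<le> (\<integral>z. cmod (f z) \<partial>\<mu>)"
      unfolding \<mu>(2)[OF f] by (rule integral_norm_bound)
    also have "\<dots> \<le> (\<integral>z. e + cmod (k (proj Y y)) \<partial>\<mu>)"
    proof (rule integral_mono_AE)
      show "AE z in \<mu>. cmod (f z) \<le> e + cmod (k (proj Y y))"
        using Z.over_AE[OF \<mu>(1)] by eventually_elim (use k(2) in \<open>auto simp: Z.fibre_def\<close>)
    qed (use i in auto)
    also have "\<dots> = e + cmod (k (proj Y y))" by (simp add: prob_space)
    finally show ?thesis .
  qed
  then show "\<exists>k\<in>C0_fun G U. \<forall>y\<in>topspace (sptop Y). cmod (\<psi> f y) \<le> e + cmod (k (proj Y y))"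
    using k(1) by blast
qed

end

locale gucp_pair = ucp_pair +
  assumes psi_bact: "\<gamma> \<in> open_bisections G \<Longrightarrow> f \<in> corner G (C_galg G Z) (src G ` \<gamma>) \<Longrightarrow>
    \<psi> (bact (C_galg G Z) \<gamma> f) = bact (C_galg G Y) \<gamma> (\<psi> f)"
begin

text \<open>Equivariance under a single arrow. The value at g y is an integral over one fibre, so f
  may be cut off near that fibre; the cut function lies in a corner, where \<open>psi_bact\<close>
  applies.\<close>

lemma psi_act:
  assumes gy: "(g, y) \<in> act_dom G Y" and f: "f \<in> Z.CY"
  obtains f'' where "f'' \<in> Z.CY" "\<And>z. z \<in> Z.fibre (src G g) \<Longrightarrow> f'' z = f (act Z g z)"
    "\<psi> f (act Y g y) = \<psi> f'' y"
proof -
  have g: "g \<in> arrows G" and y: "y \<in> topspace (sptop Y)" "proj Y y = src G g"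
    using gy by (auto simp: act_dom_def)
  obtain \<gamma> f' where t: "\<gamma> \<in> open_bisections G" "ginv G g \<in> \<gamma>" "f' \<in> Z.CY"
    "f' \<in> corner G (galg G Z Z.CY) (src G ` \<gamma>)"
    "\<And>y. y \<in> Z.fibre (rng G g) \<Longrightarrow> f' y = f y"
    "bact (galg G Z Z.CY) \<gamma> f' \<in> Z.CY"
    "\<And>y. y \<in> Z.fibre (src G g) \<Longrightarrow> bact (galg G Z Z.CY) \<gamma> f' y = f (act Z g y)"
    using Z.translate_ex[OF g f] by blast
  let ?y = "act Y g y"
  have y': "?y \<in> topspace (sptop Y)" "proj Y ?y = rng G g"
    using Y.act_closed[OF gy] Y.proj_act[OF gy] by auto
  obtain \<mu> where \<mu>: "Z.over \<mu> (rng G g)" "\<And>f. f \<in> Z.CY \<Longrightarrow> \<psi> f ?y = (\<integral>z. f z \<partial>\<mu>)"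
    using measure_ex[OF y'(1)] y'(2) by metis
  have \<mu>P: "\<mu> \<in> Z.P" using \<mu>(1) by (simp add: Z.over_def)
  have "\<psi> f ?y = \<psi> f' ?y"
    unfolding \<mu>(2)[OF f] \<mu>(2)[OF t(3)]
  proof (rule integral_cong_AE)
    show "f \<in> borel_measurable \<mu>" "f' \<in> borel_measurable \<mu>"
      using f t(3) prob_measuresD(2)[OF \<mu>P] by (auto intro: continuous_functions_measurable)
    show "AE z in \<mu>. f z = f' z"
      using Z.over_AE[OF \<mu>(1)] by eventually_elim (simp add: t(5))
  qed
  also have "\<dots> = \<psi> f' (act Y (ginv G (ginv G g)) y)" by (simp add: Z.inv_inv[OF g])
  also have "\<dots> = bact (galg G Y Y.CY) \<gamma> (\<psi> f') y"
    using y g by (intro Y.bact_at[OF t(1,2), symmetric]) (auto simp: Z.rng_inv)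
  also have "\<dots> = \<psi> (bact (galg G Z Z.CY) \<gamma> f') y"
    using psi_bact[OF t(1)] t(4) unfolding C_galg_eq_galg by simp
  finally show thesis using that[OF t(6,7)] by blast
qed

text \<open>The set is the graph of the partial map that sends y to z when the measure of \<psi> at
  y is the Dirac measure at z.\<close>

lemma dirac_graph_closed:
  "closedin (prod_topology (sptop Y) (sptop Z))
     {(y, z) \<in> topspace (sptop Y) \<times> topspace (sptop Z). \<forall>f\<in>Z.CY. \<psi> f y = f z}"
proof -
  let ?P = "prod_topology (sptop Y) (sptop Z)"
  have "closedin ?P {p \<in> topspace ?P. \<psi> f (fst p) = f (snd p)}" if f: "f \<in> Z.CY" for f
  proof (rule closedin_continuous_maps_eq)
    have "continuous_map (sptop Y) euclidean (\<psi> f)" "continuous_map (sptop Z) euclidean f"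
      using f psi_in[OF f] by (auto simp: continuous_functions_def)
    then show "continuous_map ?P euclidean (\<lambda>p. \<psi> f (fst p))" "continuous_map ?P euclidean (\<lambda>p. f (snd p))"
      using continuous_map_compose[OF continuous_map_fst] continuous_map_compose[OF continuous_map_snd]
      by (auto simp: o_def)
  qed simp
  then have "closedin ?P (\<Inter>f\<in>Z.CY. {p \<in> topspace ?P. \<psi> f (fst p) = f (snd p)})"
    using Z.zero_in by (intro closedin_Inter) auto
  moreover have "(\<Inter>f\<in>Z.CY. {p \<in> topspace ?P. \<psi> f (fst p) = f (snd p)}) =
      {(y, z) \<in> topspace (sptop Y) \<times> topspace (sptop Z). \<forall>f\<in>Z.CY. \<psi> f y = f z}"
    using Z.zero_in by auto
  ultimately show ?thesis by simp
qed

lemma closed_projection: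
  assumes "closedin (prod_topology (sptop Y) (sptop Z)) D"
  shows "closedin (sptop Y) (fst ` D)"
proof -
  have "compactin (prod_topology (sptop Y) (sptop Z)) D"
    using assms Y.compact Z.compact by (intro closedin_compact_space) (auto simp: compact_space_prod_topology)
  then have "compactin (sptop Y) (fst ` D)"
    by (rule image_compactin[OF _ continuous_map_fst])
  then show ?thesis using Y.Hausdorff by (intro compactin_imp_closedin)
qed

lemma Z_separate:
  assumes "z \<in> topspace (sptop Z)" "z' \<in> topspace (sptop Z)" "\<And>f. f \<in> Z.CY \<Longrightarrow> f z = f z'"
  shows "z = z'"
proof (rule ccontr)
  assume "z \<noteq> z'"
  then obtain u where u: "continuous_map (sptop Z) euclideanreal u" "u z = 0" "u z' = 1"
    using continuous_functions_separate[OF Z.compact Z.Hausdorff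
        closedin_Hausdorff_singleton[OF Z.Hausdorff assms(1)] assms(2)] by auto
  show False
    using assms(3)[OF continuous_functions_of_real[OF u(1)]] assms(1,2) u(2,3) by simp
qed

lemma dirac_proj:
  assumes y: "y \<in> topspace (sptop Y)" and z: "z \<in> topspace (sptop Z)" and eq: "\<And>f. f \<in> Z.CY \<Longrightarrow> \<psi> f y = f z"
  shows "proj Z z = proj Y y"
proof (rule ccontr)
  assume "proj Z z \<noteq> proj Y y"
  moreover have zu: "proj Z z \<in> units G" "proj Y y \<in> units G" using Z.proj_units[OF z] Y.proj_units[OF y] .
  ultimately obtain u where u: "continuous_map (unit_top G) euclideanreal u" "u (proj Z z) = 0" "u (proj Y y) = 1"
    using continuous_functions_separate[OF Z.compact_units Z.Hausdorff_units
        closedin_Hausdorff_singleton[OF Z.Hausdorff_units, of "proj Z z"], of "proj Y y"] by auto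
  note k = continuous_functions_of_real[OF u(1)]
  show False
    using eq[OF Z.proj_continuous_functions[OF k]] psi_incl[OF k] y z zu u(2,3)
    unfolding C_galg_eq_galg by (simp cong: if_cong)
qed

lemma dual_gmap:
  assumes sp: "strongly_proximal G Z" and irr: "irreducible_gspace G Y"
  obtains q where "gmap G Y Z q" "\<And>f y. f \<in> Z.CY \<Longrightarrow> y \<in> topspace (sptop Y) \<Longrightarrow> \<psi> f y = f (q y)"
proof -
  define D where "D = {(y, z) \<in> topspace (sptop Y) \<times> topspace (sptop Z). \<forall>f\<in>Z.CY. \<psi> f y = f z}"
  have D_iff: "(y, z) \<in> D \<longleftrightarrow> y \<in> topspace (sptop Y) \<and> z \<in> topspace (sptop Z) \<and> (\<forall>f\<in>Z.CY. \<psi> f y = f z)" for y z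
    by (simp add: D_def)
  define E where "E = fst ` D"
  have D_act: "(act Y g y, act Z g z) \<in> D" if gy: "(g, y) \<in> act_dom G Y" and yz: "(y, z) \<in> D" for g y z
  proof -
    have pz: "proj Z z = proj Y y" using yz by (intro dirac_proj) (auto simp: D_iff)
    then have gz: "(g, z) \<in> act_dom G Z" using gy yz by (auto simp: act_dom_def D_iff)
    have "\<psi> f (act Y g y) = f (act Z g z)" if f: "f \<in> Z.CY" for f
    proof -
      obtain f'' where f'': "f'' \<in> Z.CY" "\<And>z. z \<in> Z.fibre (src G g) \<Longrightarrow> f'' z = f (act Z g z)"
        "\<psi> f (act Y g y) = \<psi> f'' y" using psi_act[OF gy f] by blast
      have "\<psi> f'' y = f'' z" using yz f''(1) by (simp add: D_iff)
      also have "\<dots> = f (act Z g z)" using gz by (intro f''(2)) (auto simp: act_dom_def Z.fibre_def)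
      finally show ?thesis using f''(3) by simp
    qed
    then show ?thesis using Y.act_closed[OF gy] Z.act_closed[OF gz] by (simp add: D_iff)
  qed
  have E_surj: "units G \<subseteq> proj Y ` E"
  proof
    fix x0 assume x0: "x0 \<in> units G"
    \<comment> \<open>A section s of Y, chosen without continuity, selects one measure on each fibre
      of Z: the measure of \<psi> at s x.\<close>
    have "\<forall>x. \<exists>y. x \<in> units G \<longrightarrow> y \<in> topspace (sptop Y) \<and> proj Y y = x"
      using Y.proj_surj by (metis imageE)
    then obtain s where s: "\<And>x. x \<in> units G \<Longrightarrow> s x \<in> topspace (sptop Y) \<and> proj Y (s x) = x" by metis
    have "\<forall>x. \<exists>\<mu>. x \<in> units G \<longrightarrow> Z.over \<mu> x \<and> (\<forall>f\<in>Z.CY. \<psi> f (s x) = (\<integral>z. f z \<partial>\<mu>))"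
      using measure_ex s by metis
    then obtain m where m: "\<And>x. x \<in> units G \<Longrightarrow> Z.over (m x) x \<and> (\<forall>f\<in>Z.CY. \<psi> f (s x) = (\<integral>z. f z \<partial>m x))"
      by metis
    let ?S = "{gpush G Z g (m x) | x g. x \<in> units G \<and> g \<in> arrows G \<and> src G g = x}"
    have "fibre_family G Z m" using m by (simp add: Z.fibre_family_over)
    then have "units G \<subseteq> proj Z ` {z \<in> topspace (sptop Z). dirac (sptop Z) z \<in> weak_star_top (sptop Z) closure_of ?S}"
      using sp unfolding strongly_proximal_def by blast
    then obtain z where z: "z \<in> topspace (sptop Z)" "proj Z z = x0"
      "dirac (sptop Z) z \<in> weak_star_top (sptop Z) closure_of ?S" using x0 by auto
    let ?R = "product_topology (\<lambda>_. euclidean :: complex topology) Z.CY"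
    define \<iota> where "\<iota> = (\<lambda>\<mu>. \<lambda>f\<in>Z.CY. (\<integral>y. f y \<partial>\<mu>) :: complex)"
    define J where "J y = (\<lambda>f\<in>Z.CY. \<psi> f y)" for y
    \<comment> \<open>The states of \<open>C(Z)\<close> that come from points of Y form a compact,
      hence closed set. It contains the integrals against each translate g m, which come from the
      point g s(x), and therefore also those against a Dirac measure in their closure.\<close>
    have "continuous_map (sptop Y) ?R J"
      unfolding J_def continuous_map_componentwise using psi_in by (auto simp: continuous_functions_def)
    then have "compactin ?R (J ` topspace (sptop Y))"
      using Y.compact by (intro image_compactin) (auto simp: compact_space_def)
    moreover have "Hausdorff_space ?R" by (simp add: Hausdorff_space_product_topology)
    ultimately have cl: "closedin ?R (J ` topspace (sptop Y))" by (rule compactin_imp_closedin[rotated])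
    have "\<iota> (dirac (sptop Z) z) \<in> J ` topspace (sptop Y)"
    proof (rule ccontr)
      assume n: "\<iota> (dirac (sptop Z) z) \<notin> J ` topspace (sptop Y)"
      define W where "W = topspace ?R - J ` topspace (sptop Y)"
      have "openin ?R W" unfolding W_def using cl by (simp add: closedin_def)
      then have o: "openin (weak_star_top (sptop Z)) (\<iota> -` W \<inter> Z.P)"
        unfolding weak_star_top_def openin_pullback_topology \<iota>_def by blast
      have "\<iota> (dirac (sptop Z) z) \<in> W" using n unfolding W_def by (simp add: \<iota>_def)
      then have d: "dirac (sptop Z) z \<in> \<iota> -` W \<inter> Z.P"
        using dirac_prob_measures[OF Z.Hausdorff z(1)] by simp
      have "\<And>V. dirac (sptop Z) z \<in> V \<Longrightarrow> openin (weak_star_top (sptop Z)) V \<Longrightarrow> \<exists>\<nu>. \<nu> \<in> ?S \<and> \<nu> \<in> V"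
        using z(3) unfolding in_closure_of by simp
      then have "\<exists>\<nu>. \<nu> \<in> ?S \<and> \<nu> \<in> \<iota> -` W \<inter> Z.P" using d o .
      then obtain \<nu> where \<nu>: "\<nu> \<in> ?S" "\<iota> \<nu> \<in> W" by blast
      then obtain g where g: "g \<in> arrows G" "src G g \<in> units G" "\<nu> = gpush G Z g (m (src G g))" by blast
      note ms = m[OF g(2)] s[OF g(2)]
      have gy: "(g, s (src G g)) \<in> act_dom G Y" using g(1) ms by (simp add: act_dom_def)
      have "(\<integral>z. f z \<partial>\<nu>) = \<psi> f (act Y g (s (src G g)))" if f: "f \<in> Z.CY" for f
      proof -
        obtain f'' where f'': "f'' \<in> Z.CY" "\<And>z. z \<in> Z.fibre (src G g) \<Longrightarrow> f'' z = f (act Z g z)"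
          "\<psi> f (act Y g (s (src G g))) = \<psi> f'' (s (src G g))" using psi_act[OF gy f] by blast
        have "(\<integral>z. f z \<partial>\<nu>) = (\<integral>z. f'' z \<partial>m (src G g))"
          unfolding g(3) using ms by (intro Z.integral_gpush_eq[OF g(1) _ f f''(1,2)]) auto
        then show ?thesis using f''(1,3) ms by simp
      qed
      then have "\<iota> \<nu> = J (act Y g (s (src G g)))"
        unfolding \<iota>_def J_def by (intro restrict_ext) simp
      then show False using \<nu>(2) Y.act_closed[OF gy] unfolding W_def by blast
    qed
    then obtain y where y: "y \<in> topspace (sptop Y)" "\<iota> (dirac (sptop Z) z) = J y" by blast
    have eq: "\<psi> f y = f z" if "f \<in> Z.CY" for f
      using fun_cong[OF y(2), of f] that integral_dirac[OF z(1) that] by (simp add: \<iota>_def J_def)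
    then have "(y, z) \<in> D" using y(1) z(1) by (simp add: D_iff)
    have "proj Y y = x0" using dirac_proj[OF y(1) z(1) eq] z(2) by simp
    moreover have "y \<in> E"
      unfolding E_def using \<open>(y, z) \<in> D\<close> by (rule image_eqI[rotated]) simp
    ultimately show "x0 \<in> proj Y ` E" by (intro image_eqI) simp_all
  qed
  have "E = topspace (sptop Y)"
  proof -
    have ET: "E \<subseteq> topspace (sptop Y)" unfolding E_def by (auto simp: D_iff)
    have "closedin (sptop Y) E" unfolding E_def D_def by (rule closed_projection[OF dirac_graph_closed])
    moreover have "\<forall>(g, y)\<in>act_dom G Y. y \<in> E \<longrightarrow> act Y g y \<in> E"
    proof (rule ballI, rule case_prodI2, rule impI)
      fix p g y assume p: "p \<in> act_dom G Y" "p = (g, y)" and "y \<in> E"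
      then obtain z where yz: "(y, z) \<in> D" unfolding E_def by auto
      have "(g, y) \<in> act_dom G Y" using p by simp
      from D_act[OF this yz] show "act Y g y \<in> E"
        unfolding E_def by (rule image_eqI[rotated]) simp
    qed
    moreover have "proj Y ` E = units G"
    proof (rule antisym[OF _ E_surj])
      show "proj Y ` E \<subseteq> units G"
      proof
        fix x assume "x \<in> proj Y ` E"
        then obtain y where y: "x = proj Y y" "y \<in> E" by (rule imageE)
        show "x \<in> units G" unfolding y(1) by (rule Y.proj_units[OF subsetD[OF ET y(2)]])
      qed
    qed
    ultimately show ?thesis using irr unfolding irreducible_gspace_def by blast
  qed
  then have E_eq: "fst ` D = topspace (sptop Y)" unfolding E_def .
  have "\<exists>z. y \<in> topspace (sptop Y) \<longrightarrow> (y, z) \<in> D" for y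
    unfolding E_eq[symmetric] by auto
  then obtain q where q: "\<And>y. y \<in> topspace (sptop Y) \<Longrightarrow> (y, q y) \<in> D" by metis
  have q_unique: "z = q y" if "(y, z) \<in> D" for y z
    using that q[of y] by (intro Z_separate) (auto simp: D_iff)
  have "continuous_map (sptop Y) (sptop Z) q"
    unfolding continuous_map_closedin
  proof (intro conjI allI impI)
    show "q \<in> topspace (sptop Y) \<rightarrow> topspace (sptop Z)" using q D_iff by blast
    fix C assume C: "closedin (sptop Z) C"
    \<comment> \<open>Closed graph argument: the preimage of C is the projection of the part of the
      graph over C, and compactness makes this projection closed.\<close>
    have "closedin (prod_topology (sptop Y) (sptop Z)) (topspace (sptop Y) \<times> C)"
      using C by (simp add: closedin_prod_Times_iff)
    then have "closedin (sptop Y) (fst ` (D \<inter> (topspace (sptop Y) \<times> C)))"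
      using dirac_graph_closed unfolding D_def by (intro closed_projection closedin_Int)
    moreover have "fst ` (D \<inter> (topspace (sptop Y) \<times> C)) = {y \<in> topspace (sptop Y). q y \<in> C}"
    proof (intro equalityI subsetI)
      fix y assume "y \<in> fst ` (D \<inter> (topspace (sptop Y) \<times> C))"
      then obtain z where z: "(y, z) \<in> D" "z \<in> C" by auto
      then show "y \<in> {y \<in> topspace (sptop Y). q y \<in> C}" using q_unique[OF z(1)] by (auto simp: D_iff)
    next
      fix y assume y: "y \<in> {y \<in> topspace (sptop Y). q y \<in> C}"
      then have "(y, q y) \<in> D" by (intro q) simp
      then have "(y, q y) \<in> D \<inter> (topspace (sptop Y) \<times> C)" using y by simp
      then show "y \<in> fst ` (D \<inter> (topspace (sptop Y) \<times> C))" by (rule image_eqI[rotated]) simp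
    qed
    ultimately show "closedin (sptop Y) {y \<in> topspace (sptop Y). q y \<in> C}" by simp
  qed
  moreover have "proj Z (q y) = proj Y y" if "y \<in> topspace (sptop Y)" for y
    using q[OF that] by (intro dirac_proj) (auto simp: D_iff)
  moreover have "q (act Y g y) = act Z g (q y)" if gy: "(g, y) \<in> act_dom G Y" for g y
  proof -
    have "(y, q y) \<in> D" using gy by (intro q) (simp add: act_dom_def)
    from q_unique[OF D_act[OF gy this]] show ?thesis by simp
  qed
  ultimately have "gmap G Y Z q" unfolding gmap_def by blast
  then show thesis using that q D_iff by blast
qed

end


section \<open>The spectrum of an essential extension is a boundary\<close>

text \<open>A homomorphism carries the form Z* Z to the same form, which is all that positivity
  asks. Surjectivity forces the unit to be preserved.\<close>

lemma star_iso_ucp: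
  assumes A: "cstar_algebra A" and B: "cstar_algebra B"
    and h: "star_hom_on (carrier A) A B \<Phi>" and bij: "bij_betw \<Phi> (carrier A) (carrier B)"
  shows "ucp_map A B \<Phi>"
proof -
  interpret A: cstar_algebra A by (rule A)
  interpret B: cstar_algebra B by (rule B)
  have cl: "\<Phi> x \<in> carrier B" if "x \<in> carrier A" for x using h that unfolding star_hom_on_def by blast
  have add: "\<Phi> (x \<oplus>\<^bsub>A\<^esub> y) = \<Phi> x \<oplus>\<^bsub>B\<^esub> \<Phi> y" if "x \<in> carrier A" "y \<in> carrier A" for x y
    using h that unfolding star_hom_on_def by blast
  have mult: "\<Phi> (x \<otimes>\<^bsub>A\<^esub> y) = \<Phi> x \<otimes>\<^bsub>B\<^esub> \<Phi> y" if "x \<in> carrier A" "y \<in> carrier A" for x y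
    using h that unfolding star_hom_on_def by blast
  have scale: "\<Phi> (scale A c x) = scale B c (\<Phi> x)" if "x \<in> carrier A" for c x
    using h that unfolding star_hom_on_def by blast
  have adj: "\<Phi> (adj A x) = adj B (\<Phi> x)" if "x \<in> carrier A" for x
    using h that unfolding star_hom_on_def by blast
  have zero: "\<Phi> \<zero>\<^bsub>A\<^esub> = \<zero>\<^bsub>B\<^esub>"
  proof -
    have "\<Phi> \<zero>\<^bsub>A\<^esub> \<oplus>\<^bsub>B\<^esub> \<Phi> \<zero>\<^bsub>A\<^esub> = \<Phi> \<zero>\<^bsub>A\<^esub>" using add[of "\<zero>\<^bsub>A\<^esub>" "\<zero>\<^bsub>A\<^esub>"] by simp
    then show ?thesis using cl[OF A.zero_closed] B.add.r_cancel_one' by metis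
  qed
  have one: "\<Phi> \<one>\<^bsub>A\<^esub> = \<one>\<^bsub>B\<^esub>"
  proof -
    obtain x where x: "x \<in> carrier A" "\<Phi> x = \<one>\<^bsub>B\<^esub>"
      using bij B.one_closed unfolding bij_betw_def by (metis imageE)
    have "\<Phi> \<one>\<^bsub>A\<^esub> = \<Phi> \<one>\<^bsub>A\<^esub> \<otimes>\<^bsub>B\<^esub> \<Phi> x" using x cl[OF A.one_closed] by simp
    also have "\<dots> = \<Phi> x" using mult[OF A.one_closed x(1)] x(1) by simp
    finally show ?thesis using x(2) by simp
  qed
  have fin: "\<Phi> (finsum A F {..<n}) = finsum B (\<lambda>k. \<Phi> (F k)) {..<n}"
    if "\<And>k. k < n \<Longrightarrow> F k \<in> carrier A" for F :: "nat \<Rightarrow> _" and n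
    using that
  proof (induction n)
    case (Suc n)
    have e: "{..<Suc n} = insert n {..<n}" by auto
    have "finsum A F {..<Suc n} = F n \<oplus>\<^bsub>A\<^esub> finsum A F {..<n}"
      unfolding e using Suc.prems by (intro A.finsum_insert) auto
    moreover have "finsum B (\<lambda>k. \<Phi> (F k)) {..<Suc n} = \<Phi> (F n) \<oplus>\<^bsub>B\<^esub> finsum B (\<lambda>k. \<Phi> (F k)) {..<n}"
      unfolding e using Suc.prems cl by (intro B.finsum_insert) auto
    moreover have "finsum A F {..<n} \<in> carrier A" using Suc.prems by (intro A.finsum_closed) auto
    ultimately show ?case using Suc add by simp
  qed (simp add: A.finsum_empty B.finsum_empty zero)
  have pos: "mat_positive B n (\<lambda>i j. \<Phi> (X i j))" if "mat_positive A n X" for n X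
  proof -
    obtain Z where Z: "\<And>i j. i < n \<Longrightarrow> j < n \<Longrightarrow> Z i j \<in> carrier A"
      and X: "\<And>i j. i < n \<Longrightarrow> j < n \<Longrightarrow> X i j = finsum A (\<lambda>k. adj A (Z k i) \<otimes>\<^bsub>A\<^esub> Z k j) {..<n}"
      using \<open>mat_positive A n X\<close> unfolding mat_positive_def mat_carrier_def by blast
    have "\<Phi> (X i j) = finsum B (\<lambda>k. adj B (\<Phi> (Z k i)) \<otimes>\<^bsub>B\<^esub> \<Phi> (Z k j)) {..<n}" if ij: "i < n" "j < n" for i j
    proof -
      have "\<Phi> (X i j) = finsum B (\<lambda>k. \<Phi> (adj A (Z k i) \<otimes>\<^bsub>A\<^esub> Z k j)) {..<n}"
        unfolding X[OF ij] using Z ij A.adj_closed by (intro fin) auto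
      also have "\<dots> = finsum B (\<lambda>k. adj B (\<Phi> (Z k i)) \<otimes>\<^bsub>B\<^esub> \<Phi> (Z k j)) {..<n}"
        using Z ij cl A.adj_closed B.adj_closed by (intro B.finsum_cong') (auto simp: mult adj)
      finally show ?thesis .
    qed
    then show ?thesis
      unfolding mat_positive_def mat_carrier_def using Z cl by (intro exI[of _ "\<lambda>i j. \<Phi> (Z i j)"]) auto
  qed
  show ?thesis
    unfolding ucp_map_def using cl add scale one pos by blast
qed

lemma ucp_map_comp: "ucp_map A B \<phi> \<Longrightarrow> ucp_map B C \<psi> \<Longrightarrow> ucp_map A C (\<psi> \<circ> \<phi>)"
  unfolding ucp_map_def by simp

lemma mat_positive_carrier:
  assumes A: "cstar_algebra A" and "mat_positive A n X" "i < n" "j < n"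
  shows "X i j \<in> carrier A"
proof -
  interpret A: cstar_algebra A by (rule A)
  obtain Z where Z: "\<And>i j. i < n \<Longrightarrow> j < n \<Longrightarrow> Z i j \<in> carrier A"
    and X: "X i j = finsum A (\<lambda>k. adj A (Z k i) \<otimes>\<^bsub>A\<^esub> Z k j) {..<n}"
    using assms(2-) unfolding mat_positive_def mat_carrier_def by blast
  show ?thesis
    unfolding X using Z assms(3,4) A.adj_closed by (intro A.finsum_closed) auto
qed

lemma mat_positive_cong:
  "(\<And>i j. i < n \<Longrightarrow> j < n \<Longrightarrow> X i j = X' i j) \<Longrightarrow> mat_positive A n X \<longleftrightarrow> mat_positive A n X'"
  unfolding mat_positive_def by simp

lemma corner_subset: "gcstar_algebra G A \<Longrightarrow> corner G A U \<subseteq> carrier A"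
proof -
  assume "gcstar_algebra G A"
  then interpret gcstar_algebra G A .
  show ?thesis
    unfolding corner_def using closure_of_subset_topspace[of "norm_top A"] topspace_norm_top by simp
qed

text \<open>Maps are total functions, so two of them that agree on the carrier need not be equal;
  being an embedding is a property of the values on the carrier.\<close>

lemma gembedding_cong:
  assumes A: "gcstar_algebra G A" and eq: "\<And>a. a \<in> carrier A \<Longrightarrow> \<phi> a = \<phi>' a"
    and e: "gembedding G A B \<phi>'"
  shows "gembedding G A B \<phi>"
proof -
  interpret A: gcstar_algebra G A by (rule A)
  have u: "ucp_map A B \<phi>"
  proof -
    have u': "ucp_map A B \<phi>'" using e by (simp add: gembedding_def gucp_map_def)
    have "mat_positive B n (\<lambda>i j. \<phi> (X i j))" if X: "mat_positive A n X" for n X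
    proof -
      have "mat_positive B n (\<lambda>i j. \<phi> (X i j)) \<longleftrightarrow> mat_positive B n (\<lambda>i j. \<phi>' (X i j))"
        using mat_positive_carrier[OF A.cstar_algebra_axioms X] by (intro mat_positive_cong eq)
      then show ?thesis using u' X unfolding ucp_map_def by blast
    qed
    then show ?thesis
      using u' unfolding ucp_map_def by (simp add: eq A.scale_closed)
  qed
  have "compatible G A B \<phi>"
  proof -
    have c: "compatible G A B \<phi>'" using e by (simp add: gembedding_def gucp_map_def)
    have "incl A f \<in> carrier A" if "f \<in> continuous_functions (unit_top G)" for f
      using A.incl_hom that unfolding star_hom_on_def by blast
    moreover have "bact A \<gamma> a \<in> carrier A" "a \<in> carrier A"
      if "\<gamma> \<in> open_bisections G" "a \<in> corner G A (src G ` \<gamma>)" for \<gamma> a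
      using A.bact_hom[OF that(1)] that(2) corner_subset[OF A] unfolding star_hom_on_def by auto
    ultimately show ?thesis using c unfolding compatible_def by (simp add: eq)
  qed
  moreover have "complete_order_embedding A B \<phi>"
  proof -
    have c: "complete_order_embedding A B \<phi>'" using e by (simp add: gembedding_def)
    have "mat_positive A n X" if X: "mat_carrier A n X" and p: "mat_positive B n (\<lambda>i j. \<phi> (X i j))" for n X
    proof -
      have "mat_positive B n (\<lambda>i j. \<phi> (X i j)) \<longleftrightarrow> mat_positive B n (\<lambda>i j. \<phi>' (X i j))"
        using X unfolding mat_carrier_def by (intro mat_positive_cong eq) auto
      then show ?thesis using c X p unfolding complete_order_embedding_def by blast
    qed
    moreover have "inj_on \<phi> (carrier A)"
      using c inj_on_cong[of "carrier A" \<phi> \<phi>'] eq unfolding complete_order_embedding_def by blast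
    ultimately show ?thesis using u unfolding complete_order_embedding_def by blast
  qed
  ultimately show ?thesis using u unfolding gembedding_def gucp_map_def by blast
qed

lemma unit_gspace_simps [simp]:
  "sptop (unit_gspace G) = unit_top G" "proj (unit_gspace G) x = x" "act (unit_gspace G) g x = rng G g"
  by (simp_all add: unit_gspace_def)

lemma (in compact_groupoid) compact_galg_unit: "compact_galg G (unit_gspace G)"
proof (intro compact_galg.intro compact_groupoid_axioms compact_gspace.intro)
  show "continuous_map (sptop (unit_gspace G)) (unit_top G) (proj (unit_gspace G))"
    by (simp add: unit_gspace_def)
  show "proj (unit_gspace G) ` topspace (sptop (unit_gspace G)) = units G"
    by simp
  have "continuous_map (subtopology (prod_topology (gtop G) (unit_top G)) (act_dom G (unit_gspace G)))
      (unit_top G) (rng G \<circ> fst)"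
    by (intro continuous_map_compose[OF _ continuous_rng] continuous_map_from_subtopology continuous_map_fst)
  then show "continuous_map (subtopology (prod_topology (gtop G) (sptop (unit_gspace G))) (act_dom G (unit_gspace G)))
      (sptop (unit_gspace G)) (\<lambda>(g, y). act (unit_gspace G) g y)"
    by (simp add: o_def case_prod_beta')
qed (auto simp: compact_units Hausdorff_units act_dom_def rng_units rng_unit rng_mul)

section \<open>The Poisson transform\<close>

context compact_galg
begin

definition poisson :: "('g \<Rightarrow> 'y measure) \<Rightarrow> ('y \<Rightarrow> complex) \<Rightarrow> 'g set set \<Rightarrow> complex" where
  "poisson \<mu> f t = (if t \<in> arrow_code ` arrows G
     then \<integral>y. f y \<partial>gpush G Y (arrow_decode t) (\<mu> (src G (arrow_decode t))) else 0)"

context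
  fixes \<mu>
  assumes fam: "\<And>x. x \<in> units G \<Longrightarrow> over (\<mu> x) x"
begin

lemma fam_prob: "g \<in> arrows G \<Longrightarrow> gpush G Y g (\<mu> (src G g)) \<in> P"
  using gpush_prob fam src_units by blast

lemma fam_P: "g \<in> arrows G \<Longrightarrow> \<mu> (src G g) \<in> P"
  using fam src_units by (simp add: over_def)

lemma poisson_in: "f \<in> CY \<Longrightarrow> poisson \<mu> f \<in> arrow_functions G"
proof -
  assume f: "f \<in> CY"
  obtain B where B: "0 < B" "\<And>y. cmod (f y) \<le> B" using bound_ex[OF f] by blast
  have "cmod (poisson \<mu> f t) \<le> B" for t
  proof (cases "t \<in> arrow_code ` arrows G")
    case True
    then obtain g where g: "g \<in> arrows G" "t = arrow_code g" by blast
    let ?\<nu> = "gpush G Y g (\<mu> (src G g))"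
    interpret prob_space ?\<nu> using prob_measuresD[OF fam_prob[OF g(1)]] by blast
    have i: "integrable ?\<nu> f" by (rule integrable_CY[OF fam_prob[OF g(1)] f])
    have "cmod (\<integral>y. f y \<partial>?\<nu>) \<le> (\<integral>y. cmod (f y) \<partial>?\<nu>)" by (rule integral_norm_bound)
    also have "\<dots> \<le> (\<integral>y. B \<partial>?\<nu>)" using i B by (intro integral_mono) auto
    also have "\<dots> = B" by (simp add: prob_space)
    finally show ?thesis using g by (simp add: poisson_def)
  qed (use B in \<open>simp add: poisson_def\<close>)
  moreover have "poisson \<mu> f t = 0" if "t \<notin> arrow_code ` arrows G" for t
    using that by (simp add: poisson_def)
  ultimately show ?thesis unfolding arrow_functions_def by blast
qed

text \<open>The quadratic form of the matrix of integrals is the integral of the pointwise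
  forms.\<close>

lemma poisson_psd:
  assumes M: "\<And>i j. i < n \<Longrightarrow> j < n \<Longrightarrow> M i j \<in> CY"
    and p: "\<And>y. y \<in> topspace (sptop Y) \<Longrightarrow> psd n (\<lambda>i j. M i j y)" and g: "g \<in> arrows G"
  shows "psd n (\<lambda>i j. poisson \<mu> (M i j) (arrow_code g))"
proof -
  let ?\<nu> = "gpush G Y g (\<mu> (src G g))"
  note \<nu> = fam_prob[OF g]
  interpret prob_space ?\<nu> using prob_measuresD[OF \<nu>] by blast
  have i: "integrable ?\<nu> (M i j)" if "i < n" "j < n" for i j
    using integrable_CY[OF \<nu> M[OF that]] .
  have herm: "M j i y = cnj (M i j y)" if "i < n" "j < n" for i j y
  proof (cases "y \<in> topspace (sptop Y)")
    case True
    show ?thesis by (rule psd_hermitian[OF p[OF True] that])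
  next
    case False
    then show ?thesis using vanish[OF M[OF that] False] vanish[OF M[OF that(2,1)] False] by simp
  qed
  have nonneg: "0 \<le> Re (\<Sum>i<n. \<Sum>j<n. cnj (v i) * (\<integral>y. M i j y \<partial>?\<nu>) * v j)" for v
  proof -
    have iv: "integrable ?\<nu> (\<lambda>y. cnj (v i) * M i j y * v j)" if "i < n" "j < n" for i j
      using i[OF that] by (intro integrable_mult_left integrable_mult_right)
    have iv2: "integrable ?\<nu> (\<lambda>y. \<Sum>j<n. cnj (v i) * M i j y * v j)" if "i < n" for i
      by (rule Bochner_Integration.integrable_sum) (simp add: iv that)
    have iv3: "integrable ?\<nu> (\<lambda>y. \<Sum>i<n. \<Sum>j<n. cnj (v i) * M i j y * v j)"
      by (rule Bochner_Integration.integrable_sum) (simp add: iv2)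
    have "(\<Sum>i<n. \<Sum>j<n. cnj (v i) * (\<integral>y. M i j y \<partial>?\<nu>) * v j) =
        (\<Sum>i<n. \<Sum>j<n. (\<integral>y. cnj (v i) * M i j y * v j \<partial>?\<nu>))"
      by (intro sum.cong refl) simp
    also have "\<dots> = (\<Sum>i<n. (\<integral>y. (\<Sum>j<n. cnj (v i) * M i j y * v j) \<partial>?\<nu>))"
      using iv by (intro sum.cong refl Bochner_Integration.integral_sum[symmetric]) auto
    also have "\<dots> = (\<integral>y. (\<Sum>i<n. \<Sum>j<n. cnj (v i) * M i j y * v j) \<partial>?\<nu>)"
      by (rule Bochner_Integration.integral_sum[symmetric]) (simp add: iv2)
    finally have "Re (\<Sum>i<n. \<Sum>j<n. cnj (v i) * (\<integral>y. M i j y \<partial>?\<nu>) * v j) =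
        (\<integral>y. Re (\<Sum>i<n. \<Sum>j<n. cnj (v i) * M i j y * v j) \<partial>?\<nu>)"
      using integral_Re[OF iv3] by simp
    also have "\<dots> \<ge> 0"
      using psd_nonneg[OF p] prob_measuresD(3)[OF \<nu>] by (intro integral_nonneg_AE AE_I2) blast
    finally show ?thesis .
  qed
  have "psd n (\<lambda>i j. \<integral>y. M i j y \<partial>?\<nu>)"
    unfolding psd_def
  proof (intro conjI allI impI nonneg)
    fix i k assume ij: "i < n" "k < n"
    have "(\<integral>y. M k i y \<partial>?\<nu>) = (\<integral>y. cnj (M i k y) \<partial>?\<nu>)"
      by (intro Bochner_Integration.integral_cong refl herm ij)
    then show "(\<integral>y. M k i y \<partial>?\<nu>) = cnj (\<integral>y. M i k y \<partial>?\<nu>)" by simp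
  qed
  then show ?thesis using g by (simp add: poisson_def)
qed

lemma poisson_incl:
  assumes k: "k \<in> continuous_functions (unit_top G)"
  shows "poisson \<mu> (incl A k) = incl (galg G (arrow_gspace G) (arrow_functions G)) k"
proof
  fix t
  show "poisson \<mu> (incl A k) t = incl (galg G (arrow_gspace G) (arrow_functions G)) k t"
  proof (cases "t \<in> arrow_code ` arrows G")
    case True
    then obtain g where g: "g \<in> arrows G" "t = arrow_code g" by blast
    interpret prob_space "\<mu> (src G g)" using prob_measuresD[OF fam_P[OF g(1)]] by blast
    \<comment> \<open>On the source fibre of g the function to be integrated is constant, because g
      maps this fibre into the fibre over its range.\<close>
    let ?h = "\<lambda>y. k (rng G g) * (if y \<in> topspace (sptop Y) then 1 else 0)"
    have "(\<integral>y. incl A k y \<partial>gpush G Y g (\<mu> (src G g))) = (\<integral>y. ?h y \<partial>\<mu> (src G g))"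
    proof (rule integral_gpush_eq[OF g(1) fam[OF src_units[OF g(1)]]])
      show "incl A k \<in> CY" using incl_in'[OF k] .
      show "?h \<in> CY" by (intro scale_in one_in)
      show "?h y = incl A k (act Y g y)" if "y \<in> fibre (src G g)" for y
        using act_fibre[OF g(1) that] act_closed proj_act that by (simp add: fibre_def)
    qed
    also have "\<dots> = (\<integral>y. k (rng G g) \<partial>\<mu> (src G g))"
      using prob_measuresD(3)[OF fam_P[OF g(1)]] by (intro Bochner_Integration.integral_cong) auto
    finally show ?thesis using g by (simp add: poisson_def prob_space del: galg_simps(8)) simp
  qed (simp add: poisson_def)
qed

text \<open>Both sides integrate f at the image of y under h\<inverse> g, where h is the arrow of
  \<gamma> with the range of g. Thus translating f by \<gamma> amounts to multiplying g from the
  left by h\<inverse>.\<close>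

lemma poisson_bact:
  assumes \<gamma>: "\<gamma> \<in> open_bisections G" and f: "f \<in> CY" "bact A \<gamma> f \<in> CY"
  shows "poisson \<mu> (bact A \<gamma> f) = bact (galg G (arrow_gspace G) (arrow_functions G)) \<gamma> (poisson \<mu> f)"
proof
  interpret R: gset G "arrow_gspace G" "arrow_functions G" by (rule gset_arrow)
  fix t
  show "poisson \<mu> (bact A \<gamma> f) t = bact (galg G (arrow_gspace G) (arrow_functions G)) \<gamma> (poisson \<mu> f) t"
  proof (cases "t \<in> arrow_code ` arrows G")
    case True
    then obtain g where g: "g \<in> arrows G" "t = arrow_code g" by blast
    let ?F = "fibre (src G g)" and ?m = "\<mu> (src G g)"
    have L: "poisson \<mu> (bact A \<gamma> f) t = (\<integral>y. indicator ?F y *\<^sub>R bact A \<gamma> f (act Y g y) \<partial>?m)"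
      using g integral_gpush[OF g(1) fam_P[OF g(1)] f(2)] by (simp add: poisson_def del: galg_simps(9))
    show ?thesis
    proof (cases "rng G g \<in> rng G ` \<gamma>")
      case True
      then obtain h where h: "h \<in> \<gamma>" "rng G g = rng G h" by blast
      have ha: "h \<in> arrows G" by (rule bisection_arrows[OF \<gamma> h(1)])
      let ?l = "gmul G (ginv G h) g"
      have comp: "(ginv G h, g) \<in> composable G" using ha g(1) h(2) by (simp add: composable_def inv_closed src_inv)
      have l: "?l \<in> arrows G" "src G ?l = src G g" using mul_closed[OF comp] src_mul[OF comp] .
      have "bact (galg G (arrow_gspace G) (arrow_functions G)) \<gamma> (poisson \<mu> f) t = poisson \<mu> f (arrow_code ?l)"
        using R.bact_at[OF \<gamma> h(1), of t "poisson \<mu> f"] g h(2) by (simp del: galg_simps(9))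
      also have "\<dots> = (\<integral>y. indicator ?F y *\<^sub>R f (act Y ?l y) \<partial>?m)"
        using l integral_gpush[OF l(1), of ?m f] fam_P[OF g(1)] f(1) by (simp add: poisson_def)
      also have "\<dots> = (\<integral>y. indicator ?F y *\<^sub>R bact A \<gamma> f (act Y g y) \<partial>?m)"
      proof (intro Bochner_Integration.integral_cong refl)
        fix y
        have "bact A \<gamma> f (act Y g y) = f (act Y ?l y)" if y: "y \<in> ?F"
        proof -
          note a = act_fibre[OF g(1) y]
          have "bact A \<gamma> f (act Y g y) = f (act Y (ginv G h) (act Y g y))"
            using act_closed[OF a] proj_act[OF a] h(2) by (intro bact_at[OF \<gamma> h(1)]) auto
          then show ?thesis using act_mul[OF comp a] by simp
        qed
        then show "indicator ?F y *\<^sub>R f (act Y ?l y) = indicator ?F y *\<^sub>R bact A \<gamma> f (act Y g y)"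
          by (cases "y \<in> ?F") (simp_all del: galg_simps(9))
      qed
      finally show ?thesis using L by simp
    next
      case False
      have z: "indicator ?F y *\<^sub>R bact A \<gamma> f (act Y g y) = 0" for y
        using False proj_act[OF act_fibre[OF g(1)], of y] by (auto simp: indicator_def)
      have "poisson \<mu> (bact A \<gamma> f) t = 0" unfolding L z by simp
      then show ?thesis using False g by (simp del: galg_simps(9)) simp
    qed
  qed (simp add: poisson_def)
qed

lemma poisson_ucp: "ucp_map A (galg G (arrow_gspace G) (arrow_functions G)) (poisson \<mu>)"
  unfolding ucp_map_def
proof (intro conjI ballI allI impI)
  interpret R: gset G "arrow_gspace G" "arrow_functions G" by (rule gset_arrow)
  show "poisson \<mu> f \<in> carrier (galg G (arrow_gspace G) (arrow_functions G))" if "f \<in> carrier A" for f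
    using that poisson_in by simp
  show "poisson \<mu> (f \<oplus>\<^bsub>A\<^esub> h) = poisson \<mu> f \<oplus>\<^bsub>galg G (arrow_gspace G) (arrow_functions G)\<^esub> poisson \<mu> h"
    if "f \<in> carrier A" "h \<in> carrier A" for f h
    using that integrable_CY[OF fam_prob] by (auto simp: poisson_def fun_eq_iff)
  show "poisson \<mu> (scale A c f) = scale (galg G (arrow_gspace G) (arrow_functions G)) c (poisson \<mu> f)"
    if "f \<in> carrier A" for c f
    using that by (auto simp: poisson_def fun_eq_iff)
  have "incl A \<one>\<^bsub>C_alg (unit_top G)\<^esub> = \<one>\<^bsub>A\<^esub>"
    using proj_units by (auto simp: C_alg_def)
  moreover have "incl (galg G (arrow_gspace G) (arrow_functions G)) \<one>\<^bsub>C_alg (unit_top G)\<^esub>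
      = \<one>\<^bsub>galg G (arrow_gspace G) (arrow_functions G)\<^esub>"
    using rng_units by (auto simp: C_alg_def fun_eq_iff)
  moreover have "\<one>\<^bsub>C_alg (unit_top G)\<^esub> \<in> continuous_functions (unit_top G)"
    using X.one_in by (simp add: C_alg_def)
  ultimately show "poisson \<mu> \<one>\<^bsub>A\<^esub> = \<one>\<^bsub>galg G (arrow_gspace G) (arrow_functions G)\<^esub>"
    using poisson_incl by metis
  fix n M assume "mat_positive A n M"
  then have M: "\<And>i j. i < n \<Longrightarrow> j < n \<Longrightarrow> M i j \<in> CY" "\<And>y. y \<in> topspace (sptop Y) \<Longrightarrow> psd n (\<lambda>i j. M i j y)"
    unfolding mat_positive_galg by auto
  then show "mat_positive (galg G (arrow_gspace G) (arrow_functions G)) n (\<lambda>i j. poisson \<mu> (M i j))"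
    unfolding R.mat_positive_galg using poisson_in poisson_psd[OF M] by auto
qed

end

end

locale essential_spectrum = compact_galg G Y
  for G :: "'g groupoid" and Y :: "('g, 'y) gspace" +
  fixes A :: "('g, 'a) gcstar" and j :: "('g \<Rightarrow> complex) \<Rightarrow> 'a" and \<Phi> :: "'a \<Rightarrow> 'y \<Rightarrow> complex"
  assumes iso: "gcstar_iso G A (C_galg G Y) \<Phi>"
    and ess: "essential_extension TYPE('g set set \<Rightarrow> complex) G (C_galg G (unit_gspace G)) A j"
begin

lemma galg_A: "gcstar_algebra G A"
  using ess by (simp add: essential_extension_def)

lemma Phi_ucp: "ucp_map A (C_galg G Y) \<Phi>"
  using iso star_iso_ucp[of A "C_galg G Y" \<Phi>] galg_A[THEN gcstar_algebra.axioms(1)] cstar_algebra_galg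
  unfolding gcstar_iso_def C_galg_eq_galg by blast

lemma Phi_in: "a \<in> carrier A \<Longrightarrow> \<Phi> a \<in> CY"
  using Phi_ucp unfolding ucp_map_def C_galg_eq_galg by simp

lemma Phi_incl: "k \<in> continuous_functions (unit_top G) \<Longrightarrow> \<Phi> (incl A k) = incl (C_galg G Y) k"
  using iso unfolding gcstar_iso_def compatible_def by blast

lemma Phi_bact: "\<gamma> \<in> open_bisections G \<Longrightarrow> a \<in> corner G A (src G ` \<gamma>) \<Longrightarrow> \<Phi> (bact A \<gamma> a) = bact (C_galg G Y) \<gamma> (\<Phi> a)"
  using iso unfolding gcstar_iso_def compatible_def by blast

text \<open>By essentiality the Poisson transform of every family of measures on the fibres is a complete
  order embedding, since on \<open>C(G\<^sup>0)\<close> it is composition with the range map.\<close>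

lemma poisson_embedding:
  assumes fam: "\<And>x. x \<in> units G \<Longrightarrow> over (\<mu> x) x"
  shows "gembedding G A (galg G (arrow_gspace G) (arrow_functions G)) (poisson \<mu> \<circ> \<Phi>)"
proof -
  interpret R: gset G "arrow_gspace G" "arrow_functions G" by (rule gset_arrow)
  interpret U: compact_galg G "unit_gspace G" by (rule compact_galg_unit)
  let ?B = "galg G (arrow_gspace G) (arrow_functions G)"
  interpret r: gset_map G "unit_gspace G" "continuous_functions (unit_top G)" "arrow_gspace G" "arrow_functions G"
    "\<lambda>t. rng G (arrow_decode t)"
  proof (intro gset_map.intro gset_map_axioms.intro R.gset_axioms)
    show "gset G (unit_gspace G) (continuous_functions (unit_top G))" using U.gset_axioms by simp
    show "rng G (arrow_decode (act (arrow_gspace G) g y)) = act (unit_gspace G) g (rng G (arrow_decode y))"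
      if "(g, y) \<in> act_dom G (arrow_gspace G)" for g y
    proof -
      have "(g, arrow_decode y) \<in> composable G" using that by (auto simp: act_dom_def composable_def)
      then show ?thesis using rng_mul by simp
    qed
    show "pull (arrow_gspace G) (\<lambda>t. rng G (arrow_decode t)) f \<in> arrow_functions G"
      if "f \<in> continuous_functions (unit_top G)" for f
      using R.incl_in'[OF that] by (simp add: pull_def[abs_def] cong: if_cong)
  qed (auto simp: rng_units)
  have emb: "gembedding G (C_galg G (unit_gspace G)) ?B (pull (arrow_gspace G) (\<lambda>t. rng G (arrow_decode t)))"
    unfolding C_galg_eq_galg unit_gspace_simps
  proof (rule r.pull_gembedding)
    show "(\<lambda>t. rng G (arrow_decode t)) ` topspace (sptop (arrow_gspace G)) = topspace (sptop (unit_gspace G))"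
      using R.proj_surj by simp
  qed
  have "gembedding G (C_galg G (unit_gspace G)) ?B ((poisson \<mu> \<circ> \<Phi>) \<circ> j)"
  proof (rule gembedding_cong[OF _ _ emb])
    show "gcstar_algebra G (C_galg G (unit_gspace G))"
      using U.gcstar_algebra_galg unfolding C_galg_eq_galg .
    fix k assume "k \<in> carrier (C_galg G (unit_gspace G))"
    then have k: "k \<in> continuous_functions (unit_top G)" by (simp add: C_galg_eq_galg)
    \<comment> \<open>A function on the units is its own inclusion, so compatibility determines j on
      all of \<open>C(G\<^sup>0)\<close>.\<close>
    have ik: "incl (C_galg G (unit_gspace G)) k = k"
      using X.vanish[OF k] by (auto simp: C_galg_eq_galg)
    have "j (incl (C_galg G (unit_gspace G)) k) = incl A k"
      using ess k unfolding essential_extension_def gembedding_def gucp_map_def compatible_def by blast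
    then have "(poisson \<mu> \<circ> \<Phi> \<circ> j) k = poisson \<mu> (incl (C_galg G Y) k)"
      using Phi_incl[OF k] by (simp add: ik)
    also have "\<dots> = incl ?B k"
      unfolding C_galg_eq_galg by (rule poisson_incl[OF fam k])
    also have "\<dots> = pull (arrow_gspace G) (\<lambda>t. rng G (arrow_decode t)) k"
      by (simp add: pull_def fun_eq_iff)
    finally show "(poisson \<mu> \<circ> \<Phi> \<circ> j) k = pull (arrow_gspace G) (\<lambda>t. rng G (arrow_decode t)) k" .
  qed
  moreover have "gucp_map G A ?B (poisson \<mu> \<circ> \<Phi>)"
    unfolding gucp_map_def
  proof
    show "ucp_map A ?B (poisson \<mu> \<circ> \<Phi>)"
      using ucp_map_comp[OF Phi_ucp[unfolded C_galg_eq_galg] poisson_ucp[OF fam]] .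
    show "compatible G A ?B (poisson \<mu> \<circ> \<Phi>)"
      unfolding compatible_def
    proof (intro conjI ballI)
      show "(poisson \<mu> \<circ> \<Phi>) (incl A k) = incl ?B k" if "k \<in> continuous_functions (unit_top G)" for k
        using Phi_incl[OF that] poisson_incl[OF fam that] unfolding C_galg_eq_galg o_def by metis
      fix \<gamma> a assume \<gamma>: "\<gamma> \<in> open_bisections G" and a: "a \<in> corner G A (src G ` \<gamma>)"
      have aA: "a \<in> carrier A" using corner_subset[OF galg_A] a by blast
      have "bact A \<gamma> a \<in> carrier A"
        using gcstar_algebra.bact_hom[OF galg_A \<gamma>] a unfolding star_hom_on_def by blast
      then have b: "bact (galg G Y CY) \<gamma> (\<Phi> a) \<in> CY"
        using Phi_in Phi_bact[OF \<gamma> a] unfolding C_galg_eq_galg by metis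
      have "(poisson \<mu> \<circ> \<Phi>) (bact A \<gamma> a) = poisson \<mu> (bact (galg G Y CY) \<gamma> (\<Phi> a))"
        using Phi_bact[OF \<gamma> a] unfolding C_galg_eq_galg by simp
      also have "\<dots> = bact ?B \<gamma> ((poisson \<mu> \<circ> \<Phi>) a)"
        unfolding o_def by (rule poisson_bact[OF fam \<gamma> Phi_in[OF aA] b])
      finally show "(poisson \<mu> \<circ> \<Phi>) (bact A \<gamma> a) = bact ?B \<gamma> ((poisson \<mu> \<circ> \<Phi>) a)" .
    qed
  qed
  moreover have "gcstar_algebra G ?B" by (rule R.gcstar_algebra_galg)
  ultimately show ?thesis
    using ess unfolding essential_extension_def by blast
qed

text \<open>The 1 x 1 case of \<open>poisson_embedding\<close>, carried from A to functions by
  \<Phi>. Contrapositively, a real function that is negative at one point has a negative integral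
  against some translate g \<mu>.\<close>

lemma order_reflect:
  assumes fam: "\<And>x. x \<in> units G \<Longrightarrow> over (\<mu> x) x" and f: "f \<in> CY"
    and pos: "\<And>g. g \<in> arrows G \<Longrightarrow> Im (\<integral>y. f y \<partial>gpush G Y g (\<mu> (src G g))) = 0 \<and>
      0 \<le> Re (\<integral>y. f y \<partial>gpush G Y g (\<mu> (src G g)))"
    and y: "y \<in> topspace (sptop Y)"
  shows "Im (f y) = 0 \<and> 0 \<le> Re (f y)"
proof -
  interpret R: gset G "arrow_gspace G" "arrow_functions G" by (rule gset_arrow)
  let ?B = "galg G (arrow_gspace G) (arrow_functions G)"
  obtain a where a: "a \<in> carrier A" "\<Phi> a = f"
    using iso f unfolding gcstar_iso_def bij_betw_def C_galg_eq_galg galg_simps by (metis imageE)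
  have "psd 1 (\<lambda>i j. poisson \<mu> f (arrow_code g))" if "g \<in> arrows G" for g
    unfolding psd_1 using pos[OF that] that by (simp add: poisson_def)
  then have "mat_positive ?B 1 (\<lambda>i j. (poisson \<mu> \<circ> \<Phi>) a)"
    unfolding R.mat_positive_galg using poisson_in[OF fam f] a(2) by auto
  moreover have "mat_carrier A 1 (\<lambda>i j. a)" using a(1) by (simp add: mat_carrier_def)
  moreover have "\<And>n X. mat_carrier A n X \<Longrightarrow> mat_positive ?B n (\<lambda>i j. (poisson \<mu> \<circ> \<Phi>) (X i j)) \<Longrightarrow> mat_positive A n X"
    using poisson_embedding[OF fam] unfolding gembedding_def complete_order_embedding_def by blast
  ultimately have "mat_positive A 1 (\<lambda>i j. a)" by blast
  then have "mat_positive (C_galg G Y) 1 (\<lambda>i j. \<Phi> a)"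
    using Phi_ucp unfolding ucp_map_def by blast
  then have "psd 1 (\<lambda>i j. f y)"
    unfolding C_galg_eq_galg mat_positive_galg using y a(2) by simp
  then show ?thesis unfolding psd_1 .
qed

lemma irreducible: "irreducible_gspace G Y"
  unfolding irreducible_gspace_def
proof (intro allI impI)
  fix Z assume Z: "closedin (sptop Y) Z" and inv: "\<forall>(g, y)\<in>act_dom G Y. y \<in> Z \<longrightarrow> act Y g y \<in> Z"
    and surj: "proj Y ` Z = units G"
  have ZT: "Z \<subseteq> topspace (sptop Y)" by (rule closedin_subset[OF Z])
  have "\<forall>x. \<exists>z. x \<in> units G \<longrightarrow> z \<in> Z \<and> proj Y z = x" using surj by (metis imageE)
  then obtain s where s: "\<And>x. x \<in> units G \<Longrightarrow> s x \<in> Z \<and> proj Y (s x) = x" by metis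
  \<comment> \<open>Point masses on a section with values in Z: by invariance all their translates
    are point masses in Z.\<close>
  define \<mu> where "\<mu> x = dirac (sptop Y) (s x)" for x
  have sT: "s x \<in> topspace (sptop Y)" if "x \<in> units G" for x using s[OF that] ZT by blast
  have fam: "over (\<mu> x) x" if x: "x \<in> units G" for x
  proof (rule overI_integral[OF _ x])
    show "\<mu> x \<in> P" unfolding \<mu>_def by (rule dirac_prob_measures[OF Hausdorff sT[OF x]])
    show "(\<integral>y. (if y \<in> topspace (sptop Y) then k (proj Y y) else 0) \<partial>\<mu> x) = k x"
      if "k \<in> continuous_functions (unit_top G)" for k
      unfolding \<mu>_def using integral_dirac[OF sT[OF x] proj_continuous_functions[OF that]] s[OF x] sT[OF x] by simp
  qed
  have "topspace (sptop Y) \<subseteq> Z"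
  proof
    fix y assume y: "y \<in> topspace (sptop Y)"
    show "y \<in> Z"
    proof (rule ccontr)
      assume "y \<notin> Z"
      then obtain u where u: "continuous_map (sptop Y) euclideanreal u" "\<And>z. z \<in> Z \<Longrightarrow> u z = 0" "u y = 1"
        using continuous_functions_separate[OF compact Hausdorff Z y] by metis
      \<comment> \<open>All integrals of f against the translates vanish, so
        \<open>order_reflect\<close> makes f nonnegative, while the sign makes its value at y equal
        to -1.\<close>
      define f where "f z = - (if z \<in> topspace (sptop Y) then complex_of_real (u z) else 0)" for z
      have f: "f \<in> CY" unfolding f_def[abs_def] by (intro uminus_in continuous_functions_of_real u(1))
      have fZ: "f z = 0" if "z \<in> Z" for z using u(2)[OF that] by (simp add: f_def)
      have "(\<integral>z. f z \<partial>gpush G Y g (\<mu> (src G g))) = 0" if g: "g \<in> arrows G" for g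
      proof -
        have x: "src G g \<in> units G" by (rule src_units[OF g])
        have gs: "(g, s (src G g)) \<in> act_dom G Y" using g s[OF x] sT[OF x] by (simp add: act_dom_def)
        then have sg: "act Y g (s (src G g)) \<in> Z" using inv s[OF x] by blast
        obtain \<gamma> f' where t: "bact (galg G Y CY) \<gamma> f' \<in> CY"
          "\<And>y. y \<in> fibre (src G g) \<Longrightarrow> bact (galg G Y CY) \<gamma> f' y = f (act Y g y)"
          using translate_ex[OF g f] by metis
        have "(\<integral>z. f z \<partial>gpush G Y g (\<mu> (src G g))) = (\<integral>z. bact (galg G Y CY) \<gamma> f' z \<partial>\<mu> (src G g))"
          by (rule integral_gpush_eq[OF g fam[OF x] f t])
        also have "\<dots> = bact (galg G Y CY) \<gamma> f' (s (src G g))"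
          unfolding \<mu>_def by (rule integral_dirac[OF sT[OF x] t(1)])
        also have "\<dots> = f (act Y g (s (src G g)))"
          using s[OF x] sT[OF x] by (intro t(2)) (simp add: fibre_def)
        finally show ?thesis using fZ[OF sg] by simp
      qed
      then have "0 \<le> Re (f y)" using order_reflect[OF fam f _ y] by simp
      then show False using u(3) y by (simp add: f_def)
    qed
  qed
  then show "Z = topspace (sptop Y)" using ZT by blast
qed

text \<open>A basic neighbourhood involves finitely many functions f, and one function controls them
  all: d, the sum of the |f - f(y)|. As d - e is negative at y, \<open>order_reflect\<close>
  provides a translate that gives d an integral below e.\<close>

lemma dirac_in_closure:
  assumes fam: "\<And>x. x \<in> units G \<Longrightarrow> over (\<mu> x) x" and y: "y \<in> topspace (sptop Y)"
  shows "dirac (sptop Y) y \<in> weak_star_top (sptop Y) closure_of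
    {gpush G Y g (\<mu> x) | x g. x \<in> units G \<and> g \<in> arrows G \<and> src G g = x}"
    (is "_ \<in> _ closure_of ?S")
  unfolding in_closure_of
proof (intro conjI allI impI)
  define \<iota> where "\<iota> = (\<lambda>\<mu>. \<lambda>f\<in>CY. (\<integral>y. f y \<partial>\<mu>) :: complex)"
  let ?R = "product_topology (\<lambda>_. euclidean :: complex topology) CY"
  have w: "weak_star_top (sptop Y) = pullback_topology P \<iota> ?R"
    unfolding weak_star_top_def \<iota>_def ..
  have dP: "dirac (sptop Y) y \<in> P" by (rule dirac_prob_measures[OF Hausdorff y])
  show "dirac (sptop Y) y \<in> topspace (weak_star_top (sptop Y))"
    unfolding w topspace_pullback_topology using dP by (simp add: \<iota>_def)
  fix V assume V: "dirac (sptop Y) y \<in> V \<and> openin (weak_star_top (sptop Y)) V"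
  then obtain W where W: "openin ?R W" "V = \<iota> -` W \<inter> P"
    unfolding w openin_pullback_topology by blast
  have "\<iota> (dirac (sptop Y) y) \<in> W" using V W(2) by blast
  then obtain O' where O: "finite {f \<in> CY. O' f \<noteq> topspace (euclidean :: complex topology)}"
    "\<forall>f\<in>CY. openin euclidean (O' f)" "\<iota> (dirac (sptop Y) y) \<in> Pi\<^sub>E CY O'" "Pi\<^sub>E CY O' \<subseteq> W"
    using bspec[OF W(1)[unfolded openin_product_topology_alt]] by blast
  define F where "F = {f \<in> CY. O' f \<noteq> UNIV}"
  have F: "finite F" "F \<subseteq> CY" using O(1) by (auto simp: F_def)
  have "\<exists>e>0. \<forall>z. cmod (z - f y) < e \<longrightarrow> z \<in> O' f" if "f \<in> F" for f
  proof -
    have fC: "f \<in> CY" using that F(2) by blast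
    have "f y \<in> O' f" using PiE_mem[OF O(3) fC] integral_dirac[OF y fC] fC by (simp add: \<iota>_def)
    moreover have "open (O' f)" using O(2) fC by simp
    ultimately show ?thesis unfolding open_dist dist_norm by blast
  qed
  then obtain ef where ef: "\<And>f. f \<in> F \<Longrightarrow> 0 < ef f" "\<And>f z. f \<in> F \<Longrightarrow> cmod (z - f y) < ef f \<Longrightarrow> z \<in> O' f"
    by metis
  obtain e where e: "0 < e" "\<And>f. f \<in> F \<Longrightarrow> e \<le> ef f"
  proof (cases "F = {}")
    case True
    then show thesis using that[of 1] by simp
  next
    case False
    then show thesis using that[of "Min (ef ` F)"] F(1) ef(1) by simp
  qed
  define d where "d z = (\<Sum>f\<in>F. cmod (f z - f y))" for z
  have dc: "continuous_map (sptop Y) euclideanreal d"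
    unfolding d_def using F
    by (intro continuous_map_sum continuous_map_norm continuous_map_diff) (auto simp: continuous_functions_def)
  define f0 where "f0 z = (if z \<in> topspace (sptop Y) then complex_of_real (d z - e) else 0)" for z
  have f0: "f0 \<in> CY"
    unfolding f0_def[abs_def] using dc by (intro continuous_functions_of_real continuous_map_diff) auto
  have "\<not> 0 \<le> Re (f0 y)" using y e(1) by (simp add: f0_def d_def)
  then obtain g where g: "g \<in> arrows G" "\<not> (Im (\<integral>y. f0 y \<partial>gpush G Y g (\<mu> (src G g))) = 0 \<and>
      0 \<le> Re (\<integral>y. f0 y \<partial>gpush G Y g (\<mu> (src G g))))"
    using order_reflect[OF fam f0 _ y] by blast
  define \<nu> where "\<nu> = gpush G Y g (\<mu> (src G g))"
  have \<nu>P: "\<nu> \<in> P" unfolding \<nu>_def by (rule fam_prob[OF fam g(1)])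
  interpret prob_space \<nu> using prob_measuresD[OF \<nu>P] by blast
  have fi: "integrable \<nu> (\<lambda>z. cmod (f z - f y))" if "f \<in> F" for f
    using integrable_CY[OF \<nu>P] that F(2) by (intro integrable_norm Bochner_Integration.integrable_diff) auto
  have di: "integrable \<nu> d" unfolding d_def using fi by (intro Bochner_Integration.integrable_sum)
  have "(\<integral>z. f0 z \<partial>\<nu>) = (\<integral>z. complex_of_real (d z - e) \<partial>\<nu>)"
    using prob_measuresD(3)[OF \<nu>P] by (intro Bochner_Integration.integral_cong) (auto simp: f0_def)
  also have "\<dots> = complex_of_real (\<integral>z. d z - e \<partial>\<nu>)" by (rule integral_complex_of_real)
  finally have "(\<integral>z. d z - e \<partial>\<nu>) < 0" using g(2) unfolding \<nu>_def[symmetric] by simp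
  then have d_less: "(\<integral>z. d z \<partial>\<nu>) < e" using di by (simp add: prob_space)
  have "(\<integral>z. f z \<partial>\<nu>) \<in> O' f" if "f \<in> F" for f
  proof (rule ef(2)[OF that])
    have i: "integrable \<nu> f" using integrable_CY[OF \<nu>P] that F(2) by blast
    have "(\<integral>z. f z \<partial>\<nu>) - f y = (\<integral>z. f z - f y \<partial>\<nu>)" using i by (simp add: prob_space)
    also have "cmod \<dots> \<le> (\<integral>z. cmod (f z - f y) \<partial>\<nu>)" by (rule integral_norm_bound)
    also have "\<dots> \<le> (\<integral>z. d z \<partial>\<nu>)"
      using fi[OF that] di F(1) that unfolding d_def by (intro integral_mono member_le_sum) auto
    also have "\<dots> < ef f" using d_less e(2)[OF that] by linarith
    finally show "cmod ((\<integral>z. f z \<partial>\<nu>) - f y) < ef f" .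
  qed
  then have "\<iota> \<nu> \<in> Pi\<^sub>E CY O'"
    unfolding \<iota>_def by (auto simp: F_def)
  then have "\<nu> \<in> V" using O(4) W(2) \<nu>P by blast
  moreover have "\<nu> \<in> ?S" using g(1) src_units[OF g(1)] unfolding \<nu>_def by blast
  ultimately show "\<exists>\<nu>. \<nu> \<in> ?S \<and> \<nu> \<in> V" by blast
qed

text \<open>Every Dirac measure is a limit of translates, which is more than one over each unit as
  strong proximality asks.\<close>

lemma gboundary: "gboundary G Y"
  unfolding gboundary_def strongly_proximal_def
proof (intro conjI allI impI compact_gspace_axioms irreducible)
  fix \<mu> assume "fibre_family G Y \<mu>"
  then have fam: "\<And>x. x \<in> units G \<Longrightarrow> over (\<mu> x) x" by (simp add: fibre_family_over)
  show "units G \<subseteq> proj Y ` {y \<in> topspace (sptop Y). dirac (sptop Y) y \<in> weak_star_top (sptop Y) closure_of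
      {gpush G Y g (\<mu> x) | x g. x \<in> units G \<and> g \<in> arrows G \<and> src G g = x}}"
  proof
    fix x assume "x \<in> units G"
    then have "x \<in> proj Y ` T" unfolding proj_surj .
    then obtain y where "x = proj Y y" "y \<in> T" by (rule imageE)
    then show "x \<in> proj Y ` {y \<in> T. dirac (sptop Y) y \<in> weak_star_top (sptop Y) closure_of
        {gpush G Y g (\<mu> x) | x g. x \<in> units G \<and> g \<in> arrows G \<and> src G g = x}}"
      using dirac_in_closure[OF fam] by (intro image_eqI CollectI conjI)
  qed
qed

end


section \<open>Comparison of the two boundaries\<close>

lemma psd_average:
  assumes M: "psd n M" and N: "psd n N"
  shows "psd n (\<lambda>i j. (M i j + N i j) / 2)"
  unfolding psd_def
proof (intro conjI allI impI)
  show "(M j i + N j i) / 2 = cnj ((M i j + N i j) / 2)" if "i < n" "j < n" for i j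
    unfolding psd_hermitian[OF M that] psd_hermitian[OF N that] by simp
  fix v :: "nat \<Rightarrow> complex"
  have eq: "(\<Sum>i<n. \<Sum>j<n. cnj (v i) * ((M i j + N i j) / 2) * v j) =
      ((\<Sum>i<n. \<Sum>j<n. cnj (v i) * M i j * v j) + (\<Sum>i<n. \<Sum>j<n. cnj (v i) * N i j * v j)) / 2"
    by (simp add: sum.distrib[symmetric] sum_divide_distrib algebra_simps add_divide_distrib)
  show "0 \<le> Re (\<Sum>i<n. \<Sum>j<n. cnj (v i) * ((M i j + N i j) / 2) * v j)"
    unfolding eq using psd_nonneg[OF M, of v] psd_nonneg[OF N, of v] by (simp del: Re_sum)
qed

lemma (in gset_map) pull_corner:
  assumes "f \<in> corner G Z.A U"
  shows "pull Y q f \<in> corner G Y.A U"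
proof -
  have f: "f \<in> W" "dominated G Z U f" using assms unfolding Z.corner_eq by auto
  have "dominated G Y U (pull Y q f)"
    unfolding dominated_def
  proof (intro allI impI)
    fix e :: real assume "e > 0"
    then obtain k where k: "k \<in> C0_fun G U" "\<forall>z\<in>topspace (sptop Z). cmod (f z) \<le> e + cmod (k (proj Z z))"
      using f(2) unfolding dominated_def by blast
    have "cmod (pull Y q f y) \<le> e + cmod (k (proj Y y))" if y: "y \<in> topspace (sptop Y)" for y
      using bspec[OF k(2) map_into[OF y]] map_proj[OF y] y by (simp add: pull_def)
    then show "\<exists>k\<in>C0_fun G U. \<forall>y\<in>topspace (sptop Y). cmod (pull Y q f y) \<le> e + cmod (k (proj Y y))"
      using k(1) by blast
  qed
  then show ?thesis using pull_in[OF f(1)] unfolding Y.corner_eq by simp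
qed

lemma gmap_gset_map:
  assumes Z: "compact_galg G Z" and Y: "compact_galg G Y" and q: "gmap G Y Z q"
  shows "gset_map G Z (continuous_functions (sptop Z)) Y (continuous_functions (sptop Y)) q"
proof -
  interpret Z: compact_galg G Z by fact
  interpret Y: compact_galg G Y by fact
  have c: "continuous_map (sptop Y) (sptop Z) q" using q by (simp add: gmap_def)
  show ?thesis
  proof (intro gset_map.intro gset_map_axioms.intro Z.gset_axioms Y.gset_axioms)
    show "q y \<in> topspace (sptop Z)" if "y \<in> topspace (sptop Y)" for y
      using continuous_map_image_subset_topspace[OF c] that by blast
    show "proj Z (q y) = proj Y y" if "y \<in> topspace (sptop Y)" for y
      using q that by (simp add: gmap_def)
    show "q (act Y g y) = act Z g (q y)" if "(g, y) \<in> act_dom G Y" for g y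
      using q that by (auto simp: gmap_def)
    show "pull Y q f \<in> continuous_functions (sptop Y)" if f: "f \<in> continuous_functions (sptop Z)" for f
    proof -
      have "continuous_map (sptop Y) euclidean (f \<circ> q)"
        using f by (intro continuous_map_compose[OF c]) (simp add: continuous_functions_def)
      then have "continuous_map (sptop Y) euclidean (pull Y q f)"
        by (rule continuous_map_eq) (simp add: pull_def)
      then show ?thesis by (simp add: continuous_functions_def pull_def)
    qed
  qed
qed

text \<open>Two maps \<open>q1\<close>, \<open>q2\<close> are compared through the average of the two pullbacks, which is again
  dual to a map.\<close>

lemma gmap_unique:
  assumes Z: "compact_galg G Z" and Y: "compact_galg G Y"
    and sp: "strongly_proximal G Z" and irr: "irreducible_gspace G Y"
    and q1: "gmap G Y Z q1" and q2: "gmap G Y Z q2" and y: "y \<in> topspace (sptop Y)"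
  shows "q1 y = q2 y"
proof -
  interpret Z: compact_galg G Z by fact
  interpret Y: compact_galg G Y by fact
  interpret a: gset_map G Z Z.CY Y Y.CY q1 by (rule gmap_gset_map[OF Z Y q1])
  interpret b: gset_map G Z Z.CY Y Y.CY q2 by (rule gmap_gset_map[OF Z Y q2])
  define \<psi> where "\<psi> f = (\<lambda>y. (pull Y q1 f y + pull Y q2 f y) / 2)" for f :: "_ \<Rightarrow> complex"
  have psi_in: "\<psi> f \<in> Y.CY" if "f \<in> Z.CY" for f
    using Y.scale_in[OF Y.add_in[OF a.pull_in[OF that] b.pull_in[OF that]], of "1 / 2"]
    by (simp add: \<psi>_def)
  interpret g: gucp_pair G Z Y \<psi>
  proof
    show "ucp_map (C_galg G Z) (C_galg G Y) \<psi>"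
      unfolding ucp_map_def C_galg_eq_galg
    proof (intro conjI ballI allI impI)
      fix n X assume X: "mat_positive Z.A n X"
      then have X': "\<And>i j. i < n \<Longrightarrow> j < n \<Longrightarrow> X i j \<in> Z.CY" "\<And>z. z \<in> topspace (sptop Z) \<Longrightarrow> psd n (\<lambda>i j. X i j z)"
        unfolding Z.mat_positive_galg by auto
      have "psd n (\<lambda>i j. \<psi> (X i j) t)" if t: "t \<in> topspace (sptop Y)" for t
        using psd_average[OF X'(2)[OF a.map_into[OF t]] X'(2)[OF b.map_into[OF t]]] t
        by (simp add: \<psi>_def pull_def)
      then show "mat_positive Y.A n (\<lambda>i j. \<psi> (X i j))"
        unfolding Y.mat_positive_galg using psi_in X'(1) by simp
    qed (auto simp: psi_in, auto simp: \<psi>_def pull_def fun_eq_iff field_simps a.map_into b.map_into)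
    show "\<psi> (incl (C_galg G Z) k) = incl (C_galg G Y) k" for k
      unfolding C_galg_eq_galg
      by (auto simp: \<psi>_def pull_def a.map_into b.map_into a.map_proj b.map_proj)
    show "\<psi> (bact (C_galg G Z) \<gamma> f) = bact (C_galg G Y) \<gamma> (\<psi> f)" if "\<gamma> \<in> open_bisections G" for \<gamma> f
      unfolding C_galg_eq_galg \<psi>_def a.pull_bact[OF that] b.pull_bact[OF that] by auto
  qed
  obtain q where q: "gmap G Y Z q" "\<And>f y. f \<in> Z.CY \<Longrightarrow> y \<in> topspace (sptop Y) \<Longrightarrow> \<psi> f y = f (q y)"
    using g.dual_gmap[OF sp irr] by blast
  have qy: "q y \<in> topspace (sptop Z)"
    using continuous_map_image_subset_topspace[of "sptop Y" "sptop Z" q] q(1) y by (auto simp: gmap_def)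
  \<comment> \<open>The point mass at q y is the average of those at q1 y and q2 y. A nonnegative
    function that is 0 at q y has average 0, hence vanishes at both points.\<close>
  have vanish: "u (q1 y) = 0 \<and> u (q2 y) = 0"
    if u: "continuous_map (sptop Z) euclideanreal u" "\<And>z. z \<in> topspace (sptop Z) \<Longrightarrow> 0 \<le> u z" "u (q y) = 0" for u
  proof -
    have "\<psi> (\<lambda>z. if z \<in> topspace (sptop Z) then complex_of_real (u z) else 0) y = 0"
      using q(2)[OF continuous_functions_of_real[OF u(1)] y] u(3) by simp
    then have "complex_of_real (u (q1 y) + u (q2 y)) = 0"
      using y a.map_into[OF y] b.map_into[OF y] by (simp add: \<psi>_def pull_def)
    then have "u (q1 y) + u (q2 y) = 0" by (simp only: of_real_eq_0_iff)
    then show ?thesis using u(2)[OF a.map_into[OF y]] u(2)[OF b.map_into[OF y]] by linarith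
  qed
  have eq: "z = q y" if z: "z \<in> topspace (sptop Z)" "z = q1 y \<or> z = q2 y" for z
  proof (rule ccontr)
    assume "z \<noteq> q y"
    then obtain u where "continuous_map (sptop Z) euclideanreal u" "\<And>z. z \<in> topspace (sptop Z) \<Longrightarrow> 0 \<le> u z"
      "u (q y) = 0" "u z = 1"
      using continuous_functions_separate[OF Z.compact Z.Hausdorff closedin_Hausdorff_singleton[OF Z.Hausdorff qy] z(1)]
      by (metis singletonD singletonI)
    then show False using vanish[of u] z(2) by auto
  qed
  show ?thesis using eq[OF a.map_into[OF y]] eq[OF b.map_into[OF y]] by simp
qed

section \<open>Copies of spaces in the universe type\<close>

definition transport :: "('y \<Rightarrow> 'u) \<Rightarrow> ('g, 'y) gspace \<Rightarrow> ('g, 'u) gspace" where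
  "transport e Y = \<lparr>
     sptop = pullback_topology (e ` topspace (sptop Y)) (the_inv_into (topspace (sptop Y)) e) (sptop Y),
     proj = (\<lambda>t. proj Y (the_inv_into (topspace (sptop Y)) e t)),
     act = (\<lambda>g t. e (act Y g (the_inv_into (topspace (sptop Y)) e t)))\<rparr>"

lemma transport_simps:
  "sptop (transport e Y) = pullback_topology (e ` topspace (sptop Y)) (the_inv_into (topspace (sptop Y)) e) (sptop Y)"
  "proj (transport e Y) t = proj Y (the_inv_into (topspace (sptop Y)) e t)"
  "act (transport e Y) g t = e (act Y g (the_inv_into (topspace (sptop Y)) e t))"
  by (simp_all add: transport_def)

text \<open>Universality and injectivity quantify over objects in one universe type; a space of
  another type enters through a copy along an injection.\<close>

lemma transport_properties:
  assumes Y: "compact_galg G Y" and inj: "inj_on e (topspace (sptop Y))"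
  defines "i \<equiv> the_inv_into (topspace (sptop Y)) e"
  shows "compact_galg G (transport e Y)" "gmap G Y (transport e Y) e" "gmap G (transport e Y) Y i"
    "topspace (sptop (transport e Y)) = e ` topspace (sptop Y)"
    "\<And>y. y \<in> topspace (sptop Y) \<Longrightarrow> i (e y) = y"
proof -
  interpret Y: compact_galg G Y by fact
  let ?T = "topspace (sptop Y)" and ?Y' = "transport e Y"
  have ie: "i (e y) = y" if "y \<in> ?T" for y
    unfolding i_def using inj that by (rule the_inv_into_f_f)
  then show "\<And>y. y \<in> ?T \<Longrightarrow> i (e y) = y" .
  have st: "sptop ?Y' = pullback_topology (e ` ?T) i (sptop Y)" by (simp add: transport_simps i_def)
  have pr: "proj ?Y' t = proj Y (i t)" and ac: "act ?Y' g t = e (act Y g (i t))" for g t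
    by (simp_all add: transport_simps i_def)
  show T': "topspace (sptop ?Y') = e ` ?T"
    unfolding st topspace_pullback_topology using ie by auto
  have ce: "continuous_map (sptop Y) (sptop ?Y') e"
    unfolding st
  proof (rule continuous_map_pullback')
    show "continuous_map (sptop Y) (sptop Y) (i \<circ> e)"
      by (rule continuous_map_eq[OF continuous_map_id]) (simp add: ie)
  qed auto
  have ci: "continuous_map (sptop ?Y') (sptop Y) i"
    using continuous_map_pullback[OF continuous_map_id, of "e ` ?T" i "sptop Y"] by (simp add: st)
  have hom: "homeomorphic_maps (sptop Y) (sptop ?Y') e i"
    unfolding homeomorphic_maps_def using ce ci ie T' by auto
  then have hs: "sptop Y homeomorphic_space sptop ?Y'" unfolding homeomorphic_space_def by blast
  have dom: "(g, i t) \<in> act_dom G Y" "t = e (i t)" if "(g, t) \<in> act_dom G ?Y'" for g t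
    using that ie by (auto simp: act_dom_def T' pr)
  show "compact_galg G ?Y'"
  proof (intro compact_galg.intro Y.compact_groupoid_axioms compact_gspace.intro)
    show "compact_space (sptop ?Y')" using homeomorphic_compact_space[OF hs] Y.compact by simp
    show "Hausdorff_space (sptop ?Y')" using homeomorphic_Hausdorff_space[OF hs] Y.Hausdorff by simp
    show "continuous_map (sptop ?Y') (unit_top G) (proj ?Y')"
      using continuous_map_compose[OF ci Y.continuous_proj] by (simp add: o_def pr[abs_def])
    show "proj ?Y' ` topspace (sptop ?Y') = units G"
      unfolding T' image_image pr Y.proj_surj[symmetric] by (intro image_cong refl) (simp add: ie)
    show "act ?Y' g t \<in> topspace (sptop ?Y')" if "(g, t) \<in> act_dom G ?Y'" for g t
      unfolding T' ac using Y.act_closed[OF dom(1)[OF that]] by blast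
    show "proj ?Y' (act ?Y' g t) = rng G g" if "(g, t) \<in> act_dom G ?Y'" for g t
      unfolding ac pr using Y.act_closed[OF dom(1)[OF that]] Y.proj_act[OF dom(1)[OF that]] by (simp add: ie)
    show "act ?Y' (proj ?Y' t) t = t" if "t \<in> topspace (sptop ?Y')" for t
      using that Y.act_unit unfolding T' ac pr by (auto simp: ie)
    show "act ?Y' (gmul G g h) t = act ?Y' g (act ?Y' h t)"
      if "(g, h) \<in> composable G" "(h, t) \<in> act_dom G ?Y'" for g h t
      unfolding ac using Y.act_mul[OF that(1) dom(1)[OF that(2)]] Y.act_closed[OF dom(1)[OF that(2)]]
      by (simp add: ie)
    show "continuous_map (subtopology (prod_topology (gtop G) (sptop ?Y')) (act_dom G ?Y')) (sptop ?Y')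
        (\<lambda>(g, y). act ?Y' g y)"
    proof -
      have "continuous_map (subtopology (prod_topology (gtop G) (sptop ?Y')) (act_dom G ?Y'))
          (prod_topology (gtop G) (sptop Y)) (\<lambda>p. (fst p, (i \<circ> snd) p))"
        by (intro continuous_map_pairedI continuous_map_from_subtopology continuous_map_fst
            continuous_map_compose[OF continuous_map_snd ci])
      then have "continuous_map (subtopology (prod_topology (gtop G) (sptop ?Y')) (act_dom G ?Y'))
          (subtopology (prod_topology (gtop G) (sptop Y)) (act_dom G Y)) (\<lambda>p. (fst p, (i \<circ> snd) p))"
        by (intro continuous_map_into_subtopology) (auto intro: dom)
      from continuous_map_compose[OF continuous_map_compose[OF this Y.continuous_act] ce]
      show ?thesis by (simp add: o_def case_prod_beta' ac)
    qed
  qed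
  show "gmap G Y ?Y' e"
    unfolding gmap_def using ce Y.act_closed by (auto simp: pr ac ie act_dom_def)
  show "gmap G ?Y' Y i"
    unfolding gmap_def
  proof (intro conjI ci ballI)
    show "proj Y (i t) = proj ?Y' t" for t by (simp add: pr)
    fix p assume "p \<in> act_dom G ?Y'"
    then show "case p of (g, t) \<Rightarrow> i (act ?Y' g t) = act Y g (i t)"
      using dom(1) Y.act_closed by (cases p) (auto simp: ac ie)
  qed
qed

text \<open>The orbits of any section are dense, so a point is determined by the sets of arrows whose
  translates of the section accumulate at it.\<close>

lemma (in compact_galg) irreducible_code:
  assumes irr: "irreducible_gspace G Y"
  obtains e :: "'y \<Rightarrow> 'g set set" where "inj_on e (topspace (sptop Y))"
proof -
  have "\<exists>y. x \<in> units G \<longrightarrow> y \<in> T \<and> proj Y y = x" for x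
    using proj_surj by (metis imageE)
  then obtain s where s: "\<And>x. x \<in> units G \<Longrightarrow> s x \<in> T \<and> proj Y (s x) = x" by metis
  define r where "r g = act Y g (s (src G g))" for g
  have r_dom: "(g, s (src G g)) \<in> act_dom G Y" if "g \<in> arrows G" for g
    using that s[OF src_units[OF that]] by (simp add: act_dom_def)
  have r_T: "r g \<in> T" and r_proj: "proj Y (r g) = rng G g" if "g \<in> arrows G" for g
    unfolding r_def using act_closed[OF r_dom[OF that]] proj_act[OF r_dom[OF that]] .
  define Z where "Z = sptop Y closure_of (r ` arrows G)"
  have ZT: "Z \<subseteq> T" unfolding Z_def by (rule closure_of_subset_topspace)
  have rZ: "r g \<in> Z" if "g \<in> arrows G" for g
    unfolding Z_def using closure_of_subset[of "r ` arrows G" "sptop Y"] r_T that by blast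
  have "act Y g y \<in> Z" if gy: "(g, y) \<in> act_dom G Y" and y: "y \<in> Z" for g y
  proof -
    have g: "g \<in> arrows G" and yT: "y \<in> T" and yp: "proj Y y = src G g" using gy by (auto simp: act_dom_def)
    \<comment> \<open>The arrow g acts on one fibre, while orbit points close to y may lie in other
      fibres. A bisection through the inverse of g extends the action of g to a neighbourhood of y,
      and it maps orbit points to orbit points.\<close>
    obtain \<gamma> where \<gamma>: "\<gamma> \<in> open_bisections G" "ginv G g \<in> \<gamma>" using bisection_ex[OF inv_closed[OF g]] by blast
    define U where "U = {t \<in> T. proj Y t \<in> rng G ` \<gamma>}"
    define \<tau> where "\<tau> t = act Y (ginv G (arr \<gamma> (proj Y t))) t" for t
    have Uo: "openin (sptop Y) U" unfolding U_def by (rule bisection_preimage_open[OF \<gamma>(1)])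
    have c: "continuous_map (subtopology (sptop Y) U) (sptop Y) \<tau>"
      unfolding \<tau>_def[abs_def] U_def by (rule continuous_bisection_act[OF \<gamma>(1)])
    have yU: "y \<in> U" using yT yp \<gamma>(2) rng_inv[OF g] unfolding U_def by force
    have ty: "\<tau> y = act Y g y"
      using arr_rng[OF \<gamma>] yp by (simp add: \<tau>_def rng_inv[OF g] inv_inv[OF g])
    show ?thesis
      unfolding Z_def in_closure_of
    proof (intro conjI allI impI)
      show "act Y g y \<in> T" by (rule act_closed[OF gy])
      fix W assume W: "act Y g y \<in> W \<and> openin (sptop Y) W"
      then have "openin (subtopology (sptop Y) U) {t \<in> topspace (subtopology (sptop Y) U). \<tau> t \<in> W}"
        using openin_continuous_map_preimage[OF c] by blast
      then have No: "openin (sptop Y) {t \<in> topspace (subtopology (sptop Y) U). \<tau> t \<in> W}" (is "openin _ ?N")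
        using Uo openin_trans_full by blast
      have yN: "y \<in> ?N" using yU yT ty W by simp
      have "\<exists>z. z \<in> r ` arrows G \<and> z \<in> ?N"
        using y No yN unfolding Z_def in_closure_of by (elim conjE allE[of _ ?N]) simp
      then obtain h where h: "h \<in> arrows G" "r h \<in> U" "\<tau> (r h) \<in> W" by auto
      obtain k where k: "k \<in> \<gamma>" "rng G h = rng G k"
        using h(2) r_proj[OF h(1)] unfolding U_def by auto
      have ka: "k \<in> arrows G" by (rule bisection_arrows[OF \<gamma>(1) k(1)])
      have comp: "(ginv G k, h) \<in> composable G"
        using ka h(1) k(2) by (simp add: composable_def inv_closed src_inv)
      have "\<tau> (r h) = act Y (ginv G k) (r h)"
        using arr_rng[OF \<gamma>(1) k(1)] r_proj[OF h(1)] k(2) by (simp add: \<tau>_def)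
      also have "\<dots> = r (gmul G (ginv G k) h)"
        unfolding r_def src_mul[OF comp] by (rule act_mul[OF comp r_dom[OF h(1)], symmetric])
      finally show "\<exists>z. z \<in> r ` arrows G \<and> z \<in> W"
        using h(3) mul_closed[OF comp] by auto
    qed
  qed
  moreover have "proj Y ` Z = units G"
  proof
    show "proj Y ` Z \<subseteq> units G"
      using ZT proj_units by (intro image_subsetI) auto
    show "units G \<subseteq> proj Y ` Z"
    proof
      fix x assume x: "x \<in> units G"
      then have xa: "x \<in> arrows G" using units_subset by blast
      show "x \<in> proj Y ` Z" using rZ[OF xa] r_proj[OF xa] rng_unit[OF x] by (intro image_eqI[of _ _ "r x"]) auto
    qed
  qed
  moreover have "closedin (sptop Y) Z" unfolding Z_def by simp
  ultimately have Z: "Z = T"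
    using irr unfolding irreducible_gspace_def by auto
  define e where "e y = {S. S \<subseteq> arrows G \<and> y \<in> sptop Y closure_of (r ` S)}" for y
  have "inj_on e T"
  proof (rule inj_onI, rule ccontr)
    fix y y' assume y: "y \<in> T" "y' \<in> T" and eq: "e y = e y'" and ne: "y \<noteq> y'"
    then obtain U V where U: "openin (sptop Y) U" "y \<in> U" and V: "openin (sptop Y) V" "y' \<in> V" and d: "disjnt U V"
      using Hausdorff unfolding Hausdorff_space_def by metis
    \<comment> \<open>The orbit points in U accumulate at y but avoid V, a neighbourhood of y', so S
      belongs to the code of y and not to that of y'.\<close>
    define S where "S = {g \<in> arrows G. r g \<in> U}"
    have "y \<in> sptop Y closure_of (r ` S)"
      unfolding in_closure_of
    proof (intro conjI allI impI y(1))
      fix W assume W: "y \<in> W \<and> openin (sptop Y) W"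
      have "y \<in> Z" using y(1) Z by simp
      then have "\<exists>z. z \<in> r ` arrows G \<and> z \<in> W \<inter> U"
        using W U openin_Int[of "sptop Y" W U] unfolding Z_def in_closure_of by blast
      then show "\<exists>z. z \<in> r ` S \<and> z \<in> W" unfolding S_def by auto
    qed
    then have "S \<in> e y'" unfolding eq[symmetric] by (simp add: e_def S_def)
    then have "y' \<in> sptop Y closure_of (r ` S)" by (simp add: e_def)
    then obtain z where "z \<in> r ` S" "z \<in> V" using V unfolding in_closure_of by blast
    then show False using d unfolding S_def disjnt_def by auto
  qed
  then show thesis by (rule that)
qed

text \<open>The factorisation of \<Phi> a lifts to A, since \<Phi> is multiplicative and bijective.
  Hence a is literally one of the products whose closure is the corner, and no limit has to be taken
  in A.\<close>

lemma (in essential_spectrum) iso_corner: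
  assumes a: "a \<in> carrier A" and c: "\<Phi> a \<in> corner G (C_galg G Y) U"
  shows "a \<in> corner G A U"
proof -
  interpret A: gcstar_algebra G A by (rule galg_A)
  have hom: "star_hom_on (carrier A) A (C_galg G Y) \<Phi>" and bij: "bij_betw \<Phi> (carrier A) CY"
    using iso unfolding gcstar_iso_def C_galg_eq_galg by simp_all
  have "\<Phi> a \<in> CY" "dominated G Y U (\<Phi> a)"
    using c unfolding C_galg_eq_galg corner_eq by auto
  then obtain u b where u: "u \<in> C0_fun G U" and b: "b \<in> CY"
    and eq: "\<Phi> a = (\<lambda>t. incl (galg G Y CY) u t * b t * incl (galg G Y CY) u t)"
    using dominated_factor by blast
  obtain b' where b': "b' \<in> carrier A" "\<Phi> b' = b"
    using bij b unfolding bij_betw_def by (metis imageE)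
  have iu: "incl A u \<in> carrier A"
    using A.incl_hom C0_continuous[OF u] unfolding star_hom_on_def by blast
  let ?x = "incl A u \<otimes>\<^bsub>A\<^esub> b' \<otimes>\<^bsub>A\<^esub> incl A u"
  have "\<Phi> ?x = \<Phi> (incl A u \<otimes>\<^bsub>A\<^esub> b') \<otimes>\<^bsub>C_galg G Y\<^esub> \<Phi> (incl A u)"
    using hom iu b'(1) A.m_closed[OF iu b'(1)] unfolding star_hom_on_def by blast
  also have "\<Phi> (incl A u \<otimes>\<^bsub>A\<^esub> b') = \<Phi> (incl A u) \<otimes>\<^bsub>C_galg G Y\<^esub> \<Phi> b'"
    using hom iu b'(1) unfolding star_hom_on_def by blast
  finally have "\<Phi> ?x = \<Phi> a"
    unfolding eq Phi_incl[OF C0_continuous[OF u]] b'(2) C_galg_eq_galg by simp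
  then have ax: "a = ?x"
    using bij a A.m_closed[OF A.m_closed[OF iu b'(1)] iu] unfolding bij_betw_def by (auto dest: inj_onD)
  let ?S = "{incl A f \<otimes>\<^bsub>A\<^esub> a \<otimes>\<^bsub>A\<^esub> incl A h | f a h. f \<in> C0_fun G U \<and> a \<in> carrier A \<and> h \<in> C0_fun G U}"
  have "incl A k \<in> carrier A" if "k \<in> C0_fun G U" for k
    using A.incl_hom C0_continuous[OF that] unfolding star_hom_on_def by blast
  then have "?S \<subseteq> topspace (norm_top A)"
    unfolding A.topspace_norm_top by auto
  then have "?S \<subseteq> norm_top A closure_of ?S" by (rule closure_of_subset)
  moreover have "a \<in> ?S" using ax u b'(1) by blast
  ultimately show ?thesis unfolding corner_def by blast
qed

text \<open>A copy of the spectrum is again a spectrum of A and so inherits the results of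
  \<open>essential_spectrum\<close>; in particular it is a boundary, without transporting that
  property itself.\<close>

lemma is_spectrum_transport:
  assumes e: "essential_spectrum G Y A j \<Phi>" and Y': "compact_galg G Y'"
    and f: "gmap G Y' Y f" and g: "gmap G Y Y' g"
    and fg: "\<And>y. y \<in> topspace (sptop Y) \<Longrightarrow> f (g y) = y" and gf: "\<And>y. y \<in> topspace (sptop Y') \<Longrightarrow> g (f y) = y"
  shows "essential_spectrum G Y' A j (pull Y' f \<circ> \<Phi>)"
proof -
  interpret E: essential_spectrum G Y A j \<Phi> by fact
  interpret Y': compact_galg G Y' by fact
  interpret f: gset_map G Y E.CY Y' Y'.CY f by (rule gmap_gset_map[OF E.compact_galg_axioms Y' f])
  interpret g: gset_map G Y' Y'.CY Y E.CY g by (rule gmap_gset_map[OF Y' E.compact_galg_axioms g])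
  have hom: "star_hom_on (carrier A) A (C_galg G Y) \<Phi>" and bij: "bij_betw \<Phi> (carrier A) E.CY"
    using E.iso unfolding gcstar_iso_def C_galg_eq_galg by simp_all
  have pfg: "pull Y g (pull Y' f k) = k" if "k \<in> E.CY" for k
    using E.vanish[OF that] g.map_into by (auto simp: pull_def fg)
  have pgf: "pull Y' f (pull Y g k) = k" if "k \<in> Y'.CY" for k
    using Y'.vanish[OF that] f.map_into by (auto simp: pull_def gf)
  have "bij_betw (pull Y' f) E.CY Y'.CY"
    by (rule bij_betw_byWitness[where f' = "pull Y g"]) (auto simp: pfg pgf f.pull_in g.pull_in)
  then have "bij_betw (pull Y' f \<circ> \<Phi>) (carrier A) (carrier (C_galg G Y'))"
    unfolding C_galg_eq_galg galg_simps using bij by (rule bij_betw_trans[rotated])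
  moreover have "star_hom_on (carrier A) A (C_galg G Y') (pull Y' f \<circ> \<Phi>)"
    using hom f.pull_in unfolding star_hom_on_def C_galg_eq_galg by (auto simp: pull_def)
  moreover have "compatible G A (C_galg G Y') (pull Y' f \<circ> \<Phi>)"
    unfolding compatible_def
  proof (intro conjI ballI)
    show "(pull Y' f \<circ> \<Phi>) (incl A k) = incl (C_galg G Y') k" if "k \<in> continuous_functions (unit_top G)" for k
      using E.Phi_incl[OF that] f.map_into f.map_proj unfolding C_galg_eq_galg by (auto simp: pull_def)
    show "(pull Y' f \<circ> \<Phi>) (bact A \<gamma> a) = bact (C_galg G Y') \<gamma> ((pull Y' f \<circ> \<Phi>) a)"
      if "\<gamma> \<in> open_bisections G" "a \<in> corner G A (src G ` \<gamma>)" for \<gamma> a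
      using E.Phi_bact[OF that] f.pull_bact[OF that(1)] unfolding C_galg_eq_galg by simp
  qed
  ultimately have "gcstar_iso G A (C_galg G Y') (pull Y' f \<circ> \<Phi>)"
    unfolding gcstar_iso_def by blast
  then show ?thesis
    by (intro essential_spectrum.intro essential_spectrum_axioms.intro Y' E.ess)
qed

text \<open>The map is dual to an extension of the inclusion of \<open>C(G\<^sup>0)\<close> in \<open>A\<close> to \<open>C(Z)\<close>. Injectivity
  of \<open>A\<close> is only available for test objects in the universe type, so \<open>G\<^sup>0\<close> and \<open>Z\<close> are replaced by
  copies in \<open>'g set set\<close>.\<close>

lemma (in essential_spectrum) gmap_to_boundary:
  fixes Z :: "('g, 'z) gspace"
  assumes inj: "ginjective TYPE('g set set \<Rightarrow> complex) G A" and Z: "gboundary G Z"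
  obtains q where "gmap G Y Z q"
proof -
  have Zc: "compact_galg G Z" and sp: "strongly_proximal G Z" and irr: "irreducible_gspace G Z"
    using Z compact_groupoid_axioms by (auto simp: gboundary_def intro: compact_galg.intro)
  interpret Z: compact_galg G Z by (rule Zc)
  interpret U: compact_galg G "unit_gspace G" by (rule compact_galg_unit)
  obtain e :: "'z \<Rightarrow> 'g set set" where e: "inj_on e (topspace (sptop Z))"
    using Z.irreducible_code[OF irr] by blast
  define Z' where "Z' = transport e Z"
  note tZ = transport_properties[OF Zc e, folded Z'_def]
  interpret Z': compact_galg G Z' by (rule tZ(1))
  \<comment> \<open>The copy of the units is the smaller algebra in the extension problem that
    injectivity solves.\<close>
  define X' where "X' = transport (arrow_code :: 'g \<Rightarrow> 'g set set) (unit_gspace G)"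
  have inj_code: "inj_on arrow_code (topspace (sptop (unit_gspace G)))"
    by (rule inj_onI) (simp add: arrow_code_def)
  note tX = transport_properties[OF compact_galg_unit inj_code, folded X'_def]
  interpret X': compact_galg G X' by (rule tX(1))
  interpret x: gset_map G X' X'.CY "unit_gspace G" U.CY arrow_code
    by (rule gmap_gset_map[OF tX(1) compact_galg_unit tX(2)])
  have "gmap G Z' (unit_gspace G) (proj Z')"
    unfolding gmap_def using Z'.continuous_proj Z'.proj_act by auto
  then have pX: "gmap G Z' X' (arrow_code \<circ> proj Z')"
    using tX(2) unfolding gmap_def
    by (auto intro: continuous_map_compose simp: act_dom_def Z'.proj_units)
  interpret p: gset_map G X' X'.CY Z' Z'.CY "arrow_code \<circ> proj Z'"
    by (rule gmap_gset_map[OF tX(1) tZ(1) pX])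
  have emb: "gembedding G (C_galg G X') (C_galg G Z') (pull Z' (arrow_code \<circ> proj Z'))"
    unfolding C_galg_eq_galg
    by (rule p.pull_gembedding) (simp only: image_comp[symmetric] Z'.proj_surj tX(4) unit_gspace_simps
        topspace_unit_top)
  have j: "gucp_map G (C_galg G (unit_gspace G)) A j"
    using ess by (simp add: essential_extension_def gembedding_def)
  have phi: "gucp_map G (C_galg G X') A (j \<circ> pull (unit_gspace G) arrow_code)"
    unfolding gucp_map_def
  proof
    show "ucp_map (C_galg G X') A (j \<circ> pull (unit_gspace G) arrow_code)"
      using x.pull_gucp j unfolding gucp_map_def C_galg_eq_galg by (blast intro: ucp_map_comp)
    have jc: "compatible G (C_galg G (unit_gspace G)) A j" using j by (simp add: gucp_map_def)
    have xc: "compatible G (C_galg G X') (C_galg G (unit_gspace G)) (pull (unit_gspace G) arrow_code)"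
      using x.pull_gucp unfolding gucp_map_def C_galg_eq_galg by blast
    show "compatible G (C_galg G X') A (j \<circ> pull (unit_gspace G) arrow_code)"
      using jc xc x.pull_corner unfolding compatible_def C_galg_eq_galg by simp
  qed
  obtain \<psi> where \<psi>: "gucp_map G (C_galg G Z') A \<psi>"
  proof -
    have "gcstar_algebra G (C_galg G X')" "gcstar_algebra G (C_galg G Z')"
      using X'.gcstar_algebra_galg Z'.gcstar_algebra_galg unfolding C_galg_eq_galg .
    then show thesis using inj emb phi that unfolding ginjective_def by blast
  qed
  have psi_u: "ucp_map (C_galg G Z') A \<psi>" and psi_c: "compatible G (C_galg G Z') A \<psi>"
    using \<psi> by (auto simp: gucp_map_def)
  interpret \<chi>: ucp_pair G Z' Y "\<Phi> \<circ> \<psi>"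
  proof
    show "ucp_map (C_galg G Z') (C_galg G Y) (\<Phi> \<circ> \<psi>)"
      using psi_u Phi_ucp by (rule ucp_map_comp)
    show "(\<Phi> \<circ> \<psi>) (incl (C_galg G Z') k) = incl (C_galg G Y) k" if "k \<in> continuous_functions (unit_top G)" for k
      using psi_c Phi_incl[OF that] that unfolding compatible_def by simp
  qed
  have chi_bact: "(\<Phi> \<circ> \<psi>) (bact (C_galg G Z') \<gamma> f) = bact (C_galg G Y) \<gamma> ((\<Phi> \<circ> \<psi>) f)"
    if \<gamma>: "\<gamma> \<in> open_bisections G" and f: "f \<in> corner G (C_galg G Z') (src G ` \<gamma>)" for \<gamma> f
  proof -
    \<comment> \<open>Compatibility of \<Phi> is stated on corners of A, so \<psi> f has to be
      placed in one, by the domination estimate for its image in \<open>C(Y)\<close>.\<close>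
    have f': "f \<in> Z'.CY" "dominated G Z' (src G ` \<gamma>) f"
      using f unfolding C_galg_eq_galg Z'.corner_eq by auto
    have "\<psi> f \<in> carrier A" using psi_u f'(1) unfolding ucp_map_def C_galg_eq_galg by simp
    moreover have "\<Phi> (\<psi> f) \<in> corner G (C_galg G Y) (src G ` \<gamma>)"
      using \<chi>.psi_in[OF f'(1)] \<chi>.psi_dominated[OF f'] unfolding C_galg_eq_galg corner_eq by simp
    ultimately have "\<psi> f \<in> corner G A (src G ` \<gamma>)" by (rule iso_corner)
    then show ?thesis
      using psi_c Phi_bact[OF \<gamma>] \<gamma> f unfolding compatible_def by simp
  qed
  \<comment> \<open>Composing with the pullback along ?i returns from the copy Z' to Z.\<close>
  let ?i = "the_inv_into (topspace (sptop Z)) e"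
  interpret i: gset_map G Z Z.CY Z' Z'.CY ?i
    by (rule gmap_gset_map[OF Zc tZ(1) tZ(3)])
  interpret \<xi>: gucp_pair G Z Y "\<Phi> \<circ> \<psi> \<circ> pull Z' ?i"
  proof
    show "ucp_map (C_galg G Z) (C_galg G Y) (\<Phi> \<circ> \<psi> \<circ> pull Z' ?i)"
      using i.pull_gucp \<chi>.ucp unfolding gucp_map_def C_galg_eq_galg by (blast intro: ucp_map_comp)
    have ic: "compatible G (C_galg G Z) (C_galg G Z') (pull Z' ?i)"
      using i.pull_gucp unfolding gucp_map_def C_galg_eq_galg by blast
    show "(\<Phi> \<circ> \<psi> \<circ> pull Z' ?i) (incl (C_galg G Z) k) = incl (C_galg G Y) k"
      if "k \<in> continuous_functions (unit_top G)" for k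
      using ic \<chi>.psi_incl[OF that] that unfolding compatible_def by simp
    show "(\<Phi> \<circ> \<psi> \<circ> pull Z' ?i) (bact (C_galg G Z) \<gamma> f) = bact (C_galg G Y) \<gamma> ((\<Phi> \<circ> \<psi> \<circ> pull Z' ?i) f)"
      if \<gamma>: "\<gamma> \<in> open_bisections G" and f: "f \<in> corner G (C_galg G Z) (src G ` \<gamma>)" for \<gamma> f
    proof -
      have "pull Z' ?i f \<in> corner G (C_galg G Z') (src G ` \<gamma>)"
        using i.pull_corner f unfolding C_galg_eq_galg by blast
      then show ?thesis using chi_bact[OF \<gamma>] ic \<gamma> f unfolding compatible_def by simp
    qed
  qed
  show thesis
    using \<xi>.dual_gmap[OF sp irreducible] that by blast
qed

section \<open>Composition of equivariant maps and the isomorphism\<close>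

lemma gmap_comp:
  assumes "gmap G X Y f" "gmap G Y Z g" and "compact_gspace G X"
  shows "gmap G X Z (g \<circ> f)"
proof -
  have c: "continuous_map (sptop X) (sptop Y) f" using assms(1) by (simp add: gmap_def)
  have "f x \<in> topspace (sptop Y)" if "x \<in> topspace (sptop X)" for x
    using continuous_map_image_subset_topspace[OF c] that by blast
  then show ?thesis
    using assms(1,2) unfolding gmap_def by (auto intro: continuous_map_compose simp: act_dom_def)
qed

lemma gmap_id: "gmap G Y Y (\<lambda>y. y)"
  by (simp add: gmap_def)

theorem theorem4p19:
  fixes G :: "'g groupoid"
    and F :: "('g, 'y) gspace"
    and A :: "('g, 'a) gcstar"
    and H :: "('g, 'z) gspace"
  assumes "etale_groupoid G"
    and "compact_space (unit_top G)"
    and "Hausdorff_space (unit_top G)"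
    and "furstenberg_boundary TYPE('g set set) G F"
    and "injective_envelope TYPE('g set set \<Rightarrow> complex) G (C_galg G (unit_gspace G)) A"
    and "is_spectrum G A H"
  shows "isomorphic_gspaces G H F"
proof -
  have cg: "compact_groupoid G"
    using assms(1-3) by (intro compact_groupoid.intro compact_groupoid_axioms.intro)
  have Fb: "gboundary G F" using assms(4) by (simp add: furstenberg_boundary_def)
  have Fc: "compact_galg G F" using cg Fb by (auto simp: gboundary_def intro: compact_galg.intro)
  have Hc: "compact_galg G H" using cg assms(6) by (auto simp: is_spectrum_def intro: compact_galg.intro)
  obtain \<Phi> where iso: "gcstar_iso G A (C_galg G H) \<Phi>" using assms(6) unfolding is_spectrum_def by blast
  obtain j where ess: "essential_extension TYPE('g set set \<Rightarrow> complex) G (C_galg G (unit_gspace G)) A j"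
    and inj: "ginjective TYPE('g set set \<Rightarrow> complex) G A"
    using assms(5) unfolding injective_envelope_def by blast
  have E: "essential_spectrum G H A j \<Phi>"
    using Hc iso ess by (intro essential_spectrum.intro essential_spectrum_axioms.intro)
  interpret E: essential_spectrum G H A j \<Phi> by (rule E)
  obtain q where q: "gmap G H F q" using E.gmap_to_boundary[OF inj Fb] by blast
  \<comment> \<open>The universality of F concerns boundaries in \<open>'g set set\<close>; it is
    applied to a copy of H, and the resulting map is composed with the map back to H.\<close>
  obtain e :: "'z \<Rightarrow> 'g set set" where e: "inj_on e (topspace (sptop H))"
    using E.irreducible_code[OF E.irreducible] by blast
  let ?H = "transport e H" and ?i = "the_inv_into (topspace (sptop H)) e"
  note t = transport_properties[OF Hc e]
  have "essential_spectrum G ?H A j (pull ?H ?i \<circ> \<Phi>)"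
    by (rule is_spectrum_transport[OF E t(1,3,2,5)]) (auto simp: t(4,5))
  then have "gboundary G ?H" by (rule essential_spectrum.gboundary)
  then obtain f where "gmap G F ?H f"
    using assms(4) unfolding furstenberg_boundary_def by blast
  then have f: "gmap G F H (?i \<circ> f)"
    using t(3) Fb by (intro gmap_comp) (auto simp: gboundary_def)
  have Hb: "gboundary G H" by (rule E.gboundary)
  have FF: "gmap G F F (q \<circ> (?i \<circ> f))" and HH: "gmap G H H ((?i \<circ> f) \<circ> q)"
    using gmap_comp[OF f q] gmap_comp[OF q f] Fb Hb by (auto simp: gboundary_def)
  \<comment> \<open>An equivariant self-map of a boundary coincides with the identity by
    \<open>gmap_unique\<close>.\<close>
  have "(q \<circ> (?i \<circ> f)) y = y" if "y \<in> topspace (sptop F)" for y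
    using gmap_unique[OF Fc Fc _ _ FF gmap_id that] Fb by (simp add: gboundary_def)
  moreover have "((?i \<circ> f) \<circ> q) y = y" if "y \<in> topspace (sptop H)" for y
    using gmap_unique[OF Hc Hc _ _ HH gmap_id that] Hb by (simp add: gboundary_def)
  ultimately have "homeomorphic_maps (sptop H) (sptop F) q (?i \<circ> f)"
    using q f unfolding homeomorphic_maps_def gmap_def by auto
  then have "homeomorphic_map (sptop H) (sptop F) q"
    unfolding homeomorphic_map_maps by blast
  then show ?thesis
    unfolding isomorphic_gspaces_def using q by blast
qed


end
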